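(* 1. The $A$-module $\mathrm{der}_K(A)$ does not depend on the choice of generators for the ideal $I$: two finite generating sets of $I$ give the same $A$-submodule of $\mathrm{Der}_K(A)$. 2. The set of natural derivations $\mathrm{der}_K(A)$ does not depend on the presentation of the algebra $A$ as the factor algebra $P_n/I$: if $\sigma:P_n/I\to P_{n'}/I'$ is a $K$-algebra isomorphism, then $\sigma\,\mathrm{der}_K(P_n/I)\,\sigma^{-1}=\mathrm{der}_K(P_{n'}/I')$. 3. The ring $\mathfrak{D}(A)$ of natural differential operators on $A$ does not depend either on the choice of generators for the ideal $I$ or on the presentation of the algebra $A$ as the factor algebra $P_n/I$ (in the same sense as in 1 and 2).
   Context: $K$ is a field of characteristic zero, $P_n=K[x_1,\ldots,x_n]$, $I=\sum_{i=1}^m P_nf_i$ is a prime but not maximal ideal of $P_n$ with generators $f_1,\ldots,f_m$, and $A=P_n/I$, a domain with field of fractions $Q$ (similarly $P_{n'}=K[x_1',\ldots,x_{n'}']$ and $I'$). The image of $p\in P_n$ in $A$ is written $\overline{p}$. $\overline{J}=\left(\overline{\partial f_i/\partial x_j}\right)\in M_{m,n}(A)$ is the Jacobi matrix and $r$ is its rank over $Q$. For tuples $\mathbf{i}=(i_1,\ldots,i_r)$ of indices in $\{1,\ldots,m\}$ and $\mathbf{j}=(j_1,\ldots,j_r)$ of indices in $\{1,\ldots,n\}$, $\Delta(\mathbf{i};j_1,\ldots,j_r)=\det(\overline{J}_{i_\nu,j_\mu})_{\nu,\mu=1,\ldots,r}$. For $1\le i_1<\cdots<i_r\le m$ and $1\le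 j_1<\cdots<j_{r+1}\le n$, $\partial_{\mathbf{i},\mathbf{j}}=\sum_{k=1}^{r+1}(-1)^{r+1+k}\Delta(\mathbf{i};j_1,\ldots,\widehat{j_k},\ldots,j_{r+1})\,\partial/\partial x_{j_k}$ (hat means omitted), i.e. the well-defined $K$-derivation of $A$ sending $x_{j_k}$ to $(-1)^{r+1+k}\Delta(\mathbf{i};j_1,\ldots,\widehat{j_k},\ldots,j_{r+1})$ and $x_l$ to $0$ for $l\notin\{j_1,\ldots,j_{r+1}\}$. For the given presentation and generators, the module of natural derivations $\mathrm{der}_K(A)$ is the left $A$-submodule of $\mathrm{Der}_K(A)$ generated by all the derivations $\partial_{\mathbf{i},\mathbf{j}}$. The algebra of natural differential operators $\mathfrak{D}(A)$ is the subalgebra of $\mathrm{End}_K(A)$ (equivalently, of the ring of differential operators $\mathcal{D}(A)$) generated by $A$ and $\mathrm{der}_K(A)$. *)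

theory Defs
  imports
    "HOL-Algebra.QuotRing"
    "HOL-Algebra.Module"
    "HOL-Algebra.Subrings"
    "HOL-Combinatorics.Permutations"
    "HOL-Library.Poly_Mapping"
begin

section \<open>Polynomials and affine algebras\<close>

text \<open>Polynomials over a field are finitely supported functions from monomials to coefficients, and
  a monomial is a finitely supported function from variable indices to exponents. The ring
  \<open>P\<^sub>n\<close> consists of the polynomials in which only the variables with indices \<open>1, \<dots>, n\<close> occur.\<close>

type_synonym 'k mpoly = "(nat \<Rightarrow>\<^sub>0 nat) \<Rightarrow>\<^sub>0 'k"

definition mvar :: "nat \<Rightarrow> 'k::field mpoly"
  where "mvar j = Poly_Mapping.single (Poly_Mapping.single j 1) 1"

definition mconst :: "'k::field \<Rightarrow> 'k mpoly"
  where "mconst c = Poly_Mapping.single 0 c"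

definition mpoly_ring :: "nat \<Rightarrow> 'k::field mpoly ring"
  where "mpoly_ring n =
    \<lparr>carrier = {p. \<forall>mon \<in> Poly_Mapping.keys p. Poly_Mapping.keys mon \<subseteq> {1..n}},
     monoid.mult = (*), one = 1, zero = 0, add = (+)\<rparr>"

definition mpderiv :: "nat \<Rightarrow> 'k::field mpoly \<Rightarrow> 'k mpoly"
  where "mpderiv j p = (\<Sum>mon \<in> Poly_Mapping.keys p.
    Poly_Mapping.single (mon - Poly_Mapping.single j 1)
      (of_nat (Poly_Mapping.lookup mon j) * Poly_Mapping.lookup p mon))"

text \<open>The \<open>K\<close>-algebra \<open>P\<^sub>n / I\<close>; the scalars are all elements of the type \<open>'k\<close>.\<close>

definition quot_alg :: "nat \<Rightarrow> 'k::field mpoly set \<Rightarrow> ('k, 'k mpoly set) module"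
  where "quot_alg n I = ring.extend (mpoly_ring n Quot I)
    \<lparr>smult = \<lambda>c a. (I +>\<^bsub>mpoly_ring n\<^esub> mconst c) \<otimes>\<^bsub>mpoly_ring n Quot I\<^esub> a\<rparr>"

definition generated_ideal :: "nat \<Rightarrow> nat \<Rightarrow> (nat \<Rightarrow> 'k::field mpoly) \<Rightarrow> 'k mpoly set"
  where "generated_ideal n m f =
    {\<Sum>i = 1..m. g i * f i | g. g \<in> {1..m} \<rightarrow> carrier (mpoly_ring n)}"

definition presents :: "nat \<Rightarrow> 'k::field mpoly set \<Rightarrow> nat \<Rightarrow> (nat \<Rightarrow> 'k mpoly) \<Rightarrow> bool"
  where "presents n I m f \<longleftrightarrow>
    f \<in> {1..m} \<rightarrow> carrier (mpoly_ring n) \<and> I = generated_ideal n m f \<and>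
    primeideal I (mpoly_ring n) \<and> \<not> maximalideal I (mpoly_ring n)"

definition alg_iso :: "('k, 'a) module \<Rightarrow> ('k, 'b) module \<Rightarrow> ('a \<Rightarrow> 'b) set"
  where "alg_iso A B =
    {\<sigma> \<in> ring_iso A B. \<forall>c. \<forall>a \<in> carrier A. \<sigma> (c \<odot>\<^bsub>A\<^esub> a) = c \<odot>\<^bsub>B\<^esub> \<sigma> a}"


section \<open>Field of fractions, determinants and rank\<close>

text \<open>The class of the fraction \<open>a / s\<close> in a domain is the set of all pairs \<open>(b, t)\<close>
  with \<open>a t = b s\<close>.\<close>

definition fraction :: "('a, 'c) ring_scheme \<Rightarrow> 'a \<Rightarrow> 'a \<Rightarrow> ('a \<times> 'a) set"
  where "fraction R a s =
    {(b, t). b \<in> carrier R \<and> t \<in> carrier R - {\<zero>\<^bsub>R\<^esub>} \<and> a \<otimes>\<^bsub>R\<^esub> t = b \<otimes>\<^bsub>R\<^esub> s}"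

text \<open>In sums and products, the union runs over all representatives; for a domain all the classes
  occurring in it coincide.\<close>

definition fraction_field :: "('a, 'c) ring_scheme \<Rightarrow> ('a \<times> 'a) set ring"
  where "fraction_field R =
    \<lparr>carrier = {fraction R a s | a s. a \<in> carrier R \<and> s \<in> carrier R - {\<zero>\<^bsub>R\<^esub>}},
     monoid.mult = \<lambda>X Y. \<Union>(a, s) \<in> X. \<Union>(b, t) \<in> Y. fraction R (a \<otimes>\<^bsub>R\<^esub> b) (s \<otimes>\<^bsub>R\<^esub> t),
     one = fraction R \<one>\<^bsub>R\<^esub> \<one>\<^bsub>R\<^esub>,
     zero = fraction R \<zero>\<^bsub>R\<^esub> \<one>\<^bsub>R\<^esub>,
     add = \<lambda>X Y. \<Union>(a, s) \<in> X. \<Union>(b, t) \<in> Y.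
       fraction R (a \<otimes>\<^bsub>R\<^esub> t \<oplus>\<^bsub>R\<^esub> b \<otimes>\<^bsub>R\<^esub> s) (s \<otimes>\<^bsub>R\<^esub> t)\<rparr>"

text \<open>Matrices are functions of a row and a column index, both starting from 1.\<close>

definition rows_independent ::
    "('a, 'c) ring_scheme \<Rightarrow> nat \<Rightarrow> (nat \<Rightarrow> nat \<Rightarrow> 'a) \<Rightarrow> nat set \<Rightarrow> bool"
  where "rows_independent F n M S \<longleftrightarrow>
    (\<forall>c \<in> S \<rightarrow> carrier F.
      (\<forall>j \<in> {1..n}. (\<Oplus>\<^bsub>F\<^esub>i \<in> S. c i \<otimes>\<^bsub>F\<^esub> M i j) = \<zero>\<^bsub>F\<^esub>) \<longrightarrow> (\<forall>i \<in> S. c i = \<zero>\<^bsub>F\<^esub>))"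

definition matrix_rank ::
    "('a, 'c) ring_scheme \<Rightarrow> nat \<Rightarrow> nat \<Rightarrow> (nat \<Rightarrow> nat \<Rightarrow> 'a) \<Rightarrow> nat"
  where "matrix_rank F m n M = Max (card ` {S. S \<subseteq> {1..m} \<and> rows_independent F n M S})"

definition determinant :: "('a, 'c) ring_scheme \<Rightarrow> nat \<Rightarrow> (nat \<Rightarrow> nat \<Rightarrow> 'a) \<Rightarrow> 'a"
  where "determinant R r M =
    (\<Oplus>\<^bsub>R\<^esub>p \<in> {p. p permutes {1..r}}. [sign p] \<cdot>\<^bsub>R\<^esub> (\<Otimes>\<^bsub>R\<^esub>i \<in> {1..r}. M i (p i)))"


section \<open>Derivations and linear endomorphisms\<close>

text \<open>Here \<open>A\<close> is an algebra over the field \<open>'k\<close>. Maps on \<open>A\<close> are normalised to be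
  \<open>undefined\<close> outside the carrier, so that they are equal iff they agree on \<open>A\<close>.\<close>

definition End_alg :: "('k, 'a) module \<Rightarrow> ('k, 'a \<Rightarrow> 'a) module"
  where "End_alg A =
    \<lparr>carrier = {T \<in> carrier A \<rightarrow>\<^sub>E carrier A.
       (\<forall>x \<in> carrier A. \<forall>y \<in> carrier A. T (x \<oplus>\<^bsub>A\<^esub> y) = T x \<oplus>\<^bsub>A\<^esub> T y) \<and>
       (\<forall>c. \<forall>x \<in> carrier A. T (c \<odot>\<^bsub>A\<^esub> x) = c \<odot>\<^bsub>A\<^esub> T x)},
     monoid.mult = compose (carrier A),
     one = \<lambda>x \<in> carrier A. x,
     zero = \<lambda>x \<in> carrier A. \<zero>\<^bsub>A\<^esub>,
     add = \<lambda>S T. \<lambda>x \<in> carrier A. S x \<oplus>\<^bsub>A\<^esub> T x,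
     smult = \<lambda>c T. \<lambda>x \<in> carrier A. c \<odot>\<^bsub>A\<^esub> T x\<rparr>"

definition Der :: "('k, 'a) module \<Rightarrow> ('a \<Rightarrow> 'a) set"
  where "Der A = {D \<in> carrier (End_alg A).
    \<forall>x \<in> carrier A. \<forall>y \<in> carrier A. D (x \<otimes>\<^bsub>A\<^esub> y) = D x \<otimes>\<^bsub>A\<^esub> y \<oplus>\<^bsub>A\<^esub> x \<otimes>\<^bsub>A\<^esub> D y}"

text \<open>The derivations as a left \<open>A\<close>-module. The multiplicative part of the record type plays no
  role for modules and is left unspecified.\<close>

definition Der_module :: "('k, 'a) module \<Rightarrow> ('a, 'a \<Rightarrow> 'a) module"
  where "Der_module A =
    \<lparr>carrier = Der A,
     monoid.mult = undefined,
     one = undefined,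
     zero = \<zero>\<^bsub>End_alg A\<^esub>,
     add = ring.add (End_alg A),
     smult = \<lambda>a D. \<lambda>x \<in> carrier A. a \<otimes>\<^bsub>A\<^esub> D x\<rparr>"

definition subalgebra_of :: "('k, 'b) module \<Rightarrow> 'b set \<Rightarrow> bool"
  where "subalgebra_of E S \<longleftrightarrow> subring S E \<and> (\<forall>c. \<forall>s \<in> S. c \<odot>\<^bsub>E\<^esub> s \<in> S)"

definition left_mult :: "('k, 'a) module \<Rightarrow> 'a \<Rightarrow> 'a \<Rightarrow> 'a"
  where "left_mult A a = (\<lambda>x \<in> carrier A. a \<otimes>\<^bsub>A\<^esub> x)"

text \<open>\<open>conjugate A B \<sigma> T\<close> is \<open>\<sigma> T \<sigma>\<^sup>-\<^sup>1\<close>.\<close>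

definition conjugate ::
    "('k, 'a) module \<Rightarrow> ('k, 'b) module \<Rightarrow> ('a \<Rightarrow> 'b) \<Rightarrow> ('a \<Rightarrow> 'a) \<Rightarrow> 'b \<Rightarrow> 'b"
  where "conjugate A B \<sigma> T = (\<lambda>y \<in> carrier B. \<sigma> (T (inv_into (carrier A) \<sigma> y)))"


section \<open>Natural derivations and natural differential operators\<close>

definition jacobi_matrix ::
    "nat \<Rightarrow> 'k::field mpoly set \<Rightarrow> (nat \<Rightarrow> 'k mpoly) \<Rightarrow> nat \<Rightarrow> nat \<Rightarrow> 'k mpoly set"
  where "jacobi_matrix n I f i j = I +>\<^bsub>mpoly_ring n\<^esub> mpderiv j (f i)"

definition jacobi_rank :: "nat \<Rightarrow> 'k::field mpoly set \<Rightarrow> nat \<Rightarrow> (nat \<Rightarrow> 'k mpoly) \<Rightarrow> nat"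
  where "jacobi_rank n I m f =
    matrix_rank (fraction_field (quot_alg n I)) m n
      (\<lambda>i j. fraction (quot_alg n I) (jacobi_matrix n I f i j) \<one>\<^bsub>quot_alg n I\<^esub>)"

text \<open>Index tuples are functions of which only the values at \<open>1, \<dots>, r\<close> (respectively
  \<open>1, \<dots>, r + 1\<close>) matter.\<close>

definition jacobi_minor ::
    "nat \<Rightarrow> 'k::field mpoly set \<Rightarrow> (nat \<Rightarrow> 'k mpoly) \<Rightarrow> nat \<Rightarrow> (nat \<Rightarrow> nat) \<Rightarrow> (nat \<Rightarrow> nat)
      \<Rightarrow> 'k mpoly set"
  where "jacobi_minor n I f r i j =
    determinant (quot_alg n I) r (\<lambda>\<nu> \<mu>. jacobi_matrix n I f (i \<nu>) (j \<mu>))"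

definition omit :: "nat \<Rightarrow> (nat \<Rightarrow> nat) \<Rightarrow> nat \<Rightarrow> nat"
  where "omit k j = (\<lambda>\<mu>. if \<mu> < k then j \<mu> else j (\<mu> + 1))"

definition natural_derivation ::
    "nat \<Rightarrow> 'k::field mpoly set \<Rightarrow> (nat \<Rightarrow> 'k mpoly) \<Rightarrow> nat \<Rightarrow> (nat \<Rightarrow> nat) \<Rightarrow> (nat \<Rightarrow> nat)
      \<Rightarrow> 'k mpoly set \<Rightarrow> 'k mpoly set"
  where "natural_derivation n I f r i j =
    (THE D. D \<in> Der (quot_alg n I) \<and>
      (\<forall>k \<in> {1..r + 1}. D (I +>\<^bsub>mpoly_ring n\<^esub> mvar (j k)) =
         [((- 1 :: int) ^ (r + 1 + k))] \<cdot>\<^bsub>quot_alg n I\<^esub> jacobi_minor n I f r i (omit k j)) \<and>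
      (\<forall>l \<in> {1..n} - j ` {1..r + 1}. D (I +>\<^bsub>mpoly_ring n\<^esub> mvar l) = \<zero>\<^bsub>quot_alg n I\<^esub>))"

definition natural_derivations ::
    "nat \<Rightarrow> 'k::field mpoly set \<Rightarrow> nat \<Rightarrow> (nat \<Rightarrow> 'k mpoly) \<Rightarrow> ('k mpoly set \<Rightarrow> 'k mpoly set) set"
  where "natural_derivations n I m f =
    (let r = jacobi_rank n I m f in
     {natural_derivation n I f r i j | i j.
       i \<in> {1..r} \<rightarrow> {1..m} \<and> strict_mono_on {1..r} i \<and>
       j \<in> {1..r + 1} \<rightarrow> {1..n} \<and> strict_mono_on {1..r + 1} j})"

definition nat_der ::
    "nat \<Rightarrow> 'k::field mpoly set \<Rightarrow> nat \<Rightarrow> (nat \<Rightarrow> 'k mpoly) \<Rightarrow> ('k mpoly set \<Rightarrow> 'k mpoly set) set"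
  where "nat_der n I m f =
    (\<lambda>N. submodule N (quot_alg n I) (Der_module (quot_alg n I))) hull natural_derivations n I m f"

definition nat_diff_ops ::
    "nat \<Rightarrow> 'k::field mpoly set \<Rightarrow> nat \<Rightarrow> (nat \<Rightarrow> 'k mpoly) \<Rightarrow> ('k mpoly set \<Rightarrow> 'k mpoly set) set"
  where "nat_diff_ops n I m f =
    subalgebra_of (End_alg (quot_alg n I)) hull
      (left_mult (quot_alg n I) ` carrier (quot_alg n I) \<union> nat_der n I m f)"

end

(*
  In terms of polynomials, A = R/p with R a polynomial ring, and the relations between the
  differentials of the generators x_j form the module N of all vectors (dF/dx_j)_j with F in p.
  A derivation corresponds to a vector w in A^n that annihilates N. For a_1, ..., a_r in N and linear
  forms l_1, ..., l_(r+1) on A^n, the functional u |-> det (l_j (a_1), ..., l_j (a_r), l_j (u)) is such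
  a vector; expanding the determinant multilinearly, the natural derivations span the same
  module as all these "cofactor vectors". This description uses neither the chosen generators of
  the ideal nor the standard basis of A^n. If a redundant generator y is added to the x_j, the rank
  grows by one, and the identity det (M + t l^T) = det M + sum of +- t_i l_j M_ij shows that the
  new cofactor vectors are exactly the old ones, extended by their value on dy. Two presentations
  are compared by adding the generators of either one to those of the other: by the chain rule,
  both ways lead to the same module of relations.
*)

theory Submission
  imports Defs "Jordan_Normal_Form.Determinant"
begin

section \<open>Determinants\<close>

text \<open>The rank r becomes a statement about minors: some r-minor with rows in the relation
  module is nonzero modulo the kernel, and all (r+1)-minors are zero. Only for the Jacobi matrix
  itself is this matched with linear independence over the field of fractions. The obstacle is that
  r is not an invariant of A: it depends on the number of variables, so cofactor vectors of two
  presentations come from determinants of different sizes and cannot be compared directly. Over the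
  joint system of variables X and Y both ranks turn into the same number, r + |Y| = s + |X|, and the
  two spans of cofactor vectors into the same set. A second complication is that the isomorphism and
  its inverse lift to polynomials only as substitutions that are inverse modulo the ideals.
  Independence of the generators of I is the case of the identity isomorphism.\<close>

definition fdet :: "nat \<Rightarrow> (nat \<Rightarrow> nat \<Rightarrow> 'r) \<Rightarrow> 'r::idom"
  where "fdet n M = det (mat n n (\<lambda>(i, j). M i j))"

text \<open>The increasing enumeration of the indices other than i; a matrix composed with such maps
  in both arguments is a minor.\<close>

definition skip :: "nat \<Rightarrow> nat \<Rightarrow> nat"
  where "skip i j = (if j < i then j else Suc j)"

lemma skip_simps [simp]: "j < i \<Longrightarrow> skip i j = j" "i \<le> j \<Longrightarrow> skip i j = Suc j"
  by (auto simp: skip_def)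

lemma skip_less: "j < n \<Longrightarrow> skip i j < Suc n"
  by (auto simp: skip_def)

lemma fdet_cong: "(\<And>i j. i < n \<Longrightarrow> j < n \<Longrightarrow> M i j = M' i j) \<Longrightarrow> fdet n M = fdet n M'"
  unfolding fdet_def by (rule arg_cong[where f = det], rule eq_matI) auto

lemma fdet_0 [simp]: "fdet 0 M = 1"
  by (simp add: fdet_def)

lemma fdet_transpose: "fdet n (\<lambda>i j. M j i) = fdet n M"
proof -
  have "mat n n (\<lambda>(i, j). M j i) = transpose_mat (mat n n (\<lambda>(i, j). M i j))"
    by (rule eq_matI) auto
  then show ?thesis
    unfolding fdet_def by (simp add: det_transpose[of _ n])
qed

lemma fdet_laplace_row:
  assumes "i < Suc n"
  shows "fdet (Suc n) M
    = (\<Sum>j<Suc n. M i j * ((-1) ^ (i + j) * fdet n (\<lambda>i' j'. M (skip i i') (skip j j'))))"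
proof -
  let ?A = "mat (Suc n) (Suc n) (\<lambda>(i, j). M i j)"
  have del: "mat_delete ?A i j = mat n n (\<lambda>(i', j'). M (skip i i') (skip j j'))" for j
    by (rule eq_matI) (auto simp: mat_delete_def skip_def)
  have "fdet (Suc n) M = (\<Sum>j<Suc n. ?A $$ (i, j) * cofactor ?A i j)"
    unfolding fdet_def using assms by (intro laplace_expansion_row) auto
  also have "\<dots> = (\<Sum>j<Suc n. M i j * ((-1) ^ (i + j) * fdet n (\<lambda>i' j'. M (skip i i') (skip j j'))))"
    using assms by (intro sum.cong) (auto simp: cofactor_def del fdet_def)
  finally show ?thesis .
qed

lemma fdet_laplace_column:
  assumes "j < Suc n"
  shows "fdet (Suc n) M
    = (\<Sum>i<Suc n. M i j * ((-1) ^ (i + j) * fdet n (\<lambda>i' j'. M (skip i i') (skip j j'))))"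
proof -
  have "fdet (Suc n) M = fdet (Suc n) (\<lambda>i j. M j i)"
    by (rule fdet_transpose[symmetric])
  also have "\<dots> = (\<Sum>i<Suc n. M i j * ((-1) ^ (j + i) * fdet n (\<lambda>i' j'. M (skip i j') (skip j i'))))"
    by (rule fdet_laplace_row[OF assms])
  also have "\<dots> = (\<Sum>i<Suc n. M i j * ((-1) ^ (i + j) * fdet n (\<lambda>i' j'. M (skip i i') (skip j j'))))"
    by (simp add: fdet_transpose[of n "\<lambda>i' j'. M (skip _ i') (skip j j')"] add.commute)
  finally show ?thesis .
qed

lemma fdet_identical_rows:
  assumes "i \<noteq> i'" "i < n" "i' < n" "\<And>j. j < n \<Longrightarrow> M i j = M i' j"
  shows "fdet n M = 0"
  unfolding fdet_def
  by (rule det_identical_rows[of _ n i i']) (use assms in \<open>auto intro!: eq_vecI\<close>)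

lemma fdet_permute_rows:
  assumes "p permutes {..<n}"
  shows "fdet n (\<lambda>i. M (p i)) = of_int (sign p) * fdet n M"
proof -
  have p: "p permutes {0..<n}"
    using assms by (simp add: lessThan_atLeast0)
  have "mat n n (\<lambda>(i, j). M (p i) j) = mat n n (\<lambda>(i, j). mat n n (\<lambda>(i, j). M i j) $$ (p i, j))"
    using permutes_in_image[OF p] by (intro eq_matI) auto
  then show ?thesis
    unfolding fdet_def by (subst det_permute_rows[OF _ p, symmetric]) auto
qed

text \<open>Border the matrix: for B = [[M, t], [-l, 1]] and C = [[1, 0], [l, 1]] the product B C is
  [[M + t l, t], [0, 1]]. As det C = 1, the left-hand side is det B. Expanding det B along its last
  row, and the resulting minors along the column t, gives the sum.\<close>

lemma fdet_add_rank_one: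
  fixes M :: "nat \<Rightarrow> nat \<Rightarrow> 'r::idom"
  shows "fdet (Suc n) (\<lambda>i j. M i j + t i * l j) = fdet (Suc n) M
    + (\<Sum>i<Suc n. \<Sum>j<Suc n. (-1) ^ (i + j) * t i * l j * fdet n (\<lambda>i' j'. M (skip i i') (skip j j')))"
proof -
  define m where "m = Suc n"
  define B where "B = (\<lambda>i j. if i < m then (if j < m then M i j else t i) else if j < m then - l j else 1)"
  define C where "C = (\<lambda>i j. if i = j then 1 else if i = m \<and> j < m then l j else 0 :: 'r)"
  let ?mat = "\<lambda>f. mat (Suc m) (Suc m) (\<lambda>(i, j). f i j :: 'r)"
  define BC where "BC = (\<lambda>i j. \<Sum>k<Suc m. B i k * C k j)"
  have BC: "BC i j = (if i < m then (if j < m then M i j + t i * l j else t i) else if j < m then 0 else 1)"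
    if "i < Suc m" "j < Suc m" for i j
  proof -
    have "BC i j = B i j * C j j + (if j < m then B i m * C m j else 0)"
    proof (cases "j < m")
      case True
      have "BC i j = (\<Sum>k\<in>{j, m}. B i k * C k j)"
        unfolding BC_def using True by (intro sum.mono_neutral_right) (auto simp: C_def)
      then show ?thesis using True by simp
    next
      case False
      have "BC i j = (\<Sum>k\<in>{j}. B i k * C k j)"
        unfolding BC_def using False that by (intro sum.mono_neutral_right) (auto simp: C_def)
      then show ?thesis using False by simp
    qed
    then show ?thesis using that by (auto simp: B_def C_def)
  qed
  have "fdet (Suc m) BC = fdet (Suc m) B * fdet (Suc m) C"
  proof -
    have "?mat BC = ?mat B * ?mat C"
      by (rule eq_matI) (auto simp: BC_def scalar_prod_def lessThan_atLeast0)
    then show ?thesis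
      unfolding fdet_def by (simp add: det_mult[of _ "Suc m"])
  qed
  moreover have "fdet (Suc m) C = 1"
  proof -
    have "det (?mat C) = prod_list (diag_mat (?mat C))"
      by (rule det_lower_triangular[of "Suc m"]) (auto simp: C_def)
    also have "diag_mat (?mat C) = map (\<lambda>i. 1) [0..<Suc m]"
      by (auto simp: diag_mat_def C_def)
    finally show ?thesis by (simp add: fdet_def map_replicate_const)
  qed
  moreover have "fdet (Suc m) BC = fdet m (\<lambda>i j. M i j + t i * l j)"
  proof -
    have "fdet (Suc m) BC
        = (\<Sum>j<Suc m. BC m j * ((-1) ^ (m + j) * fdet m (\<lambda>i' j'. BC (skip m i') (skip j j'))))"
      by (rule fdet_laplace_row) simp
    also have "\<dots> = fdet m (\<lambda>i' j'. BC (skip m i') (skip m j'))"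
      by (simp add: BC)
    also have "\<dots> = fdet m (\<lambda>i j. M i j + t i * l j)"
      by (rule fdet_cong) (simp add: BC)
    finally show ?thesis .
  qed
  moreover have "fdet (Suc m) B = fdet m M
    + (\<Sum>j<m. \<Sum>i<m. (-1) ^ (i + j) * t i * l j * fdet n (\<lambda>i' j'. M (skip i i') (skip j j')))"
  proof -
    have minor: "fdet m (\<lambda>i' j'. B (skip m i') (skip j j'))
        = (\<Sum>i<m. t i * ((-1) ^ (i + n) * fdet n (\<lambda>i' j'. M (skip i i') (skip j j'))))" if "j < m" for j
    proof -
      let ?B = "\<lambda>i' j'. B (skip m i') (skip j j')"
      have "fdet m ?B
          = (\<Sum>i<Suc n. ?B i n * ((-1) ^ (i + n) * fdet n (\<lambda>i' j'. ?B (skip i i') (skip n j'))))"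
        unfolding m_def by (rule fdet_laplace_column) simp
      also have "\<dots> = (\<Sum>i<Suc n. t i * ((-1) ^ (i + n) * fdet n (\<lambda>i' j'. M (skip i i') (skip j j'))))"
      proof (rule sum.cong[OF refl])
        fix i assume "i \<in> {..<Suc n}"
        then have "?B i n = t i"
          using that by (auto simp: B_def m_def)
        moreover have "fdet n (\<lambda>i' j'. ?B (skip i i') (skip n j')) = fdet n (\<lambda>i' j'. M (skip i i') (skip j j'))"
          using that skip_less[of _ n] by (intro fdet_cong) (auto simp: B_def m_def)
        ultimately show "?B i n * ((-1) ^ (i + n) * fdet n (\<lambda>i' j'. ?B (skip i i') (skip n j')))
            = t i * ((-1) ^ (i + n) * fdet n (\<lambda>i' j'. M (skip i i') (skip j j')))"
          by simp
      qed
      finally show ?thesis by (simp add: m_def)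
    qed
    have "fdet (Suc m) B
        = (\<Sum>j<Suc m. B m j * ((-1) ^ (m + j) * fdet m (\<lambda>i' j'. B (skip m i') (skip j j'))))"
      by (rule fdet_laplace_row) simp
    also have "\<dots> = (\<Sum>j<m. B m j * ((-1) ^ (m + j) * fdet m (\<lambda>i' j'. B (skip m i') (skip j j'))))
        + fdet m (\<lambda>i' j'. B (skip m i') (skip m j'))"
      by (simp add: B_def)
    also have "fdet m (\<lambda>i' j'. B (skip m i') (skip m j')) = fdet m M"
      by (rule fdet_cong) (simp add: B_def)
    also have "(\<Sum>j<m. B m j * ((-1) ^ (m + j) * fdet m (\<lambda>i' j'. B (skip m i') (skip j j'))))
        = (\<Sum>j<m. \<Sum>i<m. (-1) ^ (i + j) * t i * l j * fdet n (\<lambda>i' j'. M (skip i i') (skip j j')))"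
    proof (rule sum.cong[OF refl])
      fix j assume j: "j \<in> {..<m}"
      then have Bm: "B m j = - l j" by (simp add: B_def)
      \<comment> \<open>Besides (-1)^(i + j) there is a sign -1 from the entry -l_j and a sign
        (-1)^(m + n) = -1, as m = n + 1; they cancel.\<close>
      have "- l j * ((-1) ^ (m + j) * (t i * ((-1) ^ (i + n) * x))) = (-1) ^ (i + j) * t i * l j * x"
        for i x
        by (simp add: m_def power_add)
      then show "B m j * ((-1) ^ (m + j) * fdet m (\<lambda>i' j'. B (skip m i') (skip j j')))
          = (\<Sum>i<m. (-1) ^ (i + j) * t i * l j * fdet n (\<lambda>i' j'. M (skip i i') (skip j j')))"
        using j minor[of j] by (simp only: Bm sum_distrib_left lessThan_iff)
    qed
    finally show ?thesis by simp
  qed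
  ultimately show ?thesis
    unfolding m_def[symmetric] by (subst sum.swap) simp
qed

section \<open>Cofactor vectors modulo an ideal\<close>

definition dot :: "'i set \<Rightarrow> ('i \<Rightarrow> 'r) \<Rightarrow> ('i \<Rightarrow> 'r) \<Rightarrow> 'r::comm_ring_1"
  where "dot J u v = (\<Sum>x\<in>J. u x * v x)"

lemma dot_commute: "dot J u v = dot J v u"
  by (simp add: dot_def mult.commute)

lemma dot_add_left: "dot J (\<lambda>x. u x + v x) w = dot J u w + dot J v w"
  by (simp add: dot_def sum.distrib algebra_simps)

lemma dot_scale_left: "dot J (\<lambda>x. c * u x) w = c * dot J u w"
  by (simp add: dot_def sum_distrib_left algebra_simps)

lemma dot_diff_right: "dot J w (\<lambda>x. u x - v x) = dot J w u - dot J w v"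
  by (simp add: dot_def algebra_simps sum_subtractf)

lemma dot_add_right: "dot J w (\<lambda>x. u x + v x) = dot J w u + dot J w v"
  by (simp add: dot_def algebra_simps sum.distrib)

lemma dot_scale_right: "dot J w (\<lambda>x. c * u x) = c * dot J w u"
  by (simp add: dot_def algebra_simps sum_distrib_left)

lemma dot_zero [simp]: "dot J (\<lambda>_. 0) w = 0" "dot J w (\<lambda>_. 0) = 0"
  by (simp_all add: dot_def)

lemma dot_unit: "finite J \<Longrightarrow> x \<in> J \<Longrightarrow> dot J (\<lambda>z. of_bool (z = x)) w = w x"
  by (simp add: dot_def of_bool_def if_distrib[of "\<lambda>a. a * _"] cong: if_cong)

lemma dot_cong: "(\<And>x. x \<in> J \<Longrightarrow> u x = u' x) \<Longrightarrow> (\<And>x. x \<in> J \<Longrightarrow> v x = v' x) \<Longrightarrow> dot J u v = dot J u' v'"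
  by (auto simp: dot_def intro!: sum.cong)

lemma dot_sum_right: "dot J u (\<lambda>x. \<Sum>i\<in>S. c i * v i x) = (\<Sum>i\<in>S. c i * dot J u (v i))"
  unfolding dot_def sum_distrib_left by (subst sum.swap) (simp add: mult.left_commute)

text \<open>Only the values of the forms l on the vectors a enter, so no coordinates are singled
  out; for coordinate functionals l this is an ordinary minor of the matrix with rows a.\<close>

definition mdet :: "nat \<Rightarrow> 'i set \<Rightarrow> (nat \<Rightarrow> 'i \<Rightarrow> 'r) \<Rightarrow> (nat \<Rightarrow> 'i \<Rightarrow> 'r) \<Rightarrow> 'r::idom"
  where "mdet k J a l = fdet k (\<lambda>i j. dot J (a i) (l j))"

lemma mdet_commute: "mdet k J a l = mdet k J l a"
  unfolding mdet_def by (subst fdet_transpose[symmetric]) (simp add: dot_commute)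

lemma mdet_cong:
  assumes "\<And>i x. i < k \<Longrightarrow> x \<in> J \<Longrightarrow> a i x = a' i x" "\<And>i x. i < k \<Longrightarrow> x \<in> J \<Longrightarrow> l i x = l' i x"
  shows "mdet k J a l = mdet k J a' l'"
  unfolding mdet_def using assms by (intro fdet_cong dot_cong) auto

lemma mdet_0 [simp]: "mdet 0 J a l = 1"
  by (simp add: mdet_def)

lemma mdet_permute:
  assumes "p permutes {..<k}"
  shows "mdet k J (a \<circ> p) l = of_int (sign p) * mdet k J a l"
  using fdet_permute_rows[OF assms, of "\<lambda>i j. dot J (a i) (l j)"] by (simp add: mdet_def)

lemma mdet_identical:
  assumes "i \<noteq> i'" "i < k" "i' < k" "a i = a i'"
  shows "mdet k J a l = 0"
  unfolding mdet_def by (rule fdet_identical_rows[OF assms(1-3)]) (simp add: assms(4))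

lemma mdet_laplace:
  assumes "s < Suc k"
  shows "mdet (Suc k) J a l
    = (\<Sum>j<Suc k. dot J (a s) (l j) * ((-1) ^ (s + j) * mdet k J (a \<circ> skip s) (l \<circ> skip j)))"
  unfolding mdet_def by (subst fdet_laplace_row[OF assms]) simp

text \<open>Laplace expansion along row s, where the remaining rows do not involve u. The vector G
  is kept anonymous, since it serves only to express linearity in that row.\<close>

lemma mdet_row_linear:
  assumes "s < k"
  shows "\<exists>G. \<forall>u. mdet k J (a(s := u)) l = dot J u G"
proof -
  obtain n where k: "k = Suc n"
    using assms by (cases k) auto
  define c where "c = (\<lambda>j. (-1) ^ (s + j) * mdet n J (a \<circ> skip s) (l \<circ> skip j))"
  have skip: "a(s := u) \<circ> skip s = a \<circ> skip s" for u
    by (auto simp: fun_eq_iff skip_def)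
  have "mdet k J (a(s := u)) l = dot J u (\<lambda>x. \<Sum>j<Suc n. l j x * c j)" for u
  proof -
    have "mdet k J (a(s := u)) l = (\<Sum>j<Suc n. dot J u (l j) * c j)"
      unfolding k using assms k by (subst mdet_laplace[of s]) (simp_all add: c_def skip del: sum.lessThan_Suc)
    also have "\<dots> = (\<Sum>j<Suc n. \<Sum>x\<in>J. u x * (l j x * c j))"
      by (simp add: dot_def sum_distrib_right mult.assoc del: sum.lessThan_Suc)
    also have "\<dots> = (\<Sum>x\<in>J. \<Sum>j<Suc n. u x * (l j x * c j))"
      by (rule sum.swap)
    also have "\<dots> = dot J u (\<lambda>x. \<Sum>j<Suc n. l j x * c j)"
      by (simp add: dot_def sum_distrib_left del: sum.lessThan_Suc)
    finally show ?thesis .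
  qed
  then show ?thesis by blast
qed

text \<open>The vector representing the functional that maps u to the determinant with last row u;
  its coefficients are the cofactors of that row. Row k is the last of k + 1 rows counted from 0,
  hence the sign \<open>(-1) ^ (k + j)\<close>.\<close>

definition cvec :: "nat \<Rightarrow> 'i set \<Rightarrow> (nat \<Rightarrow> 'i \<Rightarrow> 'r) \<Rightarrow> (nat \<Rightarrow> 'i \<Rightarrow> 'r) \<Rightarrow> 'i \<Rightarrow> 'r::idom"
  where "cvec k J a l x = (\<Sum>j<Suc k. l j x * ((-1) ^ (k + j) * mdet k J a (l \<circ> skip j)))"

lemma mdet_last: "mdet (Suc k) J (a(k := u)) l = dot J u (cvec k J a l)"
proof -
  have "mdet (Suc k) J (a(k := u)) l = (\<Sum>j<Suc k. dot J u (l j) * ((-1) ^ (k + j) * mdet k J a (l \<circ> skip j)))"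
    by (subst mdet_laplace[of k])
      (auto intro!: sum.cong mdet_cong simp del: sum.lessThan_Suc)
  also have "\<dots> = (\<Sum>j<Suc k. \<Sum>x\<in>J. u x * (l j x * ((-1) ^ (k + j) * mdet k J a (l \<circ> skip j))))"
    by (simp add: dot_def sum_distrib_right mult.assoc del: sum.lessThan_Suc)
  also have "\<dots> = (\<Sum>x\<in>J. \<Sum>j<Suc k. u x * (l j x * ((-1) ^ (k + j) * mdet k J a (l \<circ> skip j))))"
    by (rule sum.swap)
  also have "\<dots> = dot J u (cvec k J a l)"
    by (simp add: dot_def cvec_def sum_distrib_left del: sum.lessThan_Suc)
  finally show ?thesis .
qed

lemma mdet_Suc: "mdet (Suc k) J a l = dot J (a k) (cvec k J a l)"
  using mdet_last[of k J a "a k" l] by simp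

lemma cvec_eq_mdet:
  assumes "finite J" "x \<in> J"
  shows "cvec k J a l x = mdet (Suc k) J (a(k := (\<lambda>z. of_bool (z = x)))) l"
  using assms by (simp add: mdet_last dot_unit)

text \<open>Eliminating dy = sum of p_x dx turns the row b_i into b'_i. The pairing over
  \<open>insert y J\<close> exceeds the pairing of b'_i over J by b_i(y) times the defect
  \<open>l j y - dot J p (l j)\<close>, and these products form a matrix of rank one.\<close>

lemma mdet_insert:
  fixes b :: "nat \<Rightarrow> 'i \<Rightarrow> 'r::idom" and p :: "'i \<Rightarrow> 'r"
  assumes "finite J" "y \<notin> J"
  defines "b' \<equiv> \<lambda>i x. b i x + b i y * p x"
  shows "mdet (Suc k) (insert y J) b l = mdet (Suc k) J b' l
    + (\<Sum>i<Suc k. \<Sum>j<Suc k. (-1) ^ (i + j) * b i y * (l j y - dot J p (l j)) * mdet k J (b' \<circ> skip i) (l \<circ> skip j))"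
proof -
  have "dot (insert y J) (b i) (l j) = dot J (b' i) (l j) + b i y * (l j y - dot J p (l j))" for i j
  proof -
    have "dot J (b' i) (l j) = dot J (b i) (l j) + b i y * dot J p (l j)"
      unfolding b'_def by (simp add: dot_add_left dot_scale_left)
    moreover have "dot (insert y J) (b i) (l j) = b i y * l j y + dot J (b i) (l j)"
      using assms by (simp add: dot_def)
    ultimately show ?thesis by (simp add: algebra_simps)
  qed
  then show ?thesis
    unfolding mdet_def by (simp only: fdet_add_rank_one comp_def)
qed

section \<open>Congruences modulo an ideal, spans and ranks\<close>

locale coeff_ideal =
  fixes \<pp> :: "'r::idom set"
  assumes zero_mem: "0 \<in> \<pp>"
    and add_mem: "a \<in> \<pp> \<Longrightarrow> b \<in> \<pp> \<Longrightarrow> a + b \<in> \<pp>"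
    and mult_mem: "b \<in> \<pp> \<Longrightarrow> a * b \<in> \<pp>"
begin

abbreviation cong (infix "\<approx>" 50) where "a \<approx> b \<equiv> a - b \<in> \<pp>"

lemma uminus_mem: "a \<in> \<pp> \<Longrightarrow> - a \<in> \<pp>"
  using mult_mem[of a "-1"] by simp

lemma diff_mem: "a \<in> \<pp> \<Longrightarrow> b \<in> \<pp> \<Longrightarrow> a - b \<in> \<pp>"
  using add_mem[of a "- b"] uminus_mem[of b] by simp

lemma sum_mem: "(\<And>x. x \<in> S \<Longrightarrow> f x \<in> \<pp>) \<Longrightarrow> sum f S \<in> \<pp>"
  by (induction S rule: infinite_finite_induct) (auto intro: zero_mem add_mem)

lemma cong_refl [simp]: "a \<approx> a"
  by (simp add: zero_mem)

lemma cong_sym: "a \<approx> b \<Longrightarrow> b \<approx> a"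
  using uminus_mem[of "a - b"] by simp

lemma cong_trans: "a \<approx> b \<Longrightarrow> b \<approx> c \<Longrightarrow> a \<approx> c"
  using add_mem[of "a - b" "b - c"] by simp

lemma cong_add: "a \<approx> b \<Longrightarrow> c \<approx> d \<Longrightarrow> a + c \<approx> b + d"
  using add_mem[of "a - b" "c - d"] by (simp add: algebra_simps)

lemma cong_mult: "a \<approx> b \<Longrightarrow> c \<approx> d \<Longrightarrow> a * c \<approx> b * d"
proof -
  assume "a \<approx> b" "c \<approx> d"
  then have "c * (a - b) + b * (c - d) \<in> \<pp>"
    by (intro add_mem mult_mem)
  then show ?thesis by (simp add: algebra_simps)
qed

lemma cong_sum: "(\<And>x. x \<in> S \<Longrightarrow> f x \<approx> g x) \<Longrightarrow> sum f S \<approx> sum g S"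
  using sum_mem[of S "\<lambda>x. f x - g x"] by (simp add: sum_subtractf)

lemma cong_dot: "(\<And>x. x \<in> J \<Longrightarrow> u x \<approx> u' x) \<Longrightarrow> (\<And>x. x \<in> J \<Longrightarrow> v x \<approx> v' x) \<Longrightarrow> dot J u v \<approx> dot J u' v'"
  unfolding dot_def by (intro cong_sum cong_mult) auto

lemma cong_mem: "a \<approx> b \<Longrightarrow> b \<in> \<pp> \<Longrightarrow> a \<in> \<pp>"
  using add_mem[of "a - b" b] by simp

text \<open>Vectors are functions on the whole index type of which only the entries in \<open>J\<close>, and these only
  modulo \<open>\<pp>\<close>, matter.\<close>

inductive_set cspan :: "'i set \<Rightarrow> ('i \<Rightarrow> 'r) set \<Rightarrow> ('i \<Rightarrow> 'r) set" for J B
  where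
    cspan_base: "b \<in> B \<Longrightarrow> b \<in> cspan J B"
  | cspan_zero: "(\<lambda>_. 0) \<in> cspan J B"
  | cspan_add: "u \<in> cspan J B \<Longrightarrow> v \<in> cspan J B \<Longrightarrow> (\<lambda>x. u x + v x) \<in> cspan J B"
  | cspan_scale: "u \<in> cspan J B \<Longrightarrow> (\<lambda>x. c * u x) \<in> cspan J B"
  | cspan_cong: "u \<in> cspan J B \<Longrightarrow> (\<And>x. x \<in> J \<Longrightarrow> v x \<approx> u x) \<Longrightarrow> v \<in> cspan J B"

lemma cspan_sum:
  "(\<And>i. i \<in> S \<Longrightarrow> u i \<in> cspan J B) \<Longrightarrow> (\<lambda>x. \<Sum>i\<in>S. c i * u i x) \<in> cspan J B"
proof (induction S rule: infinite_finite_induct)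
  case (insert i S)
  have "(\<lambda>x. c i * u i x + (\<Sum>i\<in>S. c i * u i x)) \<in> cspan J B"
    using insert by (intro cspan_add[of "\<lambda>x. c i * u i x"] cspan_scale) simp_all
  then show ?case using insert.hyps by simp
qed (simp_all add: cspan_zero)

text \<open>For a prime ideal this says that N has rank below k over the fractions of the residue
  ring, without any division or choice of generators.\<close>

definition minors_vanish :: "'i set \<Rightarrow> ('i \<Rightarrow> 'r) set \<Rightarrow> nat \<Rightarrow> bool"
  where "minors_vanish J N k \<longleftrightarrow> (\<forall>a l. (\<forall>i<k. a i \<in> N) \<longrightarrow> mdet k J a l \<in> \<pp>)"

definition rank_is :: "'i set \<Rightarrow> ('i \<Rightarrow> 'r) set \<Rightarrow> nat \<Rightarrow> bool"
  where "rank_is J N r \<longleftrightarrow> \<not> minors_vanish J N r \<and> minors_vanish J N (Suc r)"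

definition cof :: "'i set \<Rightarrow> ('i \<Rightarrow> 'r) set \<Rightarrow> nat \<Rightarrow> ('i \<Rightarrow> 'r) set"
  where "cof J N r = cspan J {cvec r J a l | a l. \<forall>i<r. a i \<in> N}"

lemma minors_vanish_Suc:
  assumes "minors_vanish J N k"
  shows "minors_vanish J N (Suc k)"
  unfolding minors_vanish_def
proof (intro allI impI)
  fix a l assume "\<forall>i<Suc k. a i \<in> N"
  then have "mdet k J a (l \<circ> skip j) \<in> \<pp>" for j
    using assms by (simp add: minors_vanish_def)
  then show "mdet (Suc k) J a l \<in> \<pp>"
    unfolding mdet_Suc dot_def cvec_def by (intro sum_mem mult_mem)
qed

text \<open>This is what forces the two ranks computed over a joint index set to agree. Vanishing of
  the k-minors is inherited by larger sizes, so there is only one place where it can begin.\<close>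

lemma rank_is_unique:
  assumes "rank_is J N r" "rank_is J N s"
  shows "r = s"
proof -
  have mono: "minors_vanish J N k \<Longrightarrow> k \<le> k' \<Longrightarrow> minors_vanish J N k'" for k k'
    by (rule dec_induct) (auto intro: minors_vanish_Suc)
  show ?thesis
    using assms mono[of "Suc r" s] mono[of "Suc s" r] unfolding rank_is_def
    by (metis Suc_leI linorder_neqE_nat)
qed

end

section \<open>Adjoining one redundant generator\<close>

text \<open>\<open>N\<close> consists of the relations between generators indexed by \<open>J\<close>, and \<open>N'\<close> of the relations after
  a redundant generator \<open>y\<close> with \<open>dy = \<Sum>\<^sub>x p\<^sub>x dx\<close> has been added. In a basis adapted to this,
  the matrix of pairings of \<open>mdet\<close> changes by a matrix of rank one.\<close>

locale index_extension = coeff_ideal +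
  fixes J :: "'i set" and y :: 'i and p :: "'i \<Rightarrow> 'a" and N N' :: "('i \<Rightarrow> 'a) set"
  assumes fin: "finite J" and y: "y \<notin> J"
    and project: "b \<in> N' \<Longrightarrow> (\<lambda>x. b x + b y * p x) \<in> N"
    and embed: "a \<in> N \<Longrightarrow> a(y := 0) \<in> N'"
    and new_relation: "(\<lambda>x. - p x)(y := 1) \<in> N'"
begin

text \<open>The pairing of u with the new cofactor vector is an (r+2)-determinant, to which
  \<open>mdet_insert\<close> applies. Its leading term and the terms omitting the row of u contain
  (r+1)-minors with rows in N, so they vanish modulo the ideal. Each remaining term pairs the
  eliminated u with a cofactor vector of r rows over J.\<close>

lemma cof_project_base:
  assumes van: "minors_vanish J N (Suc r)" and a: "\<forall>i<Suc r. a i \<in> N'"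
  shows "cvec (Suc r) (insert y J) a l \<in> cof J N r \<and>
    cvec (Suc r) (insert y J) a l y \<approx> dot J p (cvec (Suc r) (insert y J) a l)"
proof -
  define w where "w = cvec (Suc r) (insert y J) a l"
  define a' where "a' = (\<lambda>i x. a i x + a i y * p x)"
  have a': "\<forall>i<Suc r. a' i \<in> N"
    using a project by (simp add: a'_def)
  define c where "c = (\<lambda>i j. (-1) ^ (i + j) * a i y * (l j y - dot J p (l j)))"
  define v1 where "v1 = (\<lambda>i x. \<Sum>j<Suc (Suc r). c i j * cvec r J (a' \<circ> skip i) (l \<circ> skip j) x)"
  define v where "v = (\<lambda>x. \<Sum>i<Suc r. 1 * v1 i x)"
  have "cvec r J (a' \<circ> skip i) (l \<circ> skip j) \<in> cof J N r" for i j
  proof -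
    have "\<forall>i'<r. (a' \<circ> skip i) i' \<in> N"
      using a' skip_less by simp
    then show ?thesis
      unfolding cof_def by (blast intro: cspan_base)
  qed
  then have v: "v \<in> cof J N r"
    unfolding v_def v1_def cof_def by (intro cspan_sum)
  have key: "dot (insert y J) u w \<approx> dot J (\<lambda>x. u x + u y * p x) v" for u
  proof -
    define u' where "u' = (\<lambda>x. u x + u y * p x)"
    define b where "b = a(Suc r := u)"
    have b': "(\<lambda>i x. b i x + b i y * p x) = a'(Suc r := u')"
      by (auto simp: b_def a'_def u'_def fun_eq_iff)
    have 1: "mdet (Suc (Suc r)) J (a'(Suc r := u')) l \<approx> 0"
    proof -
      have "mdet (Suc r) J a' (l \<circ> skip j) \<in> \<pp>" for j
        using van a' by (simp add: minors_vanish_def)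
      then show ?thesis
        unfolding mdet_last dot_def cvec_def diff_zero by (intro sum_mem mult_mem)
    qed
    have 2: "mdet (Suc r) J (a'(Suc r := u') \<circ> skip (Suc r)) (l \<circ> skip j) \<approx> 0" for j
    proof -
      have "mdet (Suc r) J (a'(Suc r := u') \<circ> skip (Suc r)) (l \<circ> skip j) = mdet (Suc r) J a' (l \<circ> skip j)"
        by (rule mdet_cong) auto
      then show ?thesis
        using van a' by (simp add: minors_vanish_def)
    qed
    have 3: "mdet (Suc r) J (a'(Suc r := u') \<circ> skip i) (l \<circ> skip j)
        = dot J u' (cvec r J (a' \<circ> skip i) (l \<circ> skip j))" if "i < Suc r" for i j
    proof -
      have "a'(Suc r := u') \<circ> skip i = (a' \<circ> skip i)(r := u')"
        using that by (auto simp: fun_eq_iff skip_def)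
      then show ?thesis by (simp add: mdet_last)
    qed
    let ?c = "\<lambda>i j. (-1) ^ (i + j) * b i y * (l j y - dot J p (l j))"
    let ?M = "\<lambda>i j. mdet (Suc r) J (a'(Suc r := u') \<circ> skip i) (l \<circ> skip j)"
    let ?d = "mdet (Suc (Suc r)) J (a'(Suc r := u')) l"
    let ?S = "\<Sum>i<Suc r. \<Sum>j<Suc (Suc r). ?c i j * ?M i j"
    let ?T = "\<Sum>j<Suc (Suc r). ?c (Suc r) j * ?M (Suc r) j"
    let ?Z = "\<Sum>j<Suc (Suc r). ?c (Suc r) j * 0"
    have "dot (insert y J) u w = mdet (Suc (Suc r)) (insert y J) b l"
      unfolding b_def w_def mdet_last ..
    also have "\<dots> = mdet (Suc (Suc r)) J (a'(Suc r := u')) l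
        + (\<Sum>i<Suc (Suc r). \<Sum>j<Suc (Suc r). ?c i j * ?M i j)"
      by (subst mdet_insert[OF fin y, where p = p]) (simp only: b')
    also have "\<dots> = ?d + (?S + ?T)"
      by (subst sum.lessThan_Suc[of _ "Suc r"]) (rule refl)
    finally have A: "dot (insert y J) u w = ?d + (?S + ?T)" .
    have B: "?d + (?S + ?T) \<approx> 0 + (?S + ?Z)"
      by (intro cong_add cong_sum cong_mult 1 2 cong_refl)
    have C: "0 + (?S + ?Z) = dot J u' v"
    proof -
      have "?c i j * ?M i j = c i j * dot J u' (cvec r J (a' \<circ> skip i) (l \<circ> skip j))"
        if "i \<in> {..<Suc r}" for i j
        using that 3[of i j] by (simp add: b_def c_def)
      then have "0 + (?S + ?Z) = (\<Sum>i<Suc r. \<Sum>j<Suc (Suc r).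
          c i j * dot J u' (cvec r J (a' \<circ> skip i) (l \<circ> skip j)))"
        by (simp del: sum.lessThan_Suc)
      also have "\<dots> = dot J u' v"
        unfolding v_def v1_def dot_sum_right by simp
      finally show ?thesis .
    qed
    show ?thesis
      unfolding A u'_def[symmetric] using B unfolding C .
  qed
  \<comment> \<open>\<open>key\<close> is tested on unit vectors: that of x in J is unchanged on J
    by the elimination, while that of y becomes the vector p.\<close>
  have J: "w x \<approx> v x" if "x \<in> J" for x
  proof -
    have "dot (insert y J) (\<lambda>z. of_bool (z = x)) w = w x"
      using that fin by (intro dot_unit) auto
    moreover have "dot J (\<lambda>z. of_bool (z = x) + of_bool (y = x) * p z) v = v x"
      using that fin y dot_unit[OF fin that, of v] by (auto simp: dot_def)
    ultimately show ?thesis using key[of "\<lambda>z. of_bool (z = x)"] by simp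
  qed
  have "w y \<approx> dot J p v"
  proof -
    have "dot (insert y J) (\<lambda>z. of_bool (z = y)) w = w y"
      using fin by (intro dot_unit) auto
    moreover have "dot J (\<lambda>z. of_bool (z = y) + of_bool (y = y) * p z) v = dot J p v"
      using y by (intro dot_cong) auto
    ultimately show ?thesis using key[of "\<lambda>z. of_bool (z = y)"] by simp
  qed
  moreover have "dot J p v \<approx> dot J p w"
    using J cong_sym by (intro cong_dot) (auto simp: zero_mem)
  ultimately have "w y \<approx> dot J p w"
    using cong_trans by blast
  moreover have "w \<in> cof J N r"
    using v J unfolding cof_def by (rule cspan_cong)
  ultimately show ?thesis by (simp add: w_def)
qed

lemma cof_project:
  assumes van: "minors_vanish J N (Suc r)" and w: "w \<in> cof (insert y J) N' (Suc r)"
  shows "w \<in> cof J N r \<and> w y \<approx> dot J p w"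
  using w unfolding cof_def[of "insert y J"]
proof (induction rule: cspan.induct)
  case (cspan_base b)
  then show ?case using cof_project_base[OF van] by auto
next
  case cspan_zero
  then show ?case by (simp add: cof_def cspan.cspan_zero zero_mem)
next
  case (cspan_add u v)
  then show ?case
    using cong_add[of "u y" "dot J p u" "v y" "dot J p v"]
    by (auto simp: cof_def dot_commute[of J p] dot_add_left intro: cspan.cspan_add)
next
  case (cspan_scale u c)
  have "c * u y \<approx> dot J p (\<lambda>x. c * u x)"
    using mult_mem[of "u y - dot J p u" c] cspan_scale.IH
    by (simp add: dot_commute[of J p] dot_scale_left right_diff_distrib)
  moreover have "(\<lambda>x. c * u x) \<in> cof J N r"
    using cspan_scale.IH by (simp add: cof_def cspan.cspan_scale)
  ultimately show ?case by simp
next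
  case (cspan_cong u v)
  have "v y \<approx> u y" "u y \<approx> dot J p u" "dot J p u \<approx> dot J p v"
    using cspan_cong cong_sym by (auto simp: zero_mem intro!: cong_dot)
  then have "v y \<approx> dot J p v"
    using cong_trans by blast
  moreover have "v \<in> cof J N r"
    using cspan_cong cspan.cspan_cong[of u J _ v] by (simp add: cof_def)
  ultimately show ?case by simp
qed

text \<open>After elimination the row of the new relation is zero on J, so the main term of
  \<open>mdet_insert\<close> vanishes. The old forms have defect 0 and the last form has defect 1.
  Rows below r have no entry at y, and omitting row r + 1 leaves the zero row in place. So a single
  term survives, at position (r, r + 1), with sign -1.\<close>

lemma mdet_insert_new_relation:
  assumes "\<forall>i<r. a i = (a0 i)(y := 0)" and "a r = (\<lambda>x. - p x)(y := 1)"
    and l: "\<forall>j<Suc r. l j y = dot J p (l j)" "\<forall>x\<in>J. l (Suc r) x = 0" "l (Suc r) y = 1"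
  shows "mdet (Suc (Suc r)) (insert y J) (a(Suc r := u)) l
    = - mdet (Suc r) J (a0(r := (\<lambda>x. u x + u y * p x))) l"
proof -
  define u' where "u' = (\<lambda>x. u x + u y * p x)"
  define b where "b = a(Suc r := u)"
  define b' where "b' = (\<lambda>i x. b i x + b i y * p x)"
  have b'0: "b' r x = 0" "b r y = 1" "b' (Suc r) = u'" if "x \<in> J" for x
    using assms(2) that y by (auto simp: b'_def b_def u'_def)
  have b'i: "b i y = 0" "x \<in> J \<Longrightarrow> b' i x = a0 i x" if "i < r" for i x
    using assms(1) that y by (auto simp: b'_def b_def)
  have zero_last: "mdet (Suc r) J (b' \<circ> skip (Suc r)) m = 0" for m
    by (subst mdet_Suc) (simp add: b'0 dot_def)
  have "mdet (Suc (Suc r)) J b' l = 0"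
  proof -
    have "mdet (Suc r) J b' m = 0" for m
      by (subst mdet_Suc) (simp add: b'0 dot_def)
    then show ?thesis
      by (subst mdet_Suc) (simp add: cvec_def dot_def del: sum.lessThan_Suc)
  qed
  let ?g = "\<lambda>i j. (-1) ^ (i + j) * b i y * (l j y - dot J p (l j)) * mdet (Suc r) J (b' \<circ> skip i) (l \<circ> skip j)"
  have l0: "dot J p (l (Suc r)) = 0"
    using l(2) by (simp add: dot_def)
  have inner: "(\<Sum>j<Suc (Suc r). ?g i j) = ?g i (Suc r)" for i
    using l(1) by (subst sum.lessThan_Suc) (simp del: sum.lessThan_Suc)
  have "(\<Sum>i<Suc (Suc r). ?g i (Suc r)) = (\<Sum>i\<in>{r}. ?g i (Suc r))"
  proof (rule sum.mono_neutral_right)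
    show "\<forall>i\<in>{..<Suc (Suc r)} - {r}. ?g i (Suc r) = 0"
    proof
      fix i assume "i \<in> {..<Suc (Suc r)} - {r}"
      then have "i < r \<or> i = Suc r" by auto
      then show "?g i (Suc r) = 0" using b'i(1) zero_last by auto
    qed
  qed auto
  also have "\<dots> = - mdet (Suc r) J (a0(r := u')) l"
  proof -
    have "mdet (Suc r) J (b' \<circ> skip r) (l \<circ> skip (Suc r)) = mdet (Suc r) J (a0(r := u')) l"
      using b'i b'0(3) by (intro mdet_cong) (auto simp: less_Suc_eq)
    moreover have "b r y = 1"
      using assms(2) by (simp add: b_def)
    ultimately show ?thesis by (simp add: l0 l(3))
  qed
  finally show ?thesis
    unfolding b_def[symmetric] u'_def[symmetric]
    using \<open>mdet (Suc (Suc r)) J b' l = 0\<close>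
    by (subst mdet_insert[OF fin y, where p = p]) (simp only: b'_def[symmetric] inner add_0)
qed

text \<open>As the value at y is prescribed, it suffices to treat \<open>ext w\<close>. A generator
  of \<open>cof J N r\<close> extends, up to sign, to the cofactor vector built from the same
  relations together with the new relation, and the same forms together with the
  y-coordinate.\<close>

lemma cof_extend:
  assumes w: "w \<in> cof J N r" "w y \<approx> dot J p w"
  shows "w \<in> cof (insert y J) N' (Suc r)"
proof -
  define ext where "ext = (\<lambda>w. w(y := dot J p w))"
  have "ext w \<in> cof (insert y J) N' (Suc r)"
    using w(1) unfolding cof_def[of J]
  proof (induction rule: cspan.induct)
    case (cspan_base b)
    then obtain a l where b: "b = cvec r J a l" and a: "\<forall>i<r. a i \<in> N"
      by auto
    define a1 where "a1 = (\<lambda>i. if i < r then (a i)(y := 0) else (\<lambda>x. - p x)(y := 1))"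
    \<comment> \<open>The value at y is chosen to make the defect
      \<open>l j y - dot J p (l j)\<close> of the old forms zero; the added form is the
      y-coordinate.\<close>
    define l1 where "l1 = (\<lambda>j. if j < Suc r then (l j)(y := dot J p (l j)) else (\<lambda>x. of_bool (x = y)))"
    have dp: "dot J p (l1 j) = dot J p (l j)" if "j < Suc r" for j
      using that y by (intro dot_cong) (auto simp: l1_def)
    have "dot (insert y J) u (cvec (Suc r) (insert y J) a1 l1) = - dot J (\<lambda>x. u x + u y * p x) b" for u
    proof -
      have "mdet (Suc (Suc r)) (insert y J) (a1(Suc r := u)) l1
          = - mdet (Suc r) J (a(r := (\<lambda>x. u x + u y * p x))) l1"
        using y dp by (intro mdet_insert_new_relation) (auto simp: a1_def l1_def)
      also have "mdet (Suc r) J (a(r := (\<lambda>x. u x + u y * p x))) l1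
          = mdet (Suc r) J (a(r := (\<lambda>x. u x + u y * p x))) l"
        using y by (intro mdet_cong) (auto simp: l1_def)
      finally show ?thesis unfolding mdet_last b .
    qed
    note key = this
    have 1: "cvec (Suc r) (insert y J) a1 l1 x = - ext b x" if "x \<in> insert y J" for x
    proof -
      have "cvec (Suc r) (insert y J) a1 l1 x = - dot J (\<lambda>z. of_bool (z = x) + of_bool (y = x) * p z) b"
      proof -
        have "dot (insert y J) (\<lambda>z. of_bool (z = x)) (cvec (Suc r) (insert y J) a1 l1)
            = cvec (Suc r) (insert y J) a1 l1 x"
          using fin that by (intro dot_unit) auto
        with key[of "\<lambda>z. of_bool (z = x)"] show ?thesis by argo
      qed
      also have "dot J (\<lambda>z. of_bool (z = x) + of_bool (y = x) * p z) b = ext b x"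
      proof (cases "x = y")
        case True
        have "dot J (\<lambda>z. of_bool (z = x) + of_bool (y = x) * p z) b = dot J p b"
          using y True by (intro dot_cong) auto
        then show ?thesis using True by (simp add: ext_def)
      next
        case False
        then show ?thesis using that dot_unit[OF fin, of x b] by (simp add: ext_def)
      qed
      finally show ?thesis .
    qed
    have "cvec (Suc r) (insert y J) a1 l1 \<in> cof (insert y J) N' (Suc r)"
    proof -
      have "\<forall>i<Suc r. a1 i \<in> N'"
        using a embed new_relation by (auto simp: a1_def)
      then show ?thesis unfolding cof_def by (blast intro: cspan.cspan_base)
    qed
    \<comment> \<open>The scalar -1 undoes the sign of the single surviving term.\<close>
    from cspan_scale[OF this[unfolded cof_def], of "-1"]
    show ?case unfolding cof_def
      by (rule cspan.cspan_cong) (simp add: 1 zero_mem)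
  next
    case cspan_zero
    have "ext (\<lambda>_. 0) = (\<lambda>_. 0)" by (auto simp: ext_def)
    then show ?case by (simp add: cof_def cspan.cspan_zero)
  next
    case (cspan_add u v)
    have "ext (\<lambda>x. u x + v x) = (\<lambda>x. ext u x + ext v x)"
      by (auto simp: ext_def fun_eq_iff dot_commute[of J p] dot_add_left)
    then show ?case using cspan_add.IH by (simp add: cof_def cspan.cspan_add)
  next
    case (cspan_scale u c)
    have "ext (\<lambda>x. c * u x) = (\<lambda>x. c * ext u x)"
      by (auto simp: ext_def fun_eq_iff dot_commute[of J p] dot_scale_left)
    then show ?case using cspan_scale.IH by (simp add: cof_def cspan.cspan_scale)
  next
    case (cspan_cong u v)
    have "ext v x \<approx> ext u x" if "x \<in> insert y J" for x
      using that cspan_cong.hyps by (auto simp: ext_def zero_mem intro!: cong_dot)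
    then show ?case using cspan_cong.IH unfolding cof_def by (blast intro: cspan.cspan_cong)
  qed
  then show ?thesis
    unfolding cof_def by (rule cspan_cong) (use w(2) in \<open>auto simp: ext_def zero_mem\<close>)
qed

text \<open>For the upper bound, every term of \<open>mdet_insert\<close> contains a minor of N of
  size r + 1 or r + 2. For the lower bound, a nonvanishing r-minor of N is bordered by the new
  relation and the y-coordinate. This keeps its value: the new row is eliminated to zero, and only
  the corner term, with sign +1, remains.\<close>

lemma rank_extend:
  assumes "rank_is J N r"
  shows "rank_is (insert y J) N' (Suc r)"
proof -
  have van: "minors_vanish J N (Suc r)" "minors_vanish J N (Suc (Suc r))"
    using assms minors_vanish_Suc by (auto simp: rank_is_def)
  have "minors_vanish (insert y J) N' (Suc (Suc r))"
    unfolding minors_vanish_def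
  proof (intro allI impI)
    fix b l assume b: "\<forall>i<Suc (Suc r). b i \<in> N'"
    define b' where "b' = (\<lambda>i x. b i x + b i y * p x)"
    have b': "\<forall>i<Suc (Suc r). b' i \<in> N"
      using b project by (simp add: b'_def)
    have "mdet (Suc r) J (b' \<circ> skip i) (l \<circ> skip j) \<in> \<pp>" for i j
      using van(1) b' skip_less[of _ "Suc r" i] by (simp add: minors_vanish_def)
    moreover have "mdet (Suc (Suc r)) J b' l \<in> \<pp>"
      using van(2) b' by (simp add: minors_vanish_def)
    ultimately show "mdet (Suc (Suc r)) (insert y J) b l \<in> \<pp>"
      by (subst mdet_insert[OF fin y, where p = p])
        (unfold b'_def[symmetric], intro add_mem sum_mem mult_mem)
  qed
  moreover have "\<not> minors_vanish (insert y J) N' (Suc r)"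
  proof
    assume van': "minors_vanish (insert y J) N' (Suc r)"
    obtain a l where a: "\<forall>i<r. a i \<in> N" and nz: "mdet r J a l \<notin> \<pp>"
      using assms by (auto simp: rank_is_def minors_vanish_def)
    define b where "b = (\<lambda>i. if i < r then (a i)(y := 0) else (\<lambda>x. - p x)(y := 1))"
    define l1 where "l1 = (\<lambda>j. if j < r then (l j)(y := dot J p (l j)) else (\<lambda>x. of_bool (x = y)))"
    have "\<forall>i<Suc r. b i \<in> N'"
      using a embed new_relation by (auto simp: b_def)
    then have "mdet (Suc r) (insert y J) b l1 \<in> \<pp>"
      using van' by (simp add: minors_vanish_def)
    moreover have "mdet (Suc r) (insert y J) b l1 = mdet r J a l"
    proof -
      define b' where "b' = (\<lambda>i x. b i x + b i y * p x)"
      have "dot J p (l1 j) = dot J p (l j)" if "j < r" for j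
        using that y by (intro dot_cong) (auto simp: l1_def)
      moreover have "dot J p (l1 r) = 0"
        using y by (auto simp: l1_def dot_def intro!: sum.neutral)
      ultimately have l1: "l1 j y - dot J p (l1 j) = of_bool (j = r)" if "j < Suc r" for j
        using that by (auto simp: l1_def)
      have "mdet (Suc r) J b' l1 = 0"
        using y by (subst mdet_Suc) (auto simp: dot_def b'_def b_def intro!: sum.neutral)
      moreover have "(\<Sum>i<Suc r. \<Sum>j<Suc r. (-1) ^ (i + j) * b i y * (l1 j y - dot J p (l1 j)) *
          mdet r J (b' \<circ> skip i) (l1 \<circ> skip j)) = mdet r J (b' \<circ> skip r) (l1 \<circ> skip r)"
        by (simp add: l1 b_def)
      moreover have "mdet r J (b' \<circ> skip r) (l1 \<circ> skip r) = mdet r J a l"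
        using y by (intro mdet_cong) (auto simp: b'_def b_def l1_def)
      ultimately show ?thesis
        by (subst mdet_insert[OF fin y, where p = p]) (simp only: b'_def add_0)
    qed
    ultimately show False using nz by simp
  qed
  ultimately show ?thesis by (simp add: rank_is_def)
qed

end

section \<open>Substitution and partial derivatives of polynomials\<close>

lemma mconst_hom [simp]:
  "mconst 0 = 0" "mconst 1 = 1" "mconst (a + b) = mconst a + mconst b" "mconst (a * b) = mconst a * mconst b"
  by (simp_all add: mconst_def single_add mult_single)

lemma single_eq_mconst_mult: "Poly_Mapping.single m c = mconst c * Poly_Mapping.single m 1"
  by (simp add: mconst_def mult_single)

lemma poly_mapping_single_induct:
  assumes "P 0" "\<And>k v. P (Poly_Mapping.single k v)" "\<And>f g. P f \<Longrightarrow> P g \<Longrightarrow> P (f + g)"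
  shows "P (f :: 'a \<Rightarrow>\<^sub>0 'b::comm_monoid_add)"
proof (induction f rule: update_induct)
  case const
  then show ?case by (rule assms(1))
next
  case (update f a b)
  have "Poly_Mapping.update a b f = Poly_Mapping.single a b + f"
    using update by (intro poly_mapping_eqI)
      (auto simp: lookup_update lookup_add lookup_single when_def in_keys_iff)
  then show ?case using update assms by simp
qed

text \<open>Lets statements about homomorphisms and derivations be checked on constants and
  variables alone.\<close>

lemma mpoly_induct [case_names const var add mult]:
  assumes "\<And>c. P (mconst c)" "\<And>j. P (mvar j)"
    and "\<And>p q. P p \<Longrightarrow> P q \<Longrightarrow> P (p + q)" "\<And>p q. P p \<Longrightarrow> P q \<Longrightarrow> P (p * q)"
  shows "P (p :: 'k::field mpoly)"
proof -
  have 1: "P 1" and 0: "P 0"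
    using assms(1)[of 1] assms(1)[of 0] by simp_all
  have pow: "P (Poly_Mapping.single (Poly_Mapping.single j e) 1)" for j e
  proof (induction e)
    case 0
    then show ?case using 1 by simp
  next
    case (Suc e)
    have "(Poly_Mapping.single (Poly_Mapping.single j (Suc e)) 1 :: 'k mpoly)
        = mvar j * Poly_Mapping.single (Poly_Mapping.single j e) 1"
      by (simp add: mvar_def mult_single single_add[symmetric])
    then show ?case using Suc assms by simp
  qed
  have m: "P (Poly_Mapping.single m 1)" for m
  proof (induction m rule: poly_mapping_single_induct)
    case (3 f g)
    have "(Poly_Mapping.single (f + g) 1 :: 'k mpoly) = Poly_Mapping.single f 1 * Poly_Mapping.single g 1"
      by (simp add: mult_single)
    then show ?case using 3 assms by simp
  qed (use 1 pow in simp_all)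
  show ?thesis
  proof (induction p rule: poly_mapping_single_induct)
    case (2 k v)
    then show ?case using assms m by (subst single_eq_mconst_mult) blast
  qed (use 0 assms in auto)
qed

section \<open>Substitution homomorphisms\<close>

definition mon_subst :: "(nat \<Rightarrow> 'k::field mpoly) \<Rightarrow> (nat \<Rightarrow>\<^sub>0 nat) \<Rightarrow> 'k mpoly"
  where "mon_subst s m = (\<Prod>j\<in>Poly_Mapping.keys m. s j ^ Poly_Mapping.lookup m j)"

definition subst :: "(nat \<Rightarrow> 'k::field mpoly) \<Rightarrow> 'k mpoly \<Rightarrow> 'k mpoly"
  where "subst s p = (\<Sum>m\<in>Poly_Mapping.keys p. mconst (Poly_Mapping.lookup p m) * mon_subst s m)"

lemma mon_subst_add: "mon_subst s (u + v) = mon_subst s u * mon_subst s v"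
proof -
  let ?K = "Poly_Mapping.keys u \<union> Poly_Mapping.keys v"
  have *: "mon_subst s w = (\<Prod>j\<in>?K. s j ^ Poly_Mapping.lookup w j)"
    if "Poly_Mapping.keys w \<subseteq> ?K" for w
    unfolding mon_subst_def using that by (intro prod.mono_neutral_left) (auto simp: in_keys_iff)
  show ?thesis
    using *[of u] *[of v] *[of "u + v"] keys_add[of u v]
    by (simp add: lookup_add power_add prod.distrib)
qed

lemma subst_superset:
  assumes "finite K" "Poly_Mapping.keys p \<subseteq> K"
  shows "subst s p = (\<Sum>m\<in>K. mconst (Poly_Mapping.lookup p m) * mon_subst s m)"
  unfolding subst_def using assms by (intro sum.mono_neutral_left) (auto simp: in_keys_iff)

lemma subst_add [simp]: "subst s (p + q) = subst s p + subst s q"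
proof -
  let ?K = "Poly_Mapping.keys p \<union> Poly_Mapping.keys q"
  show ?thesis
    using subst_superset[of ?K p] subst_superset[of ?K q] subst_superset[of ?K "p + q"] keys_add[of p q]
    by (simp add: lookup_add sum.distrib distrib_right)
qed

lemma subst_zero [simp]: "subst s 0 = 0"
  by (simp add: subst_def)

lemma subst_single: "subst s (Poly_Mapping.single m c) = mconst c * mon_subst s m"
  by (simp add: subst_def)

lemma subst_mult [simp]: "subst s (p * q) = subst s p * subst s q"
proof (induction p rule: poly_mapping_single_induct)
  case (2 k v)
  then show ?case
  proof (induction q rule: poly_mapping_single_induct)
    case (3 f g)
    then show ?case by (simp add: distrib_left)
  qed (simp_all add: subst_single mult_single mon_subst_add)
qed (simp_all add: distrib_right)

lemma subst_mconst [simp]: "subst s (mconst c) = mconst c"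
  by (simp add: mconst_def subst_single mon_subst_def)

lemma subst_one [simp]: "subst s 1 = 1"
  using subst_mconst[of s 1] by simp

lemma subst_mvar [simp]: "subst s (mvar j) = s j"
  by (simp add: mvar_def subst_single mon_subst_def)

lemma subst_uminus [simp]: "subst s (- p) = - subst s p"
  using subst_add[of s p "- p"] by (simp add: eq_neg_iff_add_eq_0 add.commute del: subst_add)

lemma subst_diff [simp]: "subst s (p - q) = subst s p - subst s q"
  using subst_add[of s p "- q"] by (simp del: subst_add)

lemma subst_sum [simp]: "subst s (sum f S) = (\<Sum>i\<in>S. subst s (f i))"
  by (induction S rule: infinite_finite_induct) auto

lemma subst_mvar_id: "subst mvar p = p"
  by (induction p rule: mpoly_induct) auto

section \<open>Partial derivatives and the chain rule\<close>

lemma mpderiv_superset: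
  assumes "finite K" "Poly_Mapping.keys p \<subseteq> K"
  shows "mpderiv j p = (\<Sum>m\<in>K. Poly_Mapping.single (m - Poly_Mapping.single j 1)
    (of_nat (Poly_Mapping.lookup m j) * Poly_Mapping.lookup p m))"
  unfolding mpderiv_def using assms by (intro sum.mono_neutral_left) (auto simp: in_keys_iff)

lemma mpderiv_add [simp]: "mpderiv j (p + q) = mpderiv j p + mpderiv j q"
proof -
  let ?K = "Poly_Mapping.keys p \<union> Poly_Mapping.keys q"
  show ?thesis
    using mpderiv_superset[of ?K p] mpderiv_superset[of ?K q] mpderiv_superset[of ?K "p + q"] keys_add[of p q]
    by (simp add: lookup_add sum.distrib distrib_left single_add)
qed

lemma mpderiv_zero [simp]: "mpderiv j 0 = 0"
  by (simp add: mpderiv_def)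

lemma mpderiv_single: "mpderiv j (Poly_Mapping.single m c)
    = Poly_Mapping.single (m - Poly_Mapping.single j 1) (of_nat (Poly_Mapping.lookup m j) * c)"
  by (simp add: mpderiv_def)

lemma mpderiv_mult [simp]: "mpderiv j (p * q) = mpderiv j p * q + p * mpderiv j q"
proof (induction p rule: poly_mapping_single_induct)
  case (2 u a)
  show ?case
  proof (induction q rule: poly_mapping_single_induct)
    case (2 v b)
    let ?e = "Poly_Mapping.single j 1 :: nat \<Rightarrow>\<^sub>0 nat"
    \<comment> \<open>Subtraction of exponents is truncated, so this holds only if the variable
      occurs in u; otherwise the coefficient \<open>of_nat 0\<close> removes the term.\<close>
    have shift: "u - ?e + v = u + v - ?e" if "Poly_Mapping.lookup u j \<noteq> 0" for u v :: "nat \<Rightarrow>\<^sub>0 nat"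
      using that by (intro poly_mapping_eqI) (auto simp: lookup_add lookup_minus lookup_single when_def)
    have 1: "mpderiv j (Poly_Mapping.single u a) * Poly_Mapping.single v b
        = Poly_Mapping.single (u + v - ?e) (of_nat (Poly_Mapping.lookup u j) * a * b)"
      using shift[of u v] by (cases "Poly_Mapping.lookup u j = 0") (simp_all add: mpderiv_single mult_single)
    have 2: "Poly_Mapping.single u a * mpderiv j (Poly_Mapping.single v b)
        = Poly_Mapping.single (u + v - ?e) (of_nat (Poly_Mapping.lookup v j) * a * b)"
      using shift[of v u]
      by (cases "Poly_Mapping.lookup v j = 0") (simp_all add: mpderiv_single mult_single add.commute mult_ac)
    show ?case
      by (simp only: 1 2 mult_single) (simp add: mpderiv_single lookup_add single_add[symmetric] algebra_simps)
  next
    case (3 f g)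
    then show ?case by (simp add: algebra_simps)
  qed simp
next
  case (3 f g)
  then show ?case by (simp add: algebra_simps)
qed simp

lemma mpderiv_mconst [simp]: "mpderiv j (mconst c) = 0"
  by (simp add: mconst_def mpderiv_single)

lemma mpderiv_mvar: "mpderiv j (mvar k) = of_bool (j = k)"
  by (auto simp: mvar_def mpderiv_single lookup_single when_def)

lemma mpderiv_sum [simp]: "mpderiv j (sum f S) = (\<Sum>i\<in>S. mpderiv j (f i))"
  by (induction S rule: infinite_finite_induct) auto

lemma mpderiv_diff [simp]: "mpderiv j (p - q) = mpderiv j p - mpderiv j q"
  using mpderiv_add[of j "p - q" q] by (simp add: eq_diff_eq del: mpderiv_add)

text \<open>The chain rule. As a variable outside Y is replaced by 0, it contributes nothing, and
  the sum over all variables reduces to the finite set Y.\<close>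

lemma mpderiv_subst:
  assumes "finite Y" "\<And>y. y \<notin> Y \<Longrightarrow> s y = 0"
  shows "mpderiv x (subst s p) = (\<Sum>y\<in>Y. subst s (mpderiv y p) * mpderiv x (s y))"
proof (induction p rule: mpoly_induct)
  case (var j)
  show ?case
  proof (cases "j \<in> Y")
    case True
    have "(\<Sum>y\<in>Y. subst s (mpderiv y (mvar j)) * mpderiv x (s y)) = (\<Sum>y\<in>{j}. mpderiv x (s y))"
      using True assms(1) by (intro sum.mono_neutral_cong_right) (auto simp: mpderiv_mvar)
    then show ?thesis by simp
  next
    case False
    have "(\<Sum>y\<in>Y. subst s (mpderiv y (mvar j)) * mpderiv x (s y)) = 0"
      using False by (intro sum.neutral) (auto simp: mpderiv_mvar)
    then show ?thesis using assms(2)[OF False] by simp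
  qed
next
  case (mult p q)
  then show ?case by (simp add: sum.distrib sum_distrib_left sum_distrib_right algebra_simps)
qed (simp_all add: sum.distrib distrib_right)

section \<open>The polynomials in n variables inside the type of all polynomials\<close>

definition restrict_vars :: "nat \<Rightarrow> 'k::field mpoly \<Rightarrow> 'k mpoly"
  where "restrict_vars n = subst (\<lambda>j. if j \<in> {1..n} then mvar j else 0)"

lemma mpoly_ring_simps [simp]:
  "monoid.mult (mpoly_ring n) = (*)" "one (mpoly_ring n) = 1"
  "zero (mpoly_ring n) = 0" "add (mpoly_ring n) = (+)"
  by (simp_all add: mpoly_ring_def)

lemma mpoly_carrier:
  "p \<in> carrier (mpoly_ring n) \<longleftrightarrow> (\<forall>m\<in>Poly_Mapping.keys p. Poly_Mapping.keys m \<subseteq> {1..n})"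
  by (simp add: mpoly_ring_def)

lemma mpoly_carrier_add: "p \<in> carrier (mpoly_ring n) \<Longrightarrow> q \<in> carrier (mpoly_ring n) \<Longrightarrow> p + q \<in> carrier (mpoly_ring n)"
  using keys_add[of p q] by (auto simp: mpoly_carrier)

lemma mpoly_carrier_mult:
  assumes "p \<in> carrier (mpoly_ring n)" "q \<in> carrier (mpoly_ring n)"
  shows "p * q \<in> carrier (mpoly_ring n)"
  unfolding mpoly_carrier
proof
  fix m assume "m \<in> Poly_Mapping.keys (p * q)"
  then obtain u v where "u \<in> Poly_Mapping.keys p" "v \<in> Poly_Mapping.keys q" "m = u + v"
    using keys_mult[of p q] by blast
  then show "Poly_Mapping.keys m \<subseteq> {1..n}"
    using assms keys_add[of u v] unfolding mpoly_carrier by blast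
qed

lemma mconst_carrier: "mconst c \<in> carrier (mpoly_ring n)"
  by (simp add: mpoly_carrier mconst_def)

lemma mvar_carrier: "j \<in> {1..n} \<Longrightarrow> mvar j \<in> carrier (mpoly_ring n)"
  by (simp add: mpoly_carrier mvar_def)

lemma restrict_vars_carrier: "restrict_vars n p \<in> carrier (mpoly_ring n)"
  unfolding restrict_vars_def
proof (induction p rule: mpoly_induct)
  case (var j)
  show ?case
  proof (cases "j \<in> {1..n}")
    case True
    then show ?thesis using mvar_carrier by (simp only: subst_mvar if_True)
  next
    case False
    then show ?thesis using mconst_carrier[of 0 n] by (simp only: subst_mvar if_False mconst_hom)
  qed
qed (simp_all add: mconst_carrier mpoly_carrier_add mpoly_carrier_mult)

lemma restrict_vars_id:
  assumes "p \<in> carrier (mpoly_ring n)"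
  shows "restrict_vars n p = p"
proof -
  have "j \<in> {1..n}" if "m \<in> Poly_Mapping.keys p" "j \<in> Poly_Mapping.keys m" for m j
    using assms that unfolding mpoly_carrier by blast
  then have "restrict_vars n p = subst mvar p"
    unfolding restrict_vars_def subst_def mon_subst_def by simp
  then show ?thesis by (simp add: subst_mvar_id)
qed

lemma restrict_vars_idem: "restrict_vars n (restrict_vars n p) = restrict_vars n p"
  by (rule restrict_vars_id[OF restrict_vars_carrier])

lemma restrict_vars_hom [simp]:
  "restrict_vars n (p + q) = restrict_vars n p + restrict_vars n q"
  "restrict_vars n (p * q) = restrict_vars n p * restrict_vars n q"
  "restrict_vars n (p - q) = restrict_vars n p - restrict_vars n q"
  "restrict_vars n (mconst c) = mconst c" "restrict_vars n 0 = 0" "restrict_vars n 1 = 1"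
  by (simp_all add: restrict_vars_def)

lemma restrict_vars_mvar: "restrict_vars n (mvar j) = (if j \<in> {1..n} then mvar j else 0)"
  by (simp add: restrict_vars_def)

text \<open>Chain rule for the substitution defining \<open>restrict_vars\<close>, where only y = x
  contributes. For a variable that is set to 0 the left-hand side would be 0.\<close>

lemma mpderiv_restrict_vars:
  assumes "x \<in> {1..n}"
  shows "mpderiv x (restrict_vars n p) = restrict_vars n (mpderiv x p)"
proof -
  have "mpderiv x (restrict_vars n p) = (\<Sum>y\<in>{1..n}. restrict_vars n (mpderiv y p) * of_bool (x = y))"
    unfolding restrict_vars_def by (subst mpderiv_subst[of "{1..n}"]) (auto simp: mpderiv_mvar)
  also have "\<dots> = (\<Sum>y\<in>{x}. restrict_vars n (mpderiv y p))"
    using assms by (intro sum.mono_neutral_cong_right) auto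
  finally show ?thesis by simp
qed

lemma cring_mpoly_ring: "cring (mpoly_ring n)"
proof (rule cringI)
  show "abelian_group (mpoly_ring n)"
  proof (rule abelian_groupI)
    fix x assume x: "x \<in> carrier (mpoly_ring n)"
    have "mconst (-1) * x \<in> carrier (mpoly_ring n)"
      using x mconst_carrier mpoly_carrier_mult by blast
    moreover have "mconst (-1) * x + x = mconst (-1 + 1) * x"
      by (simp only: mconst_hom distrib_right) simp
    then have "mconst (-1) * x + x = 0" by simp
    ultimately show "\<exists>y\<in>carrier (mpoly_ring n). y \<oplus>\<^bsub>mpoly_ring n\<^esub> x = \<zero>\<^bsub>mpoly_ring n\<^esub>"
      by auto
  qed (use mconst_carrier[of 0 n] in \<open>auto simp: mpoly_carrier_add ac_simps\<close>)
  show "comm_monoid (mpoly_ring n)"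
    by (rule comm_monoidI) (use mconst_carrier[of 1 n] in \<open>auto simp: mpoly_carrier_mult ac_simps\<close>)
qed (auto simp: distrib_right)

section \<open>Comparison of two presentations\<close>

text \<open>Two presentations have to be moved to a common index set and to common coefficients; a
  determinant, being polynomial in its entries, commutes with such a change.\<close>

lemma mdet_map:
  assumes "comm_ring_hom h" "bij_betw g J' J"
  shows "mdet k J' (\<lambda>i z. h (a i (g z))) (\<lambda>j z. h (l j (g z))) = h (mdet k J a l)"
proof -
  interpret h: comm_ring_hom h by fact
  have dot: "dot J' (\<lambda>z. h (a i (g z))) (\<lambda>z. h (l j (g z))) = h (dot J (a i) (l j))" for i j
  proof -
    have "dot J' (\<lambda>z. h (a i (g z))) (\<lambda>z. h (l j (g z))) = (\<Sum>z\<in>J'. h (a i (g z) * l j (g z)))"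
      by (simp add: dot_def h.hom_mult)
    also have "\<dots> = (\<Sum>x\<in>J. h (a i x * l j x))"
      by (rule sum.reindex_bij_betw[OF assms(2)])
    finally show ?thesis by (simp add: dot_def h.hom_sum)
  qed
  have "map_mat h (mat k k (\<lambda>(i, j). dot J (a i) (l j))) = mat k k (\<lambda>(i, j). h (dot J (a i) (l j)))"
    by (rule eq_matI) auto
  then show ?thesis
    unfolding mdet_def fdet_def dot by (simp flip: h.hom_det)
qed

lemma cvec_map:
  assumes "comm_ring_hom h" "bij_betw g J' J"
  shows "cvec k J' (\<lambda>i z. h (a i (g z))) (\<lambda>j z. h (l j (g z))) z = h (cvec k J a l (g z))"
proof -
  interpret h: comm_ring_hom h by fact
  have sgn: "h ((-1) ^ n) = (-1) ^ n" for n
    by (simp add: h.hom_power h.hom_uminus)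
  have "mdet k J' (\<lambda>i z. h (a i (g z))) ((\<lambda>j z. h (l j (g z))) \<circ> skip j) = h (mdet k J a (l \<circ> skip j))" for j
    using mdet_map[OF assms, of k a "l \<circ> skip j"] by (simp add: comp_def)
  then show ?thesis
    unfolding cvec_def h.hom_sum by (intro sum.cong refl) (simp add: h.hom_mult sgn)
qed

text \<open>Because h reflects membership in the ideals, a nonvanishing minor of N over J is carried
  to a nonvanishing minor of N' over J'. Applied in both directions, this identifies ranks.\<close>

lemma minors_vanish_map:
  assumes P: "coeff_ideal \<pp>" and P': "coeff_ideal \<pp>'"
    and h: "comm_ring_hom h" and g: "bij_betw g J' J"
    and h_mem: "\<And>a. h a \<in> \<pp>' \<Longrightarrow> a \<in> \<pp>"
    and N: "\<And>u. u \<in> N \<Longrightarrow> (\<lambda>z. h (u (g z))) \<in> N'"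
    and van: "coeff_ideal.minors_vanish \<pp>' J' N' k"
  shows "coeff_ideal.minors_vanish \<pp> J N k"
  unfolding coeff_ideal.minors_vanish_def[OF P]
proof (intro allI impI)
  fix a l assume "\<forall>i<k. a i \<in> N"
  then have "mdet k J' (\<lambda>i z. h (a i (g z))) (\<lambda>j z. h (l j (g z))) \<in> \<pp>'"
    using van N by (simp add: coeff_ideal.minors_vanish_def[OF P'])
  then show "mdet k J a l \<in> \<pp>"
    unfolding mdet_map[OF h g] by (rule h_mem)
qed

lemma cof_map:
  assumes P: "coeff_ideal \<pp>" and P': "coeff_ideal \<pp>'"
    and h: "comm_ring_hom h" and g: "bij_betw g J' J"
    and h_mem: "\<And>a. a \<in> \<pp> \<Longrightarrow> h a \<in> \<pp>'"
    and N: "\<And>u. u \<in> N \<Longrightarrow> (\<lambda>z. h (u (g z))) \<in> N'"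
    and w: "w \<in> coeff_ideal.cof \<pp> J N r"
  shows "(\<lambda>z. h (w (g z))) \<in> coeff_ideal.cof \<pp>' J' N' r"
proof -
  interpret P: coeff_ideal \<pp> by fact
  interpret P': coeff_ideal \<pp>' by fact
  interpret h: comm_ring_hom h by fact
  show ?thesis using w unfolding P.cof_def
  proof (induction rule: P.cspan.induct)
    case (cspan_base b)
    then obtain a l where b: "b = cvec r J a l" and a: "\<forall>i<r. a i \<in> N"
      by auto
    have "cvec r J' (\<lambda>i z. h (a i (g z))) (\<lambda>j z. h (l j (g z))) \<in> P'.cof J' N' r"
      unfolding P'.cof_def using a N by (blast intro: P'.cspan_base)
    then show ?case
      unfolding b cvec_map[OF h g, abs_def] .
  next
    case cspan_zero
    show ?case by (simp add: P'.cof_def P'.cspan_zero)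
  next
    case (cspan_add u v)
    then show ?case by (simp add: P'.cof_def h.hom_add P'.cspan_add)
  next
    case (cspan_scale u c)
    then show ?case by (simp add: P'.cof_def h.hom_mult P'.cspan_scale)
  next
    case (cspan_cong u v)
    have "h (v (g z)) - h (u (g z)) \<in> \<pp>'" if "z \<in> J'" for z
      using that h_mem[of "v (g z) - u (g z)"] cspan_cong.hyps(2) bij_betwE[OF g] by (simp add: h.hom_minus)
    then show ?case using cspan_cong.IH unfolding P'.cof_def by (blast intro: P'.cspan_cong)
  qed
qed

section \<open>Adjoining a finite set of redundant generators\<close>

context coeff_ideal
begin

text \<open>Induction on K by \<open>index_extension\<close>. All new differentials are expressed
  through J0 alone, so the coefficient vector of the next generator is set to 0 on those adjoined
  before it. \<open>NK K\<close> consists of the vectors that become relations once the generators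
  in K are eliminated.\<close>

lemma extend_indices:
  fixes p :: "'i \<Rightarrow> 'i \<Rightarrow> 'r"
  assumes J0: "finite J0"
    and N0_cong: "\<And>u v. u \<in> N0 \<Longrightarrow> (\<And>x. x \<in> J0 \<Longrightarrow> v x = u x) \<Longrightarrow> v \<in> N0"
    and N0_zero: "(\<lambda>_. 0) \<in> N0"
    and rank: "rank_is J0 N0 r"
  defines "NK \<equiv> \<lambda>K. {u. (\<lambda>x. u x + (\<Sum>y\<in>K. u y * p y x)) \<in> N0}"
  assumes K: "finite K" "K \<inter> J0 = {}"
  shows "rank_is (K \<union> J0) (NK K) (r + card K) \<and>
    (\<forall>w. w \<in> cof (K \<union> J0) (NK K) (r + card K) \<longleftrightarrow> w \<in> cof J0 N0 r \<and> (\<forall>y\<in>K. w y \<approx> dot J0 (p y) w))"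
  using K
proof (induction K)
  case empty
  have "NK {} = N0" by (simp add: NK_def)
  then show ?case using rank by simp
next
  case (insert y K)
  let ?J = "K \<union> J0"
  let ?p = "\<lambda>x. if x \<in> J0 then p y x else 0"
  have y: "y \<notin> J0" "y \<notin> K" and KJ: "K \<inter> J0 = {}"
    using insert by auto
  interpret index_extension \<pp> ?J y ?p "NK K" "NK (insert y K)"
  proof unfold_locales
    show "finite ?J" "y \<notin> ?J"
      using insert J0 by auto
  next
    fix b assume b: "b \<in> NK (insert y K)"
    have pK: "?p z = 0" if "z \<in> K" for z using that KJ by auto
    show "(\<lambda>x. b x + b y * ?p x) \<in> NK K"
      unfolding NK_def mem_Collect_eq
    proof (rule N0_cong)
      show "(\<lambda>x. b x + (\<Sum>z\<in>insert y K. b z * p z x)) \<in> N0"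
        using b by (simp add: NK_def)
      fix x assume x: "x \<in> J0"
      have "(\<Sum>z\<in>K. (b z + b y * ?p z) * p z x) = (\<Sum>z\<in>K. b z * p z x)"
        by (rule sum.cong[OF refl]) (simp only: pK mult_zero_right add_0_right)
      then show "b x + b y * ?p x + (\<Sum>z\<in>K. (b z + b y * ?p z) * p z x)
          = b x + (\<Sum>z\<in>insert y K. b z * p z x)"
        using x insert.hyps by simp
    qed
  next
    fix a assume a: "a \<in> NK K"
    show "a(y := 0) \<in> NK (insert y K)"
      unfolding NK_def mem_Collect_eq
    proof (rule N0_cong)
      show "(\<lambda>x. a x + (\<Sum>z\<in>K. a z * p z x)) \<in> N0"
        using a by (simp add: NK_def)
      fix x assume x: "x \<in> J0"
      have "(\<Sum>z\<in>K. (a(y := 0)) z * p z x) = (\<Sum>z\<in>K. a z * p z x)"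
        using y by (intro sum.cong) auto
      moreover have "x \<noteq> y" using x y by auto
      ultimately show "(a(y := 0)) x + (\<Sum>z\<in>insert y K. (a(y := 0)) z * p z x) = a x + (\<Sum>z\<in>K. a z * p z x)"
        using insert.hyps by simp
    qed
  next
    show "(\<lambda>x. - ?p x)(y := 1) \<in> NK (insert y K)"
      unfolding NK_def mem_Collect_eq
    proof (rule N0_cong[OF N0_zero])
      fix x assume x: "x \<in> J0"
      have "(\<Sum>z\<in>K. ((\<lambda>x. - ?p x)(y := 1)) z * p z x) = 0"
        using KJ y by (intro sum.neutral) auto
      moreover have "x \<noteq> y" using x y by auto
      ultimately show "((\<lambda>x. - ?p x)(y := 1)) x + (\<Sum>z\<in>insert y K. ((\<lambda>x. - ?p x)(y := 1)) z * p z x) = 0"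
        using insert.hyps x by simp
    qed
  qed
  note IH = insert.IH[OF KJ]
  have card: "r + card (insert y K) = Suc (r + card K)"
    using insert.hyps by simp
  have rank_K: "rank_is ?J (NK K) (r + card K)"
    and cof_K: "w \<in> cof ?J (NK K) (r + card K) \<longleftrightarrow> w \<in> cof J0 N0 r \<and> (\<forall>y\<in>K. w y \<approx> dot J0 (p y) w)" for w
    using IH by blast+
  have van: "minors_vanish ?J (NK K) (Suc (r + card K))"
    using rank_K by (simp add: rank_is_def)
  have dot: "dot ?J ?p w = dot J0 (p y) w" for w
    unfolding dot_def using insert.hyps J0 KJ by (intro sum.mono_neutral_cong_right) auto
  have "w \<in> cof (insert y ?J) (NK (insert y K)) (Suc (r + card K)) \<longleftrightarrow>
      w \<in> cof ?J (NK K) (r + card K) \<and> w y \<approx> dot J0 (p y) w" for w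
    using cof_project[OF van, of w] cof_extend[of w "r + card K"] unfolding dot by blast
  then show ?case
    unfolding card Un_insert_left using rank_extend[OF rank_K] cof_K by auto
qed

end

section \<open>Relations of two presentations taken together\<close>

definition relations :: "'k::field mpoly set \<Rightarrow> nat set \<Rightarrow> (nat \<Rightarrow> 'k mpoly) set"
  where "relations \<pp> X = {u. \<exists>F\<in>\<pp>. \<forall>x\<in>X. u x - mpderiv x F \<in> \<pp>}"

lemma comm_ring_hom_subst: "comm_ring_hom (subst s)"
  by unfold_locales auto

lemma sum_of_bool_eq: "finite Z \<Longrightarrow> y \<in> Z \<Longrightarrow> (\<Sum>z\<in>Z. f z * of_bool (y = z)) = (f y :: 'r::comm_ring_1)"
  by (simp add: of_bool_def if_distrib[of "\<lambda>a. _ * a"] cong: if_cong)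

text \<open>\<open>subst S\<close> leads from the second presentation to the first and
  \<open>subst T\<close> back. They lift an isomorphism of the residue rings and its inverse, and
  are inverse to each other only modulo the ideals.\<close>

locale presentation_pair = P: coeff_ideal \<pp> + Q: coeff_ideal \<qq>
  for \<pp> \<qq> :: "'k::field mpoly set" +
  fixes X Y :: "nat set" and S T :: "nat \<Rightarrow> 'k mpoly"
  assumes fin: "finite X" "finite Y"
    and S_out: "y \<notin> Y \<Longrightarrow> S y = 0" and T_out: "x \<notin> X \<Longrightarrow> T x = 0"
    and S_mem: "subst S g \<in> \<pp> \<longleftrightarrow> g \<in> \<qq>" and T_mem: "subst T h \<in> \<qq> \<longleftrightarrow> h \<in> \<pp>"
    and ST: "subst S (subst T h) - h \<in> \<pp>" and TS: "subst T (subst S g) - g \<in> \<qq>"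
begin

text \<open>The relations of the second presentation, with coefficients transported by \<open>S\<close>.\<close>

definition relS :: "(nat \<Rightarrow> 'k mpoly) set"
  where "relS = {v. \<exists>G\<in>\<qq>. \<forall>y\<in>Y. v y - subst S (mpderiv y G) \<in> \<pp>}"

lemma chain_S: "mpderiv x (subst S g) = (\<Sum>y\<in>Y. subst S (mpderiv y g) * mpderiv x (S y))"
  by (rule mpderiv_subst) (use fin S_out in auto)

lemma chain_T: "mpderiv y (subst T h) = (\<Sum>x\<in>X. subst T (mpderiv x h) * mpderiv y (T x))"
  by (rule mpderiv_subst) (use fin T_out in auto)

text \<open>By the product rule the gradient of c H is c times the gradient of H, up to multiples of
  H, which lie in the ideal.\<close>

lemma relations_lincomb:
  assumes "finite K" "u \<in> relations \<pp> X" "\<And>i. i \<in> K \<Longrightarrow> w i \<in> relations \<pp> X"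
  shows "(\<lambda>x. u x - (\<Sum>i\<in>K. c i * w i x)) \<in> relations \<pp> X"
proof -
  obtain F where F: "F \<in> \<pp>" "\<And>x. x \<in> X \<Longrightarrow> u x - mpderiv x F \<in> \<pp>"
    using assms(2) by (auto simp: relations_def)
  have "\<forall>i\<in>K. \<exists>H. H \<in> \<pp> \<and> (\<forall>x\<in>X. w i x - mpderiv x H \<in> \<pp>)"
    using assms(3) by (auto simp: relations_def)
  then obtain H where H: "\<And>i. i \<in> K \<Longrightarrow> H i \<in> \<pp>" "\<And>i x. i \<in> K \<Longrightarrow> x \<in> X \<Longrightarrow> w i x - mpderiv x (H i) \<in> \<pp>"
    by metis
  have "F - (\<Sum>i\<in>K. c i * H i) \<in> \<pp>"
    using F(1) H(1) by (intro P.diff_mem P.sum_mem P.mult_mem)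
  moreover have "u x - (\<Sum>i\<in>K. c i * w i x) - mpderiv x (F - (\<Sum>i\<in>K. c i * H i)) \<in> \<pp>" if x: "x \<in> X" for x
  proof -
    have "u x - (\<Sum>i\<in>K. c i * w i x) - mpderiv x (F - (\<Sum>i\<in>K. c i * H i))
        = u x - mpderiv x F + (\<Sum>i\<in>K. - c i * (w i x - mpderiv x (H i))) + (\<Sum>i\<in>K. mpderiv x (c i) * H i)"
      by (simp add: algebra_simps sum.distrib sum_subtractf sum_negf)
    also have "\<dots> \<in> \<pp>"
      using F(2) H x by (intro P.add_mem P.sum_mem P.mult_mem)
    finally show ?thesis .
  qed
  ultimately show ?thesis unfolding relations_def by blast
qed

text \<open>The coefficients belong to the first presentation, so T carries them to the second
  before the product rule is used; S after T returns them modulo the ideal.\<close>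

lemma relS_lincomb:
  assumes "finite K" "u \<in> relS" "\<And>i. i \<in> K \<Longrightarrow> w i \<in> relS"
  shows "(\<lambda>y. u y - (\<Sum>i\<in>K. c i * w i y)) \<in> relS"
proof -
  obtain F where F: "F \<in> \<qq>" "\<And>y. y \<in> Y \<Longrightarrow> u y - subst S (mpderiv y F) \<in> \<pp>"
    using assms(2) by (auto simp: relS_def)
  have "\<forall>i\<in>K. \<exists>H. H \<in> \<qq> \<and> (\<forall>y\<in>Y. w i y - subst S (mpderiv y H) \<in> \<pp>)"
    using assms(3) by (auto simp: relS_def)
  then obtain H where H: "\<And>i. i \<in> K \<Longrightarrow> H i \<in> \<qq>"
      "\<And>i y. i \<in> K \<Longrightarrow> y \<in> Y \<Longrightarrow> w i y - subst S (mpderiv y (H i)) \<in> \<pp>"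
    by metis
  let ?c = "\<lambda>i. subst T (c i)"
  have "F - (\<Sum>i\<in>K. ?c i * H i) \<in> \<qq>"
    using F(1) H(1) by (intro Q.diff_mem Q.sum_mem Q.mult_mem)
  moreover have "u y - (\<Sum>i\<in>K. c i * w i y) - subst S (mpderiv y (F - (\<Sum>i\<in>K. ?c i * H i))) \<in> \<pp>"
    if y: "y \<in> Y" for y
  proof -
    have "u y - (\<Sum>i\<in>K. c i * w i y) - subst S (mpderiv y (F - (\<Sum>i\<in>K. ?c i * H i)))
        = u y - subst S (mpderiv y F) + (\<Sum>i\<in>K. - c i * (w i y - subst S (mpderiv y (H i))))
        + (\<Sum>i\<in>K. subst S (mpderiv y (H i)) * (subst S (?c i) - c i))
        + (\<Sum>i\<in>K. subst S (mpderiv y (?c i)) * subst S (H i))"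
      by (simp add: algebra_simps sum.distrib sum_subtractf sum_negf)
    also have "\<dots> \<in> \<pp>"
      using F(2) H y S_mem ST by (intro P.add_mem P.sum_mem P.mult_mem) auto
    finally show ?thesis .
  qed
  ultimately show ?thesis unfolding relS_def by blast
qed

lemma relations_cong:
  assumes "u \<in> relations \<pp> X" "\<And>x. x \<in> X \<Longrightarrow> v x - u x \<in> \<pp>"
  shows "v \<in> relations \<pp> X"
  using assms P.cong_trans unfolding relations_def by blast

lemma relS_cong:
  assumes "u \<in> relS" "\<And>y. y \<in> Y \<Longrightarrow> v y - u y \<in> \<pp>"
  shows "v \<in> relS"
  using assms P.cong_trans unfolding relS_def by blast

text \<open>Pairs the congruence between u, v and b with the vector q. In the application q collects
  the y-coefficients of the differentials of the other family of generators, A and the B_z are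
  gradient entries of elements of an ideal, and the Kronecker symbol isolates v_y.\<close>

lemma elimination:
  fixes u v b :: "nat \<Rightarrow> 'k mpoly"
  assumes "finite Z" "y \<in> Z"
    and "\<And>x. x \<in> W \<Longrightarrow> u x + (\<Sum>z\<in>Z. v z * s z x) - b x \<in> \<pp>"
    and "(\<Sum>x\<in>W. b x * q x) - A \<in> \<pp>"
    and "\<And>z. z \<in> Z \<Longrightarrow> (\<Sum>x\<in>W. s z x * q x) - (B z + of_bool (y = z)) \<in> \<pp>"
  shows "v y + (\<Sum>x\<in>W. u x * q x) - (A - (\<Sum>z\<in>Z. v z * B z)) \<in> \<pp>"
proof -
  have "(\<Sum>x\<in>W. q x * (u x + (\<Sum>z\<in>Z. v z * s z x) - b x))
      = (\<Sum>x\<in>W. u x * q x) + (\<Sum>z\<in>Z. v z * (\<Sum>x\<in>W. s z x * q x)) - (\<Sum>x\<in>W. b x * q x)"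
    unfolding sum_distrib_left by (subst sum.swap[of _ W Z])
      (simp add: algebra_simps sum.distrib sum_subtractf sum_distrib_left)
  moreover have "(\<Sum>z\<in>Z. v z * ((\<Sum>x\<in>W. s z x * q x) - (B z + of_bool (y = z))))
      = (\<Sum>z\<in>Z. v z * (\<Sum>x\<in>W. s z x * q x)) - (\<Sum>z\<in>Z. v z * B z) - v y"
    using sum_of_bool_eq[OF assms(1,2), of v]
    by (simp add: distrib_left right_diff_distrib sum_subtractf sum.distrib)
  ultimately have "v y + (\<Sum>x\<in>W. u x * q x) - (A - (\<Sum>z\<in>Z. v z * B z))
      = (\<Sum>x\<in>W. q x * (u x + (\<Sum>z\<in>Z. v z * s z x) - b x)) + ((\<Sum>x\<in>W. b x * q x) - A)
        + (\<Sum>z\<in>Z. - v z * ((\<Sum>x\<in>W. s z x * q x) - (B z + of_bool (y = z))))"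
    by (simp add: sum_negf)
  also have "\<dots> \<in> \<pp>"
    using assms(3-5) by (intro P.add_mem P.sum_mem P.mult_mem)
  finally show ?thesis .
qed

text \<open>Both sides describe the relations between the differentials of the generators of the two
  presentations taken together.\<close>

lemma joint_relations:
  "(\<lambda>x. u x + (\<Sum>y\<in>Y. v y * mpderiv x (S y))) \<in> relations \<pp> X \<longleftrightarrow>
   (\<lambda>y. v y + (\<Sum>x\<in>X. u x * subst S (mpderiv y (T x)))) \<in> relS"
proof
  assume "(\<lambda>x. u x + (\<Sum>y\<in>Y. v y * mpderiv x (S y))) \<in> relations \<pp> X"
  then obtain F where F: "F \<in> \<pp>"
    and uF: "\<And>x. x \<in> X \<Longrightarrow> u x + (\<Sum>y\<in>Y. v y * mpderiv x (S y)) - mpderiv x F \<in> \<pp>"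
    by (auto simp: relations_def)
  define A where "A = (\<lambda>y. subst S (mpderiv y (subst T F)))"
  \<comment> \<open>T(S z) - z lies in the second ideal, so its gradient is a relation; it accounts
    for S and T being inverse only modulo the ideals.\<close>
  define B where "B = (\<lambda>z y. subst S (mpderiv y (subst T (S z) - mvar z)))"
  \<comment> \<open>The chain rule for T produces the coefficients S(T(dh/dx)), which agree with
    dh/dx modulo the ideal.\<close>
  have swap: "(\<Sum>x\<in>X. mpderiv x h * subst S (mpderiv y (T x))) - subst S (mpderiv y (subst T h)) \<in> \<pp>"
    for h y
  proof -
    have "(\<Sum>x\<in>X. mpderiv x h * subst S (mpderiv y (T x))) - subst S (mpderiv y (subst T h))
        = - (\<Sum>x\<in>X. subst S (mpderiv y (T x)) * (subst S (subst T (mpderiv x h)) - mpderiv x h))"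
      unfolding chain_T by (simp add: algebra_simps sum_subtractf)
    also have "\<dots> \<in> \<pp>"
      using ST by (intro P.uminus_mem P.sum_mem P.mult_mem)
    finally show ?thesis .
  qed
  have "(\<lambda>y. A y - (\<Sum>z\<in>Y. v z * B z y)) \<in> relS"
  proof (rule relS_lincomb)
    show "A \<in> relS"
      using F T_mem P.zero_mem unfolding relS_def A_def by force
    show "B z \<in> relS" for z
      using TS[of "mvar z"] P.zero_mem unfolding relS_def B_def by force
  qed (rule fin)
  then show "(\<lambda>y. v y + (\<Sum>x\<in>X. u x * subst S (mpderiv y (T x)))) \<in> relS"
  proof (rule relS_cong)
    fix y assume y: "y \<in> Y"
    show "v y + (\<Sum>x\<in>X. u x * subst S (mpderiv y (T x))) - (A y - (\<Sum>z\<in>Y. v z * B z y)) \<in> \<pp>"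
    proof (rule elimination[OF fin(2) y uF])
      show "(\<Sum>x\<in>X. mpderiv x F * subst S (mpderiv y (T x))) - A y \<in> \<pp>"
        unfolding A_def by (rule swap)
      fix z
      have "B z y + of_bool (y = z) = subst S (mpderiv y (subst T (S z)))"
        by (simp add: B_def mpderiv_mvar)
      then show "(\<Sum>x\<in>X. mpderiv x (S z) * subst S (mpderiv y (T x))) - (B z y + of_bool (y = z)) \<in> \<pp>"
        using swap[of "S z" y] by simp
    qed
  qed
next
  assume "(\<lambda>y. v y + (\<Sum>x\<in>X. u x * subst S (mpderiv y (T x)))) \<in> relS"
  then obtain G where G: "G \<in> \<qq>"
    and vG: "\<And>y. y \<in> Y \<Longrightarrow> v y + (\<Sum>x\<in>X. u x * subst S (mpderiv y (T x))) - subst S (mpderiv y G) \<in> \<pp>"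
    by (auto simp: relS_def)
  define A where "A = (\<lambda>x. mpderiv x (subst S G))"
  define B where "B = (\<lambda>z x. mpderiv x (subst S (T z) - mvar z))"
  have "(\<lambda>x. A x - (\<Sum>z\<in>X. u z * B z x)) \<in> relations \<pp> X"
  proof (rule relations_lincomb)
    show "A \<in> relations \<pp> X"
      using G S_mem P.zero_mem unfolding relations_def A_def by force
    show "B z \<in> relations \<pp> X" for z
      using ST[of "mvar z"] P.zero_mem unfolding relations_def B_def by force
  qed (rule fin)
  then show "(\<lambda>x. u x + (\<Sum>y\<in>Y. v y * mpderiv x (S y))) \<in> relations \<pp> X"
  proof (rule relations_cong)
    fix x assume x: "x \<in> X"
    show "u x + (\<Sum>y\<in>Y. v y * mpderiv x (S y)) - (A x - (\<Sum>z\<in>X. u z * B z x)) \<in> \<pp>"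
    proof (rule elimination[OF fin(1) x vG])
      show "(\<Sum>y\<in>Y. subst S (mpderiv y G) * mpderiv x (S y)) - A x \<in> \<pp>"
        unfolding A_def chain_S by (simp add: P.zero_mem)
      fix z
      have "(\<Sum>y\<in>Y. subst S (mpderiv y (T z)) * mpderiv x (S y)) = B z x + of_bool (x = z)"
        by (simp add: B_def mpderiv_mvar chain_S)
      then show "(\<Sum>y\<in>Y. subst S (mpderiv y (T z)) * mpderiv x (S y)) - (B z x + of_bool (x = z)) \<in> \<pp>"
        by (simp add: P.zero_mem)
    qed
  qed
qed

text \<open>Extending X by Y and Y by X gives the same index set and, by
  \<open>joint_relations\<close>, the same module N. Uniqueness of the rank then yields r + |Y| = s
  + |X|, so both extensions describe one span of cofactor vectors. It contains w extended by its
  values on the dy; restricted to the second variables and carried over by T, this lies in the span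
  for the second presentation.\<close>

theorem cof_transfer:
  assumes r: "P.rank_is X (relations \<pp> X) r" and s: "Q.rank_is Y (relations \<qq> Y) s"
    and w: "w \<in> P.cof X (relations \<pp> X) r"
  shows "(\<lambda>y. subst T (\<Sum>x\<in>X. mpderiv x (S y) * w x)) \<in> Q.cof Y (relations \<qq> Y) s"
proof -
  \<comment> \<open>X and Y are sets of numbers that may overlap, hence the disjoint union.\<close>
  define JX :: "(nat + nat) set" where "JX = Inl ` X"
  define JY :: "(nat + nat) set" where "JY = Inr ` Y"
  define NX where "NX = {u :: nat + nat \<Rightarrow> 'k mpoly. (\<lambda>x. u (Inl x)) \<in> relations \<pp> X}"
  define NY where "NY = {u :: nat + nat \<Rightarrow> 'k mpoly. (\<lambda>y. u (Inr y)) \<in> relS}"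
  \<comment> \<open>At \<open>Inr y\<close> the vector expresses dy through the dx, at
    \<open>Inl x\<close> it expresses dx through the dy; one function serves both
    extensions.\<close>
  define p where "p = (\<lambda>a b. case (a, b) of (Inr y, Inl x) \<Rightarrow> mpderiv x (S y)
    | (Inl x, Inr y) \<Rightarrow> subst S (mpderiv y (T x)) | _ \<Rightarrow> 0)"
  define N where "N = {u. (\<lambda>z. u z + (\<Sum>y\<in>JY. u y * p y z)) \<in> NX}"
  have bij: "bij_betw projl JX X" "bij_betw Inl X JX" "bij_betw projr JY Y" "bij_betw Inr Y JY"
    by (auto simp: JX_def JY_def bij_betw_def inj_on_def image_image)
  have fJ: "finite JX" "finite JY" "JY \<inter> JX = {}" "JX \<inter> JY = {}"
    using fin by (auto simp: JX_def JY_def)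
  have id_hom: "comm_ring_hom (\<lambda>a :: 'k mpoly. a)"
    by unfold_locales auto
  have N': "N = {u. (\<lambda>z. u z + (\<Sum>x\<in>JX. u x * p x z)) \<in> NY}"
    unfolding N_def NX_def NY_def JX_def JY_def mem_Collect_eq
    by (simp add: sum.reindex inj_on_def p_def joint_relations)
  have NX_Inl: "(\<lambda>x. u (Inl x)) \<in> relations \<pp> X" if "u \<in> NX" for u
    using that by (simp add: NX_def)
  have NX_projl: "(\<lambda>z. u (projl z)) \<in> NX" if "u \<in> relations \<pp> X" for u
    using that by (simp add: NX_def)
  have NY_Inr: "(\<lambda>y. subst T (u (Inr y))) \<in> relations \<qq> Y" if "u \<in> NY" for u
  proof -
    obtain G where G: "G \<in> \<qq>" "\<And>y. y \<in> Y \<Longrightarrow> u (Inr y) - subst S (mpderiv y G) \<in> \<pp>"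
      using \<open>u \<in> NY\<close> by (auto simp: NY_def relS_def)
    have "subst T (u (Inr y)) - mpderiv y G \<in> \<qq>" if "y \<in> Y" for y
    proof -
      have "subst T (u (Inr y)) - subst T (subst S (mpderiv y G)) \<in> \<qq>"
        using T_mem[of "u (Inr y) - subst S (mpderiv y G)"] G(2)[OF that] by simp
      then show ?thesis using TS[of "mpderiv y G"] Q.cong_trans by blast
    qed
    then show ?thesis using G(1) by (auto simp: relations_def)
  qed
  have NY_projr: "(\<lambda>z. subst S (u (projr z))) \<in> NY" if "u \<in> relations \<qq> Y" for u
  proof -
    obtain G where G: "G \<in> \<qq>" "\<And>y. y \<in> Y \<Longrightarrow> u y - mpderiv y G \<in> \<qq>"
      using \<open>u \<in> relations \<qq> Y\<close> by (auto simp: relations_def)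
    have "subst S (u y) - subst S (mpderiv y G) \<in> \<pp>" if "y \<in> Y" for y
      using S_mem[of "u y - mpderiv y G"] G(2)[OF that] by simp
    then show ?thesis using G(1) by (auto simp: NY_def relS_def)
  qed
  have "P.minors_vanish JX NX k \<longleftrightarrow> P.minors_vanish X (relations \<pp> X) k" for k
    using minors_vanish_map[OF P.coeff_ideal_axioms P.coeff_ideal_axioms id_hom bij(1) _ NX_projl]
      minors_vanish_map[OF P.coeff_ideal_axioms P.coeff_ideal_axioms id_hom bij(2) _ NX_Inl]
    by blast
  then have rX: "P.rank_is JX NX r"
    using r by (simp add: P.rank_is_def)
  have "P.minors_vanish JY NY k \<longleftrightarrow> Q.minors_vanish Y (relations \<qq> Y) k" for k
    using minors_vanish_map[OF Q.coeff_ideal_axioms P.coeff_ideal_axioms comm_ring_hom_subst bij(3) _ NY_projr]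
      minors_vanish_map[OF P.coeff_ideal_axioms Q.coeff_ideal_axioms comm_ring_hom_subst bij(4) _ NY_Inr]
      S_mem T_mem by blast
  then have rY: "P.rank_is JY NY s"
    using s by (simp add: P.rank_is_def Q.rank_is_def)
  have extX: "P.rank_is (JY \<union> JX) N (r + card JY) \<and>
    (\<forall>w. w \<in> P.cof (JY \<union> JX) N (r + card JY) \<longleftrightarrow> w \<in> P.cof JX NX r \<and> (\<forall>y\<in>JY. w y - dot JX (p y) w \<in> \<pp>))"
    unfolding N_def
  proof (rule P.extend_indices[OF fJ(1) _ _ rX fJ(2,3)])
    show "v \<in> NX" if "u \<in> NX" "\<And>x. x \<in> JX \<Longrightarrow> v x = u x" for u v
      using that relations_cong[of "\<lambda>x. u (Inl x)" "\<lambda>x. v (Inl x)"] P.zero_mem by (simp add: NX_def JX_def)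
    show "(\<lambda>_. 0) \<in> NX"
      using P.zero_mem by (force simp: NX_def relations_def)
  qed
  have extY: "P.rank_is (JX \<union> JY) N (s + card JX) \<and>
    (\<forall>w. w \<in> P.cof (JX \<union> JY) N (s + card JX) \<longleftrightarrow> w \<in> P.cof JY NY s \<and> (\<forall>x\<in>JX. w x - dot JY (p x) w \<in> \<pp>))"
    unfolding N'
  proof (rule P.extend_indices[OF fJ(2) _ _ rY fJ(1,4)])
    show "v \<in> NY" if "u \<in> NY" "\<And>y. y \<in> JY \<Longrightarrow> v y = u y" for u v
      using that relS_cong[of "\<lambda>y. u (Inr y)" "\<lambda>y. v (Inr y)"] P.zero_mem by (simp add: NY_def JY_def)
    show "(\<lambda>_. 0) \<in> NY"
      using P.zero_mem Q.zero_mem by (force simp: NY_def relS_def)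
  qed
  \<comment> \<open>Both sides are the rank of N over the joint index set.\<close>
  have rs: "r + card JY = s + card JX"
    using extX extY P.rank_is_unique[of "JX \<union> JY" N] by (auto simp: Un_commute)
  define w' where "w' = (\<lambda>z. case z of Inl x \<Rightarrow> w x | Inr y \<Rightarrow> (\<Sum>x\<in>X. mpderiv x (S y) * w x))"
  have "(\<lambda>z. w (projl z)) \<in> P.cof JX NX r"
    by (rule cof_map[OF P.coeff_ideal_axioms P.coeff_ideal_axioms id_hom bij(1) _ NX_projl w])
  then have "w' \<in> P.cof JX NX r"
    unfolding P.cof_def by (rule P.cspan_cong) (auto simp: w'_def JX_def P.zero_mem)
  moreover have "w' y - dot JX (p y) w' \<in> \<pp>" if "y \<in> JY" for y
    using that by (auto simp: w'_def JX_def JY_def p_def dot_def sum.reindex inj_on_def P.zero_mem)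
  ultimately have "w' \<in> P.cof (JX \<union> JY) N (s + card JX)"
    using extX rs by (simp add: Un_commute)
  then have w': "w' \<in> P.cof JY NY s"
    using extY by simp
  have "(\<lambda>y. subst T (w' (Inr y))) \<in> Q.cof Y (relations \<qq> Y) s"
    by (rule cof_map[OF P.coeff_ideal_axioms Q.coeff_ideal_axioms comm_ring_hom_subst bij(4) _ NY_Inr w'])
      (simp add: T_mem)
  then show ?thesis by (simp add: w'_def)
qed

end

section \<open>Derivations of quotients of polynomial rings\<close>

text \<open>The map is defined on all polynomials, not only on those in the variables X. Its kernel
  is therefore an ideal of a ring that is a whole type, to which the determinants above apply;
  variables outside X have class 0.\<close>

locale polynomial_quotient =
  fixes A :: "('k::field, 'a) module" and \<pi> :: "'k mpoly \<Rightarrow> 'a" and X :: "nat set"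
  assumes pi_carrier: "carrier A = range \<pi>"
    and pi_add: "\<pi> p \<oplus>\<^bsub>A\<^esub> \<pi> q = \<pi> (p + q)"
    and pi_mult: "\<pi> p \<otimes>\<^bsub>A\<^esub> \<pi> q = \<pi> (p * q)"
    and pi_zero: "\<zero>\<^bsub>A\<^esub> = \<pi> 0"
    and pi_one: "\<one>\<^bsub>A\<^esub> = \<pi> 1"
    and pi_smult: "c \<odot>\<^bsub>A\<^esub> \<pi> p = \<pi> (mconst c * p)"
    and pi_prime: "\<pi> (p * q) = \<pi> 0 \<Longrightarrow> \<pi> p = \<pi> 0 \<or> \<pi> q = \<pi> 0"
    and pi_nontrivial: "\<pi> 1 \<noteq> \<pi> 0"
    and pi_outside: "x \<notin> X \<Longrightarrow> \<pi> (mvar x) = \<pi> 0"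
    and finite_vars: "finite X"
begin

lemmas pi_simps = pi_add pi_mult pi_zero pi_one pi_smult

lemma pi_closed [simp]: "\<pi> p \<in> carrier A"
  by (simp add: pi_carrier)

lemma pi_cases: "a \<in> carrier A \<Longrightarrow> (\<And>p. a = \<pi> p \<Longrightarrow> thesis) \<Longrightarrow> thesis"
  unfolding pi_carrier by blast

definition ker :: "'k mpoly set"
  where "ker = {p. \<pi> p = \<pi> 0}"

lemma A_domain: "domain A"
proof -
  have ac: "p + q = q + p" "p + (q + t) = q + (p + t)" "p + q + t = p + (q + t)"
    "p * q = q * p" "p * (q * t) = q * (p * t)" "p * q * t = p * (q * t)"
    "(p + q) * t = p * t + q * t" "t * (p + q) = t * p + t * q" for p q t :: "'k mpoly"
    by (simp_all add: algebra_simps)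
  have "cring A"
  proof (rule cringI)
    show "abelian_group A"
    proof (rule abelian_groupI)
      fix a assume "a \<in> carrier A"
      then obtain p where a: "a = \<pi> p" by (rule pi_cases)
      have "\<pi> (- p) \<oplus>\<^bsub>A\<^esub> a = \<zero>\<^bsub>A\<^esub>" by (simp add: a pi_simps)
      then show "\<exists>b\<in>carrier A. b \<oplus>\<^bsub>A\<^esub> a = \<zero>\<^bsub>A\<^esub>" by (intro bexI[of _ "\<pi> (- p)"]) simp_all
    qed (auto elim!: pi_cases simp only: pi_simps pi_closed ac add_0_left add_0_right)
    show "comm_monoid A"
      by (rule comm_monoidI) (auto elim!: pi_cases simp only: pi_simps pi_closed ac mult_1_left mult_1_right)
  qed (auto elim!: pi_cases simp only: pi_simps pi_closed ac)
  then show ?thesis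
  proof (intro domain.intro domain_axioms.intro)
    show "\<one>\<^bsub>A\<^esub> \<noteq> \<zero>\<^bsub>A\<^esub>"
      using pi_nontrivial by (simp add: pi_simps)
    fix a b assume ab: "a \<otimes>\<^bsub>A\<^esub> b = \<zero>\<^bsub>A\<^esub>" and "a \<in> carrier A" "b \<in> carrier A"
    then obtain p q where "a = \<pi> p" "b = \<pi> q" by (elim pi_cases)
    then show "a = \<zero>\<^bsub>A\<^esub> \<or> b = \<zero>\<^bsub>A\<^esub>"
      using ab pi_prime[of p q] by (simp add: pi_simps)
  qed
qed

sublocale A: domain A
  by (rule A_domain)

lemma pi_uminus: "\<ominus>\<^bsub>A\<^esub> \<pi> p = \<pi> (- p)"
  by (rule A.minus_equality) (simp_all add: pi_simps)

lemma pi_eq_iff: "\<pi> p = \<pi> q \<longleftrightarrow> p - q \<in> ker"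
proof -
  have "\<pi> p = \<pi> q \<longleftrightarrow> \<pi> p \<oplus>\<^bsub>A\<^esub> \<pi> (- q) = \<pi> q \<oplus>\<^bsub>A\<^esub> \<pi> (- q)"
    by (rule A.add.right_cancel[symmetric]) simp_all
  then show ?thesis by (simp add: pi_add ker_def)
qed

sublocale ker: coeff_ideal ker
proof
  show "0 \<in> ker" by (simp add: ker_def)
  show "a + b \<in> ker" if "a \<in> ker" "b \<in> ker" for a b
    using that pi_add[of a b] pi_add[of 0 0] by (simp add: ker_def)
  show "a * b \<in> ker" if "b \<in> ker" for a b
    using that pi_mult[of a b] pi_mult[of a 0] by (simp add: ker_def)
qed

lemma ker_prime: "p * q \<in> ker \<Longrightarrow> p \<in> ker \<or> q \<in> ker"
  using pi_prime by (simp add: ker_def)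

lemma one_notin_ker: "1 \<notin> ker"
  using pi_nontrivial by (simp add: ker_def)

lemma pi_sum: "finite S \<Longrightarrow> (\<Oplus>\<^bsub>A\<^esub>i\<in>S. \<pi> (f i)) = \<pi> (sum f S)"
  by (induction S rule: finite_induct) (simp_all add: pi_simps A.finsum_insert)

lemma pi_prod: "finite S \<Longrightarrow> (\<Otimes>\<^bsub>A\<^esub>i\<in>S. \<pi> (f i)) = \<pi> (prod f S)"
  by (induction S rule: finite_induct) (simp_all add: pi_simps A.finprod_insert)

lemma pi_sign:
  assumes "k = 1 \<or> k = (-1 :: int)"
  shows "[k] \<cdot>\<^bsub>A\<^esub> \<pi> p = \<pi> (of_int k * p)"
  using assms A.add.int_pow_neg[of "\<pi> p" 1] by (auto simp: pi_uminus)

lemma DerE: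
  assumes "D \<in> Der A"
  shows "D \<in> carrier A \<rightarrow>\<^sub>E carrier A"
    and "D (\<pi> (p + q)) = D (\<pi> p) \<oplus>\<^bsub>A\<^esub> D (\<pi> q)"
    and "D (\<pi> (p * q)) = D (\<pi> p) \<otimes>\<^bsub>A\<^esub> \<pi> q \<oplus>\<^bsub>A\<^esub> \<pi> p \<otimes>\<^bsub>A\<^esub> D (\<pi> q)"
    and "D (\<pi> (mconst c)) = \<zero>\<^bsub>A\<^esub>"
proof -
  have D: "D \<in> carrier A \<rightarrow>\<^sub>E carrier A"
    and add: "\<And>a b. a \<in> carrier A \<Longrightarrow> b \<in> carrier A \<Longrightarrow> D (a \<oplus>\<^bsub>A\<^esub> b) = D a \<oplus>\<^bsub>A\<^esub> D b"
    and smult: "\<And>c a. a \<in> carrier A \<Longrightarrow> D (c \<odot>\<^bsub>A\<^esub> a) = c \<odot>\<^bsub>A\<^esub> D a"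
    and mult: "\<And>a b. a \<in> carrier A \<Longrightarrow> b \<in> carrier A \<Longrightarrow> D (a \<otimes>\<^bsub>A\<^esub> b) = D a \<otimes>\<^bsub>A\<^esub> b \<oplus>\<^bsub>A\<^esub> a \<otimes>\<^bsub>A\<^esub> D b"
    using assms by (simp_all add: Der_def End_alg_def)
  show "D \<in> carrier A \<rightarrow>\<^sub>E carrier A" by (rule D)
  have D_closed: "D (\<pi> p) \<in> carrier A" for p using D by (auto simp: PiE_iff)
  show "D (\<pi> (p + q)) = D (\<pi> p) \<oplus>\<^bsub>A\<^esub> D (\<pi> q)"
    using add[of "\<pi> p" "\<pi> q"] by (simp add: pi_add)
  show "D (\<pi> (p * q)) = D (\<pi> p) \<otimes>\<^bsub>A\<^esub> \<pi> q \<oplus>\<^bsub>A\<^esub> \<pi> p \<otimes>\<^bsub>A\<^esub> D (\<pi> q)"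
    using mult[of "\<pi> p" "\<pi> q"] by (simp add: pi_mult)
  \<comment> \<open>From D(1 * 1) = D(1) + D(1).\<close>
  have D1: "D (\<pi> 1) = \<zero>\<^bsub>A\<^esub>"
  proof -
    obtain d where d: "D (\<pi> 1) = \<pi> d"
      using D_closed by (rule pi_cases)
    have "\<pi> d = \<pi> (d + d)"
      using mult[of "\<pi> 1" "\<pi> 1"] by (simp add: pi_simps d)
    then have "- d \<in> ker" by (simp add: pi_eq_iff)
    then show ?thesis
      using ker.uminus_mem[of "- d"] by (simp add: d pi_zero ker_def)
  qed
  show "D (\<pi> (mconst c)) = \<zero>\<^bsub>A\<^esub>"
    using smult[of "\<pi> 1" c] D1 by (simp add: pi_smult pi_zero)
qed

text \<open>These are the vectors w for which the operator taking p to the sum of w_x dp/dx descends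
  to A.\<close>

definition tangent :: "(nat \<Rightarrow> 'k mpoly) \<Rightarrow> bool"
  where "tangent w \<longleftrightarrow> (\<forall>F\<in>ker. dot X w (\<lambda>x. mpderiv x F) \<in> ker)"

text \<open>The operator is evaluated on a chosen representative; for tangent w the result does not
  depend on the choice.\<close>

definition delta :: "(nat \<Rightarrow> 'k mpoly) \<Rightarrow> 'a \<Rightarrow> 'a"
  where "delta w = (\<lambda>a\<in>carrier A. \<pi> (dot X w (\<lambda>x. mpderiv x (SOME p. \<pi> p = a))))"

lemma delta_pi:
  assumes "tangent w"
  shows "delta w (\<pi> p) = \<pi> (dot X w (\<lambda>x. mpderiv x p))"
proof -
  define q where "q = (SOME q. \<pi> q = \<pi> p)"
  have "\<pi> q = \<pi> p"
    unfolding q_def by (rule someI[of _ p]) simp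
  then have "dot X w (\<lambda>x. mpderiv x (q - p)) \<in> ker"
    using assms unfolding tangent_def pi_eq_iff by blast
  then have "\<pi> (dot X w (\<lambda>x. mpderiv x q)) = \<pi> (dot X w (\<lambda>x. mpderiv x p))"
    by (simp add: dot_diff_right pi_eq_iff)
  then show ?thesis by (simp add: delta_def q_def)
qed

lemma delta_mvar:
  assumes "tangent w" "x \<in> X"
  shows "delta w (\<pi> (mvar x)) = \<pi> (w x)"
proof -
  have "dot X w (\<lambda>y. mpderiv y (mvar x)) = w x"
    using dot_unit[OF finite_vars assms(2), of w] by (simp add: mpderiv_mvar dot_commute)
  then show ?thesis by (simp add: delta_pi[OF assms(1)])
qed

lemma delta_Der:
  assumes "tangent w"
  shows "delta w \<in> Der A"
proof -
  have mem: "delta w \<in> carrier A \<rightarrow>\<^sub>E carrier A"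
    by (auto simp: delta_def)
  have "delta w (\<pi> (p * q)) = delta w (\<pi> p) \<otimes>\<^bsub>A\<^esub> \<pi> q \<oplus>\<^bsub>A\<^esub> \<pi> p \<otimes>\<^bsub>A\<^esub> delta w (\<pi> q)" for p q
  proof -
    have "dot X w (\<lambda>x. mpderiv x p * q) = dot X w (\<lambda>x. mpderiv x p) * q"
      using dot_scale_right[of X w q] by (simp add: mult.commute)
    then show ?thesis
      by (simp add: delta_pi[OF assms] pi_simps dot_add_right dot_scale_right)
  qed
  moreover have "delta w (\<pi> (p + q)) = delta w (\<pi> p) \<oplus>\<^bsub>A\<^esub> delta w (\<pi> q)" for p q
    by (simp add: delta_pi[OF assms] pi_simps dot_add_right)
  moreover have "delta w (\<pi> (mconst c * p)) = c \<odot>\<^bsub>A\<^esub> delta w (\<pi> p)" for c p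
    by (simp add: delta_pi[OF assms] pi_simps dot_scale_right)
  ultimately show ?thesis
    using mem unfolding Der_def End_alg_def by (auto elim!: pi_cases simp: pi_simps)
qed

text \<open>A derivation is determined by its values on the classes of the variables. Tangency
  expresses that the resulting formula must give 0 on the kernel, as D maps 0 to 0.\<close>

lemma Der_eq_delta:
  assumes D: "D \<in> Der A" and w: "\<And>x. x \<in> X \<Longrightarrow> D (\<pi> (mvar x)) = \<pi> (w x)"
  shows "tangent w \<and> D = delta w"
proof -
  have D0: "D (\<pi> 0) = \<pi> 0"
    using DerE(4)[OF D, of 0] by (simp add: pi_zero)
  have key: "D (\<pi> p) = \<pi> (dot X w (\<lambda>x. mpderiv x p))" for p
  proof (induction p rule: mpoly_induct)
    case (const c)
    then show ?case by (simp add: DerE(4)[OF D] pi_zero)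
  next
    case (var j)
    show ?case
    proof (cases "j \<in> X")
      case True
      then show ?thesis
        using dot_unit[OF finite_vars True, of w] w[OF True] by (simp add: mpderiv_mvar dot_commute)
    next
      case False
      then have "dot X w (\<lambda>x. mpderiv x (mvar j)) = 0"
        unfolding dot_def by (intro sum.neutral) (auto simp: mpderiv_mvar)
      then show ?thesis using pi_outside[OF False] D0 by simp
    qed
  next
    case (add p q)
    then show ?case by (simp add: DerE(2)[OF D] pi_simps dot_add_right)
  next
    case (mult p q)
    have "dot X w (\<lambda>x. mpderiv x p * q) = dot X w (\<lambda>x. mpderiv x p) * q"
      using dot_scale_right[of X w q] by (simp add: mult.commute)
    then show ?case using mult by (simp add: DerE(3)[OF D] pi_simps dot_add_right dot_scale_right)
  qed
  have tangent: "tangent w"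
    unfolding tangent_def
  proof
    fix F assume "F \<in> ker"
    then have "\<pi> (dot X w (\<lambda>x. mpderiv x F)) = \<pi> 0"
      using key[of F] D0 by (simp add: ker_def)
    then show "dot X w (\<lambda>x. mpderiv x F) \<in> ker" by (simp add: ker_def)
  qed
  moreover have "D = delta w"
  proof (rule PiE_ext[OF DerE(1)[OF D] DerE(1)[OF delta_Der[OF tangent]]])
    fix a assume "a \<in> carrier A"
    then show "D a = delta w a"
      by (auto elim!: pi_cases simp: key delta_pi[OF tangent])
  qed
  ultimately show ?thesis ..
qed

text \<open>Both determinants are Leibniz sums; the successor map transports permutations of {0..<r}
  to permutations of {1..r} and preserves signs.\<close>

lemma determinant_pi:
  assumes "\<And>i j. i \<in> {1..r} \<Longrightarrow> j \<in> {1..r} \<Longrightarrow> M i j = \<pi> (m i j)"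
  shows "determinant A r M = \<pi> (fdet r (\<lambda>i j. m (Suc i) (Suc j)))"
proof -
  let ?P = "{p. p permutes {1..r}}" and ?Q = "{p. p permutes {0..<r}}"
  have bij: "bij_betw Suc {0..<r} {1..r}"
    by (auto simp: bij_betw_def image_Suc_atLeastLessThan)
  have "determinant A r M = (\<Oplus>\<^bsub>A\<^esub>p\<in>?P. \<pi> (of_int (sign p) * (\<Prod>i\<in>{1..r}. m i (p i))))"
    unfolding determinant_def
  proof (rule A.finsum_cong')
    fix p assume "p \<in> ?P"
    then have p: "p permutes {1..r}" by simp
    have "(\<Otimes>\<^bsub>A\<^esub>i\<in>{1..r}. M i (p i)) = (\<Otimes>\<^bsub>A\<^esub>i\<in>{1..r}. \<pi> (m i (p i)))"
      using assms permutes_in_image[OF p] by (intro A.finprod_cong') auto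
    then show "[sign p] \<cdot>\<^bsub>A\<^esub> (\<Otimes>\<^bsub>A\<^esub>i\<in>{1..r}. M i (p i)) = \<pi> (of_int (sign p) * (\<Prod>i\<in>{1..r}. m i (p i)))"
      using pi_sign[of "sign p"] by (simp add: pi_prod sign_def)
  qed auto
  also have "\<dots> = \<pi> (\<Sum>p\<in>?P. of_int (sign p) * (\<Prod>i\<in>{1..r}. m i (p i)))"
    by (rule pi_sum) (simp add: finite_permutations)
  also have "(\<Sum>p\<in>?P. of_int (sign p) * (\<Prod>i\<in>{1..r}. m i (p i)))
      = (\<Sum>p\<in>?Q. of_int (sign (map_permutation {0..<r} Suc p)) *
          (\<Prod>i\<in>{1..r}. m i (map_permutation {0..<r} Suc p i)))"
  proof (rule sum.reindex_bij_betw[symmetric])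
    have "map_permutation {0..<r} Suc = (\<lambda>p x. if x \<in> {1..r} then Suc (p (inv_into {0..<r} Suc x)) else x)"
      using bij by (auto simp: map_permutation_def restrict_id_def bij_betw_def fun_eq_iff)
    then show "bij_betw (map_permutation {0..<r} Suc) ?Q ?P"
      using bij_betw_permutations[OF bij] by simp
  qed
  also have "\<dots> = fdet r (\<lambda>i j. m (Suc i) (Suc j))"
    unfolding fdet_def det_def'[OF mat_carrier]
  proof (rule sum.cong[OF refl])
    fix p assume "p \<in> ?Q"
    then have p: "p permutes {0..<r}" by simp
    have "(\<Prod>i\<in>{1..r}. m i (map_permutation {0..<r} Suc p i))
        = (\<Prod>i\<in>{0..<r}. m (Suc i) (map_permutation {0..<r} Suc p (Suc i)))"
      by (rule prod.reindex_bij_betw[OF bij, symmetric])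
    also have "\<dots> = (\<Prod>i\<in>{0..<r}. m (Suc i) (Suc (p i)))"
      by (intro prod.cong refl) (simp add: map_permutation_apply)
    finally show "of_int (sign (map_permutation {0..<r} Suc p)) * (\<Prod>i\<in>{1..r}. m i (map_permutation {0..<r} Suc p i))
        = of_int (sign p) * (\<Prod>i\<in>{0..<r}. mat r r (\<lambda>(i, j). m (Suc i) (Suc j)) $$ (i, p i))"
      using permutes_in_image[OF p] p by (simp add: sign_map_permutation)
  qed
  finally show ?thesis .
qed

end

section \<open>Rank over the field of fractions\<close>

text \<open>Lets linearity in a single row carry a property from a generating set G to all of N. The
  auxiliary claim, proved by induction on t, lets the first t rows be in N and keeps the others in
  G.\<close>

lemma rows_induct:
  fixes k :: nat
  assumes base: "\<And>a. (\<forall>i<k. a i \<in> G) \<Longrightarrow> P a"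
    and step: "\<And>a s u. s < k \<Longrightarrow> u \<in> N \<Longrightarrow> (\<And>v. v \<in> G \<Longrightarrow> P (a(s := v))) \<Longrightarrow> P (a(s := u))"
    and a: "\<forall>i<k. a i \<in> N"
  shows "P a"
proof -
  have "\<forall>b. (\<forall>i<t. b i \<in> N) \<longrightarrow> (\<forall>i<k. t \<le> i \<longrightarrow> b i \<in> G) \<longrightarrow> P b" if "t \<le> k" for t
    using that
  proof (induction t)
    case 0
    then show ?case using base by simp
  next
    case (Suc t)
    show ?case
    proof (intro allI impI)
      fix b assume b: "\<forall>i<Suc t. b i \<in> N" "\<forall>i<k. Suc t \<le> i \<longrightarrow> b i \<in> G"
      have "P (b(t := v))" if "v \<in> G" for v
      proof -
        have "\<forall>i<t. (b(t := v)) i \<in> N" "\<forall>i<k. t \<le> i \<longrightarrow> (b(t := v)) i \<in> G"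
          using b that by simp_all
        then show ?thesis
          using spec[OF Suc.IH[OF Suc_leD[OF Suc.prems]], of "b(t := v)"] by blast
      qed
      then have "P (b(t := b t))"
        using Suc.prems b by (intro step[of t "b t" b]) simp_all
      then show "P b" by simp
    qed
  qed
  from spec[OF this[OF order_refl], of a] show ?thesis using a by simp
qed

section \<open>Fractions by representatives\<close>

context polynomial_quotient
begin

definition fr :: "'k mpoly \<Rightarrow> 'k mpoly \<Rightarrow> ('a \<times> 'a) set"
  where "fr p s = fraction A (\<pi> p) (\<pi> s)"

lemma pi_nonzero: "\<pi> s \<in> carrier A - {\<zero>\<^bsub>A\<^esub>} \<longleftrightarrow> s \<notin> ker"
  by (simp add: pi_zero ker_def)

lemma mem_fr: "x \<in> fr p s \<longleftrightarrow> (\<exists>q t. x = (\<pi> q, \<pi> t) \<and> t \<notin> ker \<and> p * t - q * s \<in> ker)"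
proof -
  have "(b, t) \<in> fr p s \<longleftrightarrow> (\<exists>q u. b = \<pi> q \<and> t = \<pi> u \<and> u \<notin> ker \<and> p * u - q * s \<in> ker)" for b t
    unfolding fr_def fraction_def pi_eq_iff[symmetric] pi_nonzero[symmetric]
    by (auto simp: pi_mult elim!: pi_cases) blast
  then show ?thesis by (cases x) simp
qed

lemma fr_eq_iff:
  assumes "s \<notin> ker" "t \<notin> ker"
  shows "fr p s = fr q t \<longleftrightarrow> p * t - q * s \<in> ker"
proof
  assume "fr p s = fr q t"
  moreover have "(\<pi> p, \<pi> s) \<in> fr p s"
    using assms ker.zero_mem unfolding mem_fr by force
  ultimately have "(\<pi> p, \<pi> s) \<in> fr q t" by simp
  then obtain q' t' where "\<pi> p = \<pi> q'" "\<pi> s = \<pi> t'" "q * t' - q' * t \<in> ker"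
    unfolding mem_fr by auto
  then have "\<pi> (q * s) = \<pi> (p * t)"
    unfolding pi_eq_iff[symmetric] pi_mult[symmetric] by simp
  then show "p * t - q * s \<in> ker"
    by (metis pi_eq_iff)
next
  assume eq: "p * t - q * s \<in> ker"
  have sub: "fr p s \<subseteq> fr q t" if "p * t - q * s \<in> ker" "s \<notin> ker" for p q s t
  proof
    fix x assume "x \<in> fr p s"
    then obtain b u where x: "x = (\<pi> b, \<pi> u)" "u \<notin> ker" "p * u - b * s \<in> ker"
      unfolding mem_fr by blast
    \<comment> \<open>Transitivity of cross-multiplication up to the factor s, which is cancelled
      because the kernel is prime.\<close>
    have "s * (q * u - b * t) = t * (p * u - b * s) - u * (p * t - q * s)"
      by (simp add: algebra_simps)
    also have "\<dots> \<in> ker"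
      by (rule ker.diff_mem[OF ker.mult_mem[OF x(3)] ker.mult_mem[OF that(1)]])
    finally have "q * u - b * t \<in> ker"
      using ker_prime that(2) by blast
    then show "x \<in> fr q t" using x mem_fr by blast
  qed
  have "q * s - p * t \<in> ker"
    using ker.uminus_mem[OF eq] by simp
  then show "fr p s = fr q t"
    using sub[OF eq assms(1)] sub[of q s p t] assms(2) by blast
qed

lemma mem_fr_iff: "x \<in> fr p s \<longleftrightarrow> (\<exists>q t. x = (\<pi> q, \<pi> t) \<and> t \<notin> ker \<and> fr q t = fr p s)" if "s \<notin> ker"
proof -
  have "p * t - q * s \<in> ker \<longleftrightarrow> fr q t = fr p s" if "t \<notin> ker" for q t
    using fr_eq_iff[OF \<open>s \<notin> ker\<close> that, of p q] by auto
  then show ?thesis unfolding mem_fr by blast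
qed

lemma mult_notin_ker: "s \<notin> ker \<Longrightarrow> t \<notin> ker \<Longrightarrow> s * t \<notin> ker"
  using ker_prime by blast

lemma prod_notin_ker: "finite S \<Longrightarrow> (\<And>i. i \<in> S \<Longrightarrow> s i \<notin> ker) \<Longrightarrow> prod s S \<notin> ker"
  by (induction S rule: finite_induct) (auto simp: one_notin_ker mult_notin_ker)

abbreviation (input) "FF \<equiv> fraction_field A"

text \<open>The operations on fractions are unions over all representatives. Both classes are
  nonempty, so a union whose members all equal c is c itself.\<close>

lemma fr_union:
  assumes s: "s \<notin> ker" and t: "t \<notin> ker"
    and const: "\<And>p' s' q' t'. s' \<notin> ker \<Longrightarrow> t' \<notin> ker \<Longrightarrow> fr p' s' = fr p s \<Longrightarrow> fr q' t' = fr q t \<Longrightarrow>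
      h (\<pi> p') (\<pi> s') (\<pi> q') (\<pi> t') = c"
  shows "(\<Union>(a, s') \<in> fr p s. \<Union>(b, t') \<in> fr q t. h a s' b t') = c"
proof -
  have "(case x of (a, s') \<Rightarrow> \<Union>(b, t') \<in> fr q t. h a s' b t') = c" if "x \<in> fr p s" for x
  proof -
    from that obtain p' s' where x: "x = (\<pi> p', \<pi> s')" "s' \<notin> ker" "fr p' s' = fr p s"
      unfolding mem_fr_iff[OF s] by blast
    have "(case y of (b, t') \<Rightarrow> h (\<pi> p') (\<pi> s') b t') = c" if "y \<in> fr q t" for y
      using that x const unfolding mem_fr_iff[OF t] by auto
    moreover have "fr q t \<noteq> {}"
      using mem_fr_iff[OF t] t by blast
    ultimately show ?thesis by (simp add: x)
  qed
  moreover have "fr p s \<noteq> {}"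
    using mem_fr_iff[OF s] s by blast
  ultimately show ?thesis by simp
qed

lemma fr_mult:
  assumes "s \<notin> ker" "t \<notin> ker"
  shows "fr p s \<otimes>\<^bsub>FF\<^esub> fr q t = fr (p * q) (s * t)"
  unfolding fraction_field_def monoid.simps
proof (rule fr_union[OF assms])
  fix p' s' q' t'
  assume s': "s' \<notin> ker" and t': "t' \<notin> ker" and eq: "fr p' s' = fr p s" "fr q' t' = fr q t"
  have "p' * s - p * s' \<in> ker" "q' * t - q * t' \<in> ker"
    using eq assms s' t' by (simp_all add: fr_eq_iff)
  then have "(p' * s) * (q' * t) - (p * s') * (q * t') \<in> ker"
    by (rule ker.cong_mult)
  then have "fr (p' * q') (s' * t') = fr (p * q) (s * t)"
    using assms s' t' by (simp add: fr_eq_iff mult_notin_ker ac_simps)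
  then show "fraction A (\<pi> p' \<otimes>\<^bsub>A\<^esub> \<pi> q') (\<pi> s' \<otimes>\<^bsub>A\<^esub> \<pi> t') = fr (p * q) (s * t)"
    by (simp add: fr_def pi_mult)
qed

lemma fr_add:
  assumes "s \<notin> ker" "t \<notin> ker"
  shows "fr p s \<oplus>\<^bsub>FF\<^esub> fr q t = fr (p * t + q * s) (s * t)"
  unfolding fraction_field_def ring.simps
proof (rule fr_union[OF assms])
  fix p' s' q' t'
  assume s': "s' \<notin> ker" and t': "t' \<notin> ker" and eq: "fr p' s' = fr p s" "fr q' t' = fr q t"
  have "p' * s - p * s' \<in> ker" "q' * t - q * t' \<in> ker"
    using eq assms s' t' by (simp_all add: fr_eq_iff)
  then have "(t' * t) * (p' * s - p * s') + (s' * s) * (q' * t - q * t') \<in> ker"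
    by (intro ker.add_mem ker.mult_mem)
  then have "(p' * t' + q' * s') * (s * t) - (p * t + q * s) * (s' * t') \<in> ker"
    by (simp add: algebra_simps)
  then have "fr (p' * t' + q' * s') (s' * t') = fr (p * t + q * s) (s * t)"
    using assms s' t' by (simp add: fr_eq_iff mult_notin_ker)
  then show "fraction A (\<pi> p' \<otimes>\<^bsub>A\<^esub> \<pi> t' \<oplus>\<^bsub>A\<^esub> \<pi> q' \<otimes>\<^bsub>A\<^esub> \<pi> s') (\<pi> s' \<otimes>\<^bsub>A\<^esub> \<pi> t') = fr (p * t + q * s) (s * t)"
    by (simp add: fr_def pi_mult pi_add)
qed

lemma FF_carrier: "x \<in> carrier FF \<longleftrightarrow> (\<exists>p s. s \<notin> ker \<and> x = fr p s)"
proof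
  assume "x \<in> carrier FF"
  then obtain a b where x: "x = fraction A a b" "a \<in> carrier A" "b \<in> carrier A - {\<zero>\<^bsub>A\<^esub>}"
    unfolding fraction_field_def partial_object.simps by blast
  then obtain p s where "a = \<pi> p" "b = \<pi> s"
    by (metis DiffD1 pi_cases)
  then show "\<exists>p s. s \<notin> ker \<and> x = fr p s"
    using x pi_nonzero fr_def by blast
next
  assume "\<exists>p s. s \<notin> ker \<and> x = fr p s"
  then show "x \<in> carrier FF"
    unfolding fraction_field_def partial_object.simps fr_def pi_nonzero[symmetric]
    using pi_closed by blast
qed

lemma FF_cases: "x \<in> carrier FF \<Longrightarrow> (\<And>p s. s \<notin> ker \<Longrightarrow> x = fr p s \<Longrightarrow> thesis) \<Longrightarrow> thesis"
  unfolding FF_carrier by blast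

lemma fr_carrier: "s \<notin> ker \<Longrightarrow> fr p s \<in> carrier FF"
  unfolding FF_carrier by blast

lemma FF_zero: "\<zero>\<^bsub>FF\<^esub> = fr 0 1"
  by (simp add: fraction_field_def fr_def pi_zero pi_one)

lemma FF_one: "\<one>\<^bsub>FF\<^esub> = fr 1 1"
  by (simp add: fraction_field_def fr_def pi_one)

lemma fr_eqI: "s \<notin> ker \<Longrightarrow> t \<notin> ker \<Longrightarrow> p * t = q * s \<Longrightarrow> fr p s = fr q t"
  by (simp add: fr_eq_iff ker.zero_mem)

lemma FF_cring: "cring FF"
proof (rule cringI)
  show "abelian_group FF"
  proof (rule abelian_groupI)
    show "x \<oplus>\<^bsub>FF\<^esub> y \<in> carrier FF" if "x \<in> carrier FF" "y \<in> carrier FF" for x y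
      using that by (elim FF_cases) (simp add: fr_add fr_carrier mult_notin_ker)
    show "\<zero>\<^bsub>FF\<^esub> \<in> carrier FF"
      by (simp add: FF_zero fr_carrier one_notin_ker)
    show "x \<oplus>\<^bsub>FF\<^esub> y \<oplus>\<^bsub>FF\<^esub> z = x \<oplus>\<^bsub>FF\<^esub> (y \<oplus>\<^bsub>FF\<^esub> z)"
      if "x \<in> carrier FF" "y \<in> carrier FF" "z \<in> carrier FF" for x y z
      using that by (elim FF_cases) (simp add: fr_add mult_notin_ker, simp add: algebra_simps)
    show "x \<oplus>\<^bsub>FF\<^esub> y = y \<oplus>\<^bsub>FF\<^esub> x" if "x \<in> carrier FF" "y \<in> carrier FF" for x y
      using that by (elim FF_cases) (simp add: fr_add mult_notin_ker, simp add: algebra_simps)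
    show "\<zero>\<^bsub>FF\<^esub> \<oplus>\<^bsub>FF\<^esub> x = x" if "x \<in> carrier FF" for x
      using that by (elim FF_cases) (simp add: fr_add FF_zero one_notin_ker)
    show "\<exists>y\<in>carrier FF. y \<oplus>\<^bsub>FF\<^esub> x = \<zero>\<^bsub>FF\<^esub>" if "x \<in> carrier FF" for x
    proof -
      from that obtain p s where x: "s \<notin> ker" "x = fr p s" by (rule FF_cases)
      have "fr (- p) s \<oplus>\<^bsub>FF\<^esub> x = \<zero>\<^bsub>FF\<^esub>"
        using x one_notin_ker by (simp add: FF_zero fr_add) (intro fr_eqI mult_notin_ker, simp_all)
      then show ?thesis using fr_carrier[OF x(1)] by blast
    qed
  qed
  show "comm_monoid FF"
  proof (rule comm_monoidI)
    show "x \<otimes>\<^bsub>FF\<^esub> y \<in> carrier FF" if "x \<in> carrier FF" "y \<in> carrier FF" for x y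
      using that by (elim FF_cases) (simp add: fr_mult fr_carrier mult_notin_ker)
    show "\<one>\<^bsub>FF\<^esub> \<in> carrier FF"
      by (simp add: FF_one fr_carrier one_notin_ker)
    show "x \<otimes>\<^bsub>FF\<^esub> y \<otimes>\<^bsub>FF\<^esub> z = x \<otimes>\<^bsub>FF\<^esub> (y \<otimes>\<^bsub>FF\<^esub> z)"
      if "x \<in> carrier FF" "y \<in> carrier FF" "z \<in> carrier FF" for x y z
      using that by (elim FF_cases) (simp add: fr_mult mult_notin_ker, simp add: algebra_simps)
    show "x \<otimes>\<^bsub>FF\<^esub> y = y \<otimes>\<^bsub>FF\<^esub> x" if "x \<in> carrier FF" "y \<in> carrier FF" for x y
      using that by (elim FF_cases) (simp add: fr_mult mult_notin_ker, simp add: algebra_simps)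
    show "\<one>\<^bsub>FF\<^esub> \<otimes>\<^bsub>FF\<^esub> x = x" if "x \<in> carrier FF" for x
      using that by (elim FF_cases) (simp add: fr_mult FF_one one_notin_ker)
  qed
  show "(x \<oplus>\<^bsub>FF\<^esub> y) \<otimes>\<^bsub>FF\<^esub> z = x \<otimes>\<^bsub>FF\<^esub> z \<oplus>\<^bsub>FF\<^esub> y \<otimes>\<^bsub>FF\<^esub> z"
    if "x \<in> carrier FF" "y \<in> carrier FF" "z \<in> carrier FF" for x y z
    using that
  proof (elim FF_cases)
    fix p s q t u v assume "s \<notin> ker" "t \<notin> ker" "v \<notin> ker" and x: "x = fr p s" "y = fr q t" "z = fr u v"
    then show ?thesis
      by (simp add: fr_add fr_mult mult_notin_ker) (intro fr_eqI mult_notin_ker, simp_all add: algebra_simps)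
  qed
qed

sublocale FF: cring "fraction_field A"
  by (rule FF_cring)

lemma fr_sum: "finite S \<Longrightarrow> t \<notin> ker \<Longrightarrow> (\<Oplus>\<^bsub>FF\<^esub>i\<in>S. fr (h i) t) = fr (sum h S) t"
proof (induction S rule: finite_induct)
  case empty
  then show ?case by (simp add: FF_zero fr_eqI one_notin_ker)
next
  case (insert i S)
  have "fr (h i) t \<oplus>\<^bsub>FF\<^esub> fr (sum h S) t = fr (h i + sum h S) t"
    using insert.prems by (simp add: fr_add) (intro fr_eqI mult_notin_ker, simp_all add: algebra_simps)
  then show ?case using insert by (simp add: fr_carrier FF.finsum_insert)
qed

section \<open>Linear independence and nonvanishing minors\<close>

definition independent :: "(nat \<Rightarrow> nat \<Rightarrow> 'k mpoly) \<Rightarrow> nat set \<Rightarrow> bool"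
  where "independent g S \<longleftrightarrow> (\<forall>c. (\<forall>x\<in>X. (\<Sum>i\<in>S. c i * g i x) \<in> ker) \<longrightarrow> (\<forall>i\<in>S. c i \<in> ker))"

text \<open>Clearing denominators: the finitely many coefficients are written over one common
  denominator t, which is outside the kernel as a product of elements outside a prime ideal.\<close>

lemma rows_independent_iff:
  assumes X: "X = {1..n}" and S: "finite S"
    and M: "\<And>i x. i \<in> S \<Longrightarrow> x \<in> X \<Longrightarrow> M i x = fr (g i x) 1"
  shows "rows_independent FF n M S \<longleftrightarrow> independent g S"
proof -
  have fr_0: "fr p t = \<zero>\<^bsub>FF\<^esub> \<longleftrightarrow> p \<in> ker" if "t \<notin> ker" for p t
    using that one_notin_ker by (simp add: FF_zero fr_eq_iff)
  have comb: "(\<Oplus>\<^bsub>FF\<^esub>i\<in>S. c i \<otimes>\<^bsub>FF\<^esub> M i x) = fr (\<Sum>i\<in>S. h i * g i x) t"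
    if t: "t \<notin> ker" and x: "x \<in> X" and c: "\<And>i. i \<in> S \<Longrightarrow> c i = fr (h i) t" for c h t x
  proof -
    have "(\<Oplus>\<^bsub>FF\<^esub>i\<in>S. c i \<otimes>\<^bsub>FF\<^esub> M i x) = (\<Oplus>\<^bsub>FF\<^esub>i\<in>S. fr (h i * g i x) t)"
      using M x c t one_notin_ker by (intro FF.finsum_cong') (auto simp: fr_mult fr_carrier)
    then show ?thesis using fr_sum[OF S t] by simp
  qed
  show ?thesis
  proof
    assume ind: "rows_independent FF n M S"
    show "independent g S"
      unfolding independent_def
    proof (intro allI impI)
      fix c assume c: "\<forall>x\<in>X. (\<Sum>i\<in>S. c i * g i x) \<in> ker"
      define c' where "c' = (\<lambda>i. fr (c i) 1)"
      have "c' \<in> S \<rightarrow> carrier FF"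
        using one_notin_ker by (simp add: c'_def fr_carrier)
      moreover have "\<forall>x\<in>{1..n}. (\<Oplus>\<^bsub>FF\<^esub>i\<in>S. c' i \<otimes>\<^bsub>FF\<^esub> M i x) = \<zero>\<^bsub>FF\<^esub>"
        using comb[OF one_notin_ker, of _ c' c] c one_notin_ker X by (simp add: c'_def fr_0)
      ultimately have "\<forall>i\<in>S. c' i = \<zero>\<^bsub>FF\<^esub>"
        using ind unfolding rows_independent_def by blast
      then show "\<forall>i\<in>S. c i \<in> ker"
        using one_notin_ker by (simp add: c'_def fr_0)
    qed
  next
    assume ind: "independent g S"
    show "rows_independent FF n M S"
      unfolding rows_independent_def
    proof (intro ballI impI)
      fix c i assume c: "c \<in> S \<rightarrow> carrier FF" and i: "i \<in> S"
        and rel: "\<forall>x\<in>{1..n}. (\<Oplus>\<^bsub>FF\<^esub>i\<in>S. c i \<otimes>\<^bsub>FF\<^esub> M i x) = \<zero>\<^bsub>FF\<^esub>"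
      have "\<forall>i\<in>S. \<exists>p s. s \<notin> ker \<and> c i = fr p s"
        using c FF_carrier by blast
      then obtain p s where ps: "\<And>i. i \<in> S \<Longrightarrow> s i \<notin> ker" "\<And>i. i \<in> S \<Longrightarrow> c i = fr (p i) (s i)"
        by metis
      define t where "t = prod s S"
      have t: "t \<notin> ker" unfolding t_def using S ps(1) by (rule prod_notin_ker)
      define h where "h = (\<lambda>i. p i * prod s (S - {i}))"
      have ch: "c i = fr (h i) t" if "i \<in> S" for i
        unfolding ps(2)[OF that]
      proof (rule fr_eqI[OF ps(1)[OF that] t])
        show "p i * t = h i * s i"
          using prod.remove[OF S that, of s] by (simp add: t_def h_def ac_simps)
      qed
      have "\<forall>x\<in>X. (\<Sum>i\<in>S. h i * g i x) \<in> ker"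
        using rel X fr_0[OF t] comb[OF t _ ch] by auto
      then have "h i \<in> ker"
        using ind i unfolding independent_def by blast
      then show "c i = \<zero>\<^bsub>FF\<^esub>"
        using ch[OF i] fr_0[OF t] by simp
    qed
  qed
qed

lemma dot_lincomb:
  assumes "\<And>x. x \<in> X \<Longrightarrow> ker.cong (u x) (\<Sum>i\<in>S. c i * g i x)"
  shows "ker.cong (dot X u G) (\<Sum>i\<in>S. c i * dot X (g i) G)"
proof -
  have "ker.cong (dot X u G) (dot X (\<lambda>x. \<Sum>i\<in>S. c i * g i x) G)"
    using assms by (intro ker.cong_dot ker.cong_refl)
  then show ?thesis
    using dot_sum_right[of X G c g S] by (simp add: dot_commute[of X _ G])
qed

text \<open>Put a vanishing linear combination of the rows in place of row s. The terms with a
  repeated row drop out, so the coefficient of row s times the minor lies in the kernel, and by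
  primeness the coefficient does.\<close>

lemma independent_of_mdet:
  assumes nz: "mdet k X (\<lambda>\<nu>. g (e \<nu>)) l \<notin> ker"
  shows "inj_on e {..<k} \<and> independent g (e ` {..<k})"
proof
  show inj: "inj_on e {..<k}"
  proof (rule inj_onI, rule ccontr)
    fix i i' assume "i \<in> {..<k}" "i' \<in> {..<k}" "e i = e i'" "i \<noteq> i'"
    then have "mdet k X (\<lambda>\<nu>. g (e \<nu>)) l = 0"
      by (intro mdet_identical[of i i']) auto
    then show False using nz ker.zero_mem by simp
  qed
  show "independent g (e ` {..<k})"
    unfolding independent_def
  proof (intro allI impI ballI)
    fix c i assume rel: "\<forall>x\<in>X. (\<Sum>i\<in>e ` {..<k}. c i * g i x) \<in> ker" and "i \<in> e ` {..<k}"
    then obtain s where s: "s < k" "i = e s" by auto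
    let ?a = "\<lambda>\<nu>. g (e \<nu>)"
    obtain G where G: "\<And>u. mdet k X (?a(s := u)) l = dot X u G"
      using mdet_row_linear[OF s(1)] by blast
    have "ker.cong (dot X (\<lambda>_. 0) G) (\<Sum>j<k. c (e j) * dot X (g (e j)) G)"
    proof (rule dot_lincomb)
      fix x assume "x \<in> X"
      then have "(\<Sum>j<k. c (e j) * g (e j) x) \<in> ker"
        using rel inj by (simp add: sum.reindex)
      then show "ker.cong 0 (\<Sum>j<k. c (e j) * g (e j) x)"
        using ker.uminus_mem by simp
    qed
    moreover have "(\<Sum>j<k. c (e j) * dot X (g (e j)) G) = (\<Sum>j\<in>{s}. c (e j) * dot X (g (e j)) G)"
    proof (rule sum.mono_neutral_right)
      show "\<forall>j\<in>{..<k} - {s}. c (e j) * dot X (g (e j)) G = 0"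
      proof
        fix j assume j: "j \<in> {..<k} - {s}"
        have "mdet k X (?a(s := g (e j))) l = 0"
          using j s by (intro mdet_identical[of s j]) auto
        then show "c (e j) * dot X (g (e j)) G = 0" by (simp add: G)
      qed
    qed (use s in auto)
    moreover have "dot X (g (e s)) G = mdet k X ?a l"
    proof -
      have "?a(s := g (e s)) = ?a" by auto
      then show ?thesis using G[of "g (e s)"] by simp
    qed
    ultimately have "c (e s) * mdet k X ?a l \<in> ker"
      using ker.uminus_mem by force
    then show "c i \<in> ker"
      using nz ker_prime s(2) by blast
  qed
qed

lemma independent_mono:
  assumes "independent g S" "T \<subseteq> S" "finite S"
  shows "independent g T"
  unfolding independent_def
proof (intro allI impI ballI)
  fix c i assume rel: "\<forall>x\<in>X. (\<Sum>i\<in>T. c i * g i x) \<in> ker" and i: "i \<in> T"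
  define c' where "c' = (\<lambda>i. if i \<in> T then c i else 0)"
  have "(\<Sum>i\<in>S. c' i * g i x) = (\<Sum>i\<in>T. c i * g i x)" for x
    using assms by (intro sum.mono_neutral_cong_right) (auto simp: c'_def)
  then have "\<forall>i\<in>S. c' i \<in> ker"
    using assms(1) rel unfolding independent_def by simp
  then have "c' i \<in> ker" using i assms(2) by blast
  then show "c i \<in> ker" using i by (simp add: c'_def)
qed

text \<open>Keep k forms with a nonvanishing k-minor and let one more form run through the
  coordinates. If all (k+1)-minors vanished, expansion along that form would be a linear relation
  between the rows whose coefficient at row k is the nonvanishing k-minor.\<close>

lemma mdet_of_independent:
  "inj_on e {..<k} \<Longrightarrow> independent g (e ` {..<k}) \<Longrightarrow> \<exists>l. mdet k X (\<lambda>\<nu>. g (e \<nu>)) l \<notin> ker"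
proof (induction k)
  case 0
  then show ?case using one_notin_ker by simp
next
  case (Suc k)
  let ?a = "\<lambda>\<nu>. g (e \<nu>)"
  have "inj_on e {..<k}"
    using Suc.prems(1) by (rule inj_on_subset) auto
  moreover have "independent g (e ` {..<k})"
    using Suc.prems(2) by (rule independent_mono) auto
  ultimately obtain l where l: "mdet k X ?a l \<notin> ker"
    using Suc.IH by blast
  show ?case
  proof (rule ccontr)
    assume "\<nexists>l. mdet (Suc k) X ?a l \<notin> ker"
    then have van: "mdet (Suc k) X ?a l' \<in> ker" for l' by blast
    define d where "d = (\<lambda>j. (-1) ^ (k + j) * mdet k X l (?a \<circ> skip j))"
    have rel: "(\<Sum>j<Suc k. d j * g (e j) x) \<in> ker" if "x \<in> X" for x
    proof -
      \<comment> \<open>\<open>mdet_commute\<close> exchanges rows and forms, so that the cofactor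
        vector expands along the form with index k instead of a row.\<close>
      have "mdet (Suc k) X ?a (l(k := (\<lambda>z. of_bool (z = x)))) = cvec k X l ?a x"
        by (subst mdet_commute) (rule cvec_eq_mdet[OF finite_vars that, symmetric])
      also have "\<dots> = (\<Sum>j<Suc k. d j * g (e j) x)"
        unfolding cvec_def d_def by (intro sum.cong refl) (simp add: ac_simps)
      finally show ?thesis using van by metis
    qed
    define c where "c = (\<lambda>i. d (inv_into {..<Suc k} e i))"
    have c: "c (e j) = d j" if "j < Suc k" for j
      using that Suc.prems(1) by (simp add: c_def inv_into_f_f del: lessThan_Suc)
    have "(\<Sum>i\<in>e ` {..<Suc k}. c i * g i x) = (\<Sum>j<Suc k. d j * g (e j) x)" for x
      unfolding sum.reindex[OF Suc.prems(1)] comp_def by (intro sum.cong refl) (simp add: c)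
    then have "\<forall>i\<in>e ` {..<Suc k}. c i \<in> ker"
      using Suc.prems(2) rel unfolding independent_def by simp
    then have "c (e k) \<in> ker" by simp
    then have "d k \<in> ker" using c[of k] by simp
    moreover have "mdet k X l (?a \<circ> skip k) = mdet k X ?a l"
      by (subst mdet_commute) (rule mdet_cong, auto)
    ultimately have "mdet k X ?a l \<in> ker"
      by (simp add: d_def)
    then show False using l by simp
  qed
qed

text \<open>A size k occurs among the independent sets of rows exactly if some k-minor of N does not
  vanish: by multilinearity a nonvanishing minor can be found with rows among the g_i. The maximal
  such size therefore satisfies both conditions of \<open>rank_is\<close>.\<close>

lemma matrix_rank_is:
  assumes X: "X = {1..n}" and gN: "\<And>i. i \<in> {1..m} \<Longrightarrow> g i \<in> N"
    and N: "\<And>u. u \<in> N \<Longrightarrow> \<exists>c. \<forall>x\<in>X. ker.cong (u x) (\<Sum>i\<in>{1..m}. c i * g i x)"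
    and M: "\<And>i x. i \<in> {1..m} \<Longrightarrow> x \<in> X \<Longrightarrow> M i x = fr (g i x) 1"
  shows "ker.rank_is X N (matrix_rank FF m n M)"
proof -
  define T where "T = card ` {S. S \<subseteq> {1..m} \<and> rows_independent FF n M S}"
  have T: "k \<in> T \<longleftrightarrow> \<not> ker.minors_vanish X N k" for k
  proof
    assume "k \<in> T"
    then obtain S where S: "S \<subseteq> {1..m}" "rows_independent FF n M S" "card S = k"
      by (auto simp: T_def)
    have fS: "finite S" using S(1) finite_subset by blast
    have "M i x = fr (g i x) 1" if "i \<in> S" "x \<in> X" for i x
      using M S(1) that by blast
    then have "independent g S"
      using rows_independent_iff[OF X fS] S(2) by blast
    moreover obtain e where e: "bij_betw e {..<k} S"
      using ex_bij_betw_nat_finite[OF fS] S(3) by (auto simp: lessThan_atLeast0)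
    ultimately obtain l where "mdet k X (\<lambda>\<nu>. g (e \<nu>)) l \<notin> ker"
      using mdet_of_independent[of e k g] by (auto simp: bij_betw_def)
    moreover have "\<forall>\<nu><k. g (e \<nu>) \<in> N"
      using e S(1) gN by (auto simp: bij_betw_def)
    ultimately show "\<not> ker.minors_vanish X N k"
      unfolding ker.minors_vanish_def by (metis (no_types, lifting))
  next
    assume "\<not> ker.minors_vanish X N k"
    then obtain a l where a: "\<forall>i<k. a i \<in> N" and nz: "mdet k X a l \<notin> ker"
      by (auto simp: ker.minors_vanish_def)
    have "\<exists>e. (\<forall>\<nu><k. e \<nu> \<in> {1..m}) \<and> mdet k X (\<lambda>\<nu>. g (e \<nu>)) l \<notin> ker"
    proof (rule ccontr)
      assume none: "\<not> ?thesis"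
      have "mdet k X a l \<in> ker"
      proof (rule rows_induct[where P = "\<lambda>a. mdet k X a l \<in> ker" and G = "g ` {1..m}" and N = N])
        fix a assume "\<forall>i<k. a i \<in> g ` {1..m}"
        then have "\<forall>i. \<exists>j. i < k \<longrightarrow> j \<in> {1..m} \<and> a i = g j" by blast
        then obtain e where e: "\<And>i. i < k \<Longrightarrow> e i \<in> {1..m} \<and> a i = g (e i)" by metis
        then have "mdet k X a l = mdet k X (\<lambda>\<nu>. g (e \<nu>)) l"
          by (intro mdet_cong) auto
        then show "mdet k X a l \<in> ker" using none e by auto
      next
        fix a s u assume s: "s < k" and u: "u \<in> N"
          and IH: "\<And>v. v \<in> g ` {1..m} \<Longrightarrow> mdet k X (a(s := v)) l \<in> ker"
        obtain G where G: "\<And>u. mdet k X (a(s := u)) l = dot X u G"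
          using mdet_row_linear[OF s] by blast
        obtain c where c: "\<And>x. x \<in> X \<Longrightarrow> ker.cong (u x) (\<Sum>i\<in>{1..m}. c i * g i x)"
          using N[OF u] by blast
        have "ker.cong (dot X u G) (\<Sum>i\<in>{1..m}. c i * dot X (g i) G)"
          by (rule dot_lincomb[OF c])
        moreover have "(\<Sum>i\<in>{1..m}. c i * dot X (g i) G) \<in> ker"
          using IH by (intro ker.sum_mem ker.mult_mem) (simp add: G)
        ultimately show "mdet k X (a(s := u)) l \<in> ker"
          unfolding G by (rule ker.cong_mem)
      qed (use a in auto)
      then show False using nz by simp
    qed
    then obtain e where e: "\<forall>\<nu><k. e \<nu> \<in> {1..m}" and nz: "mdet k X (\<lambda>\<nu>. g (e \<nu>)) l \<notin> ker"
      by blast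
    have S: "e ` {..<k} \<subseteq> {1..m}" using e by auto
    then have "M i x = fr (g i x) 1" if "i \<in> e ` {..<k}" "x \<in> X" for i x
      using M that by blast
    then have "rows_independent FF n M (e ` {..<k}) \<longleftrightarrow> independent g (e ` {..<k})"
      by (rule rows_independent_iff[OF X finite_imageI[OF finite_lessThan]])
    then have "rows_independent FF n M (e ` {..<k})"
      using independent_of_mdet[of k g e l, OF nz] by blast
    moreover have "card (e ` {..<k}) = k"
      using independent_of_mdet[of k g e l, OF nz] by (simp add: card_image)
    ultimately show "k \<in> T"
      unfolding T_def using S by (intro image_eqI[where x = "e ` {..<k}"] CollectI conjI) simp_all
  qed
  have fin: "finite T" unfolding T_def by simp
  \<comment> \<open>The empty determinant is 1, which is outside the kernel; so the maximum is taken
    over a nonempty set.\<close>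
  have "0 \<in> T"
    using one_notin_ker by (simp add: T ker.minors_vanish_def)
  then have "Max T \<in> T"
    using fin by (intro Max_in) blast+
  moreover have "Suc (Max T) \<notin> T"
    using Max_ge[OF fin, of "Suc (Max T)"] not_less_eq_eq by blast
  ultimately have "Max T \<in> T" "Suc (Max T) \<notin> T" by blast+
  then show ?thesis
    unfolding ker.rank_is_def matrix_rank_def T_def[symmetric] by (simp add: T)
qed

end

section \<open>Natural derivations\<close>

text \<open>Natural derivations are indexed by increasing tuples, so arbitrary injective ones have
  to be sorted; the permutation is the one that sorts the list of values.\<close>

lemma ex_sorting_permutation:
  fixes e :: "nat \<Rightarrow> nat"
  assumes "inj_on e {..<k}"
  obtains q where "q permutes {..<k}" "strict_mono_on {..<k} (e \<circ> q)"
proof -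
  let ?xs = "map e [0..<k]"
  have "mset (sort ?xs) = mset ?xs" by simp
  then obtain q where q: "q permutes {..<length ?xs}" "permute_list q ?xs = sort ?xs"
    by (rule mset_eq_permutation)
  have q': "q permutes {..<k}" using q(1) by simp
  have nth: "sort ?xs ! i = e (q i)" if "i < k" for i
  proof -
    have "q i < k" using permutes_in_image[OF q', of i] that by simp
    then show ?thesis
      using permute_list_nth[OF q(1), of i] that q(2) by simp
  qed
  have "distinct ?xs"
    using assms by (simp add: distinct_map lessThan_atLeast0)
  then have sorted: "sorted_wrt (<) (sort ?xs)"
    by (simp add: strict_sorted_iff)
  have "strict_mono_on {..<k} (e \<circ> q)"
  proof (rule strict_mono_onI)
    fix i j assume "i \<in> {..<k}" "j \<in> {..<k}" "i < j"
    then show "(e \<circ> q) i < (e \<circ> q) j"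
      using sorted_wrt_nth_less[OF sorted, of i j] nth by simp
  qed
  with q' show ?thesis by (rule that)
qed

lemma sign_mult_self: "of_int (sign p) * of_int (sign p) = (1 :: 'a::ring_1)"
  by (simp add: sign_def)

context coeff_ideal
begin

lemma cspan_subset: "(\<And>b. b \<in> B \<Longrightarrow> b \<in> cspan J C) \<Longrightarrow> u \<in> cspan J B \<Longrightarrow> u \<in> cspan J C"
  by (erule cspan.induct) (auto intro: cspan.intros)

end

definition unit_vec :: "nat \<Rightarrow> nat \<Rightarrow> 'r::comm_ring_1"
  where "unit_vec x = (\<lambda>z. of_bool (z = x))"

text \<open>The entry at x is a determinant whose last row is a unit vector. A permutation of the
  first r rows fixes that row and has the same sign on r + 1 rows; signs are their own
  inverses.\<close>

lemma cvec_permute: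
  assumes "finite J" "x \<in> J" and q: "q permutes {..<r}" and q': "q' permutes {..<Suc r}"
  shows "cvec r J a l x = of_int (sign q) * of_int (sign q') * cvec r J (a \<circ> q) (l \<circ> q') x"
proof -
  let ?e = "\<lambda>z. of_bool (z = x)"
  have qS: "q permutes {..<Suc r}"
    using q by (rule permutes_subset) auto
  have "(a \<circ> q)(r := ?e) = a(r := ?e) \<circ> q"
  proof
    fix i
    have "q r = r" using q by (simp add: permutes_def)
    moreover have "q i = r \<longleftrightarrow> i = r"
      using permutes_inj[OF q] calculation by (metis injD)
    ultimately show "((a \<circ> q)(r := ?e)) i = (a(r := ?e) \<circ> q) i" by simp
  qed
  then have "cvec r J (a \<circ> q) (l \<circ> q') x = mdet (Suc r) J (a(r := ?e) \<circ> q) (l \<circ> q')"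
    using assms by (simp add: cvec_eq_mdet)
  also have "\<dots> = of_int (sign q) * mdet (Suc r) J (a(r := ?e)) (l \<circ> q')"
    by (rule mdet_permute[OF qS])
  also have "mdet (Suc r) J (a(r := ?e)) (l \<circ> q') = of_int (sign q') * mdet (Suc r) J (a(r := ?e)) l"
    using mdet_permute[OF q', of J l "a(r := ?e)"] by (simp add: mdet_commute)
  also have "mdet (Suc r) J (a(r := ?e)) l = cvec r J a l x"
    using assms by (simp add: cvec_eq_mdet)
  finally have "cvec r J (a \<circ> q) (l \<circ> q') x = of_int (sign q) * (of_int (sign q') * cvec r J a l x)" .
  then have "of_int (sign q) * of_int (sign q') * cvec r J (a \<circ> q) (l \<circ> q') x
      = (of_int (sign q) * of_int (sign q)) * (of_int (sign q') * of_int (sign q')) * cvec r J a l x"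
    by (simp add: ac_simps)
  then show ?thesis by (simp only: sign_mult_self mult_1_left)
qed

lemma strict_mono_on_pred:
  fixes e :: "nat \<Rightarrow> nat"
  assumes "strict_mono_on {..<k} e"
  shows "strict_mono_on {1..k} (\<lambda>i. e (i - 1))"
proof (rule strict_mono_onI)
  fix a b assume "a \<in> {1..k}" "b \<in> {1..k}" "a < b"
  then have "a - 1 \<in> {..<k}" "b - 1 \<in> {..<k}" "a - 1 < b - 1" by auto
  then show "e (a - 1) < e (b - 1)"
    using assms by (simp add: strict_mono_on_def)
qed

section \<open>Spanning by minors with increasing indices\<close>

context polynomial_quotient
begin

text \<open>For gradients g these are the coefficient vectors of the natural derivations. Tuples are
  indexed from 1, as in the definition of natural derivations, but rows and forms from 0; hence
  \<open>Suc\<close>.\<close>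

definition sorted_minors :: "nat \<Rightarrow> (nat \<Rightarrow> nat \<Rightarrow> 'k mpoly) \<Rightarrow> nat \<Rightarrow> (nat \<Rightarrow> 'k mpoly) set"
  where "sorted_minors m g r =
    {cvec r X (\<lambda>\<nu>. g (i (Suc \<nu>))) (\<lambda>\<mu>. unit_vec (j (Suc \<mu>))) | i j.
       i \<in> {1..r} \<rightarrow> {1..m} \<and> strict_mono_on {1..r} i \<and>
       j \<in> {1..r + 1} \<rightarrow> X \<and> strict_mono_on {1..r + 1} j}"

lemma cvec_zero_mem_cspan:
  assumes "\<And>x. x \<in> X \<Longrightarrow> mdet (Suc r) X (a(r := (\<lambda>z. of_bool (z = x)))) l = 0"
  shows "cvec r X a l \<in> ker.cspan X B"
  by (rule ker.cspan_cong[OF ker.cspan_zero]) (simp add: cvec_eq_mdet finite_vars assms ker.zero_mem)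

text \<open>Determinants are alternating: a repeated index gives the zero vector, and distinct
  indices are sorted at the cost of a sign.\<close>

lemma cvec_generators_mem:
  assumes e: "\<And>i. i < r \<Longrightarrow> e i \<in> {1..m}" and h: "\<And>i. i < Suc r \<Longrightarrow> h i \<in> X"
  shows "cvec r X (\<lambda>\<nu>. g (e \<nu>)) (\<lambda>\<mu>. unit_vec (h \<mu>)) \<in> ker.cspan X (sorted_minors m g r)"
proof -
  let ?a = "\<lambda>\<nu>. g (e \<nu>)" and ?l = "\<lambda>\<mu>. unit_vec (h \<mu>)"
  consider "inj_on e {..<r}" "inj_on h {..<Suc r}" | "\<not> inj_on e {..<r}" | "\<not> inj_on h {..<Suc r}"
    by blast
  then show ?thesis
  proof cases
    case 1
    obtain q where q: "q permutes {..<r}" "strict_mono_on {..<r} (e \<circ> q)"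
      using ex_sorting_permutation[OF 1(1)] .
    obtain q' where q': "q' permutes {..<Suc r}" "strict_mono_on {..<Suc r} (h \<circ> q')"
      using ex_sorting_permutation[OF 1(2)] .
    define i where "i = (\<lambda>\<nu>. (e \<circ> q) (\<nu> - 1))"
    define j where "j = (\<lambda>\<mu>. (h \<circ> q') (\<mu> - 1))"
    have "i \<in> {1..r} \<rightarrow> {1..m}"
      using e permutes_in_image[OF q(1)] by (force simp: i_def)
    moreover have "j \<in> {1..r + 1} \<rightarrow> X"
      using h permutes_in_image[OF q'(1)] by (force simp: j_def)
    moreover have "strict_mono_on {1..r} i" "strict_mono_on {1..r + 1} j"
      using strict_mono_on_pred[OF q(2)] strict_mono_on_pred[OF q'(2)] by (simp_all add: i_def j_def)
    ultimately have "cvec r X (\<lambda>\<nu>. g (i (Suc \<nu>))) (\<lambda>\<mu>. unit_vec (j (Suc \<mu>))) \<in> sorted_minors m g r"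
      unfolding sorted_minors_def by blast
    then have "cvec r X (?a \<circ> q) (?l \<circ> q') \<in> ker.cspan X (sorted_minors m g r)"
      by (intro ker.cspan_base) (simp add: i_def j_def comp_def)
    from ker.cspan_scale[OF this, of "of_int (sign q) * of_int (sign q')"]
    show ?thesis
      by (rule ker.cspan_cong) (simp add: cvec_permute[OF finite_vars _ q(1) q'(1), of _ ?a ?l] ker.zero_mem)
  next
    case 2
    then obtain s t where st: "s < r" "t < r" "s \<noteq> t" "e s = e t"
      by (auto simp: inj_on_def)
    show ?thesis
      by (rule cvec_zero_mem_cspan, rule mdet_identical[of s t]) (use st in auto)
  next
    case 3
    then obtain s t where st: "s < Suc r" "t < Suc r" "s \<noteq> t" "h s = h t"
      by (auto simp: inj_on_def)
    show ?thesis
      by (rule cvec_zero_mem_cspan, subst mdet_commute, rule mdet_identical[of s t]) (use st in auto)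
  qed
qed

lemma cvec_row_linear:
  assumes "s < r" "x \<in> X"
  shows "\<exists>G. \<forall>u. cvec r X (a(s := u)) l x = dot X u G"
proof -
  have "cvec r X (a(s := u)) l x = mdet (Suc r) X ((a(r := (\<lambda>z. of_bool (z = x))))(s := u)) l" for u
    using assms finite_vars by (simp add: cvec_eq_mdet fun_upd_twist)
  then show ?thesis
    using mdet_row_linear[of s "Suc r" X "a(r := (\<lambda>z. of_bool (z = x)))" l] assms(1) by auto
qed

lemma cvec_column_linear:
  assumes "s < Suc r" "x \<in> X"
  shows "\<exists>G. \<forall>u. cvec r X a (l(s := u)) x = dot X u G"
proof -
  have "cvec r X a (l(s := u)) x = mdet (Suc r) X (l(s := u)) (a(r := (\<lambda>z. of_bool (z = x))))" for u
    using assms finite_vars by (simp add: cvec_eq_mdet mdet_commute)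
  then show ?thesis
    using mdet_row_linear[of s "Suc r" X l "a(r := (\<lambda>z. of_bool (z = x)))"] assms(1) by auto
qed

text \<open>As each entry of F u is linear in u, the vector F u is congruent to the corresponding
  combination of the F (g i).\<close>

lemma cvec_mem_of_lincomb:
  assumes lin: "\<And>x. x \<in> X \<Longrightarrow> \<exists>G. \<forall>u. F u x = dot X u G"
    and u: "\<And>x. x \<in> X \<Longrightarrow> ker.cong (u x) (\<Sum>i\<in>S. c i * g i x)"
    and mem: "\<And>i. i \<in> S \<Longrightarrow> F (g i) \<in> ker.cspan X B"
  shows "F u \<in> ker.cspan X B"
proof -
  have "(\<lambda>x. \<Sum>i\<in>S. c i * F (g i) x) \<in> ker.cspan X B"
    using mem by (rule ker.cspan_sum)
  then show ?thesis
  proof (rule ker.cspan_cong)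
    fix x assume "x \<in> X"
    then obtain G where G: "\<And>u. F u x = dot X u G" using lin by blast
    show "ker.cong (F u x) (\<Sum>i\<in>S. c i * F (g i) x)"
      unfolding G by (rule dot_lincomb[OF u])
  qed
qed

lemma cof_eq_cspan_sorted_minors:
  assumes gN: "\<And>i. i \<in> {1..m} \<Longrightarrow> g i \<in> N"
    and N: "\<And>u. u \<in> N \<Longrightarrow> \<exists>c. \<forall>x\<in>X. ker.cong (u x) (\<Sum>i\<in>{1..m}. c i * g i x)"
  shows "ker.cof X N r = ker.cspan X (sorted_minors m g r)"
proof
  let ?C = "ker.cspan X (sorted_minors m g r)"
  have gen: "cvec r X a l \<in> ?C" if a: "\<forall>i<r. a i \<in> g ` {1..m}" and l: "\<forall>i<Suc r. l i \<in> unit_vec ` X" for a l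
  proof -
    have "\<forall>i. \<exists>j. i < r \<longrightarrow> j \<in> {1..m} \<and> a i = g j" using a by blast
    then obtain e where e: "\<And>i. i < r \<Longrightarrow> e i \<in> {1..m} \<and> a i = g (e i)" by metis
    have "\<forall>i. \<exists>j. i < Suc r \<longrightarrow> j \<in> X \<and> l i = unit_vec j" using l by blast
    then obtain h where h: "\<And>i. i < Suc r \<Longrightarrow> h i \<in> X \<and> l i = unit_vec (h i)" by metis
    have "cvec r X (\<lambda>\<nu>. g (e \<nu>)) (\<lambda>\<mu>. unit_vec (h \<mu>)) \<in> ?C"
      using e h by (intro cvec_generators_mem) auto
    then show ?thesis
    proof (rule ker.cspan_cong)
      fix x assume x: "x \<in> X"
      have "cvec r X a l x = cvec r X (\<lambda>\<nu>. g (e \<nu>)) (\<lambda>\<mu>. unit_vec (h \<mu>)) x"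
        unfolding cvec_eq_mdet[OF finite_vars x] using e h by (intro mdet_cong) auto
      then show "ker.cong (cvec r X a l x) (cvec r X (\<lambda>\<nu>. g (e \<nu>)) (\<lambda>\<mu>. unit_vec (h \<mu>)) x)"
        by (simp add: ker.zero_mem)
    qed
  qed
  have rows: "cvec r X a l \<in> ?C" if a: "\<forall>i<r. a i \<in> N" and l: "\<forall>i<Suc r. l i \<in> unit_vec ` X" for a l
  proof (rule rows_induct[where P = "\<lambda>a. cvec r X a l \<in> ?C" and G = "g ` {1..m}", OF _ _ a])
    show "cvec r X a l \<in> ?C" if "\<forall>i<r. a i \<in> g ` {1..m}" for a
      using gen[OF that l] .
    fix a s u assume s: "s < r" and u: "u \<in> N"
      and IH: "\<And>v. v \<in> g ` {1..m} \<Longrightarrow> cvec r X (a(s := v)) l \<in> ?C"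
    obtain c where c: "\<And>x. x \<in> X \<Longrightarrow> ker.cong (u x) (\<Sum>i\<in>{1..m}. c i * g i x)"
      using N[OF u] by blast
    show "cvec r X (a(s := u)) l \<in> ?C"
      by (rule cvec_mem_of_lincomb[where F = "\<lambda>u. cvec r X (a(s := u)) l", OF cvec_row_linear[OF s] c])
        (use IH in auto)
  qed
  \<comment> \<open>The forms are arbitrary, so the set of admissible forms is \<open>UNIV\<close>;
    every form is a combination of the coordinate functionals.\<close>
  have cols: "cvec r X a l \<in> ?C" if a: "\<forall>i<r. a i \<in> N" for a l
  proof (rule rows_induct[where P = "\<lambda>l. cvec r X a l \<in> ?C" and G = "unit_vec ` X" and N = UNIV and k = "Suc r"])
    show "cvec r X a l \<in> ?C" if "\<forall>i<Suc r. l i \<in> unit_vec ` X" for l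
      using rows[OF a that] .
    fix l s u assume s: "s < Suc r"
      and IH: "\<And>v. v \<in> unit_vec ` X \<Longrightarrow> cvec r X a (l(s := v)) \<in> ?C"
    have c: "ker.cong (u x) (\<Sum>i\<in>X. u i * unit_vec i x)" if "x \<in> X" for x
    proof -
      have "(\<Sum>i\<in>X. u i * unit_vec i x) = dot X (\<lambda>z. of_bool (z = x)) u"
        by (simp add: dot_def unit_vec_def mult.commute eq_commute)
      then show ?thesis
        by (simp add: dot_unit[OF finite_vars that] ker.zero_mem)
    qed
    show "cvec r X a (l(s := u)) \<in> ?C"
      by (rule cvec_mem_of_lincomb[where F = "\<lambda>u. cvec r X a (l(s := u))", OF cvec_column_linear[OF s] c])
        (use IH in auto)
  qed simp
  show "ker.cof X N r \<subseteq> ?C"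
    unfolding ker.cof_def using cols by (intro subsetI, elim ker.cspan_subset[rotated]) auto
  show "?C \<subseteq> ker.cof X N r"
  proof
    fix u assume "u \<in> ?C"
    then show "u \<in> ker.cof X N r"
      unfolding ker.cof_def
    proof (rule ker.cspan_subset[rotated])
      fix b assume "b \<in> sorted_minors m g r"
      then obtain i j where b: "b = cvec r X (\<lambda>\<nu>. g (i (Suc \<nu>))) (\<lambda>\<mu>. unit_vec (j (Suc \<mu>)))"
          and i: "i \<in> {1..r} \<rightarrow> {1..m}"
        by (auto simp: sorted_minors_def)
      have "g (i (Suc \<nu>)) \<in> N" if "\<nu> < r" for \<nu>
        using that i gN by (auto simp: Pi_iff)
      then show "b \<in> ker.cspan X {cvec r X a l | a l. \<forall>i<r. a i \<in> N}"
        unfolding b by (intro ker.cspan_base) blast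
    qed
  qed
qed

section \<open>Tangent vectors and the module of derivations\<close>

lemma tangent_cong:
  assumes "tangent u" "\<And>x. x \<in> X \<Longrightarrow> ker.cong (v x) (u x)"
  shows "tangent v" "delta v = delta u"
proof -
  have dot: "ker.cong (dot X v G) (dot X u G)" for G
    using assms(2) by (intro ker.cong_dot ker.cong_refl)
  show tv: "tangent v"
    using assms(1) dot ker.cong_mem unfolding tangent_def by blast
  show "delta v = delta u"
    unfolding delta_def using dot by (auto simp: fun_eq_iff pi_eq_iff restrict_def)
qed

lemma tangent_zero: "tangent (\<lambda>_. 0)"
  by (simp add: tangent_def ker.zero_mem)

lemma tangent_add: "tangent u \<Longrightarrow> tangent v \<Longrightarrow> tangent (\<lambda>x. u x + v x)"
  by (simp add: tangent_def dot_add_left ker.add_mem)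

lemma tangent_scale: "tangent u \<Longrightarrow> tangent (\<lambda>x. c * u x)"
  by (simp add: tangent_def dot_scale_left ker.mult_mem)

lemma tangent_cspan:
  assumes "\<And>b. b \<in> B \<Longrightarrow> tangent b" "u \<in> ker.cspan X B"
  shows "tangent u"
  using assms(2) by (induction rule: ker.cspan.induct)
    (use assms(1) tangent_zero tangent_add tangent_scale tangent_cong(1) in blast)+

text \<open>Pairing a cofactor vector of r relations with one further gradient gives an (r+1)-minor
  of relations, which vanishes modulo the kernel.\<close>

lemma tangent_cof:
  assumes "ker.minors_vanish X (relations ker X) (Suc r)" "w \<in> ker.cof X (relations ker X) r"
  shows "tangent w"
  using assms(2) unfolding ker.cof_def
proof (rule tangent_cspan[rotated])
  fix b assume "b \<in> {cvec r X a l | a l. \<forall>i<r. a i \<in> relations ker X}"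
  then obtain a l where b: "b = cvec r X a l" and a: "\<forall>i<r. a i \<in> relations ker X" by blast
  show "tangent b"
    unfolding tangent_def
  proof
    fix F assume F: "F \<in> ker"
    have "(\<lambda>x. mpderiv x F) \<in> relations ker X"
      using F ker.zero_mem by (force simp: relations_def)
    then have "mdet (Suc r) X (a(r := (\<lambda>x. mpderiv x F))) l \<in> ker"
      using assms(1) a by (simp add: ker.minors_vanish_def less_Suc_eq)
    then show "dot X b (\<lambda>x. mpderiv x F) \<in> ker"
      by (simp add: mdet_last b dot_commute)
  qed
qed

lemma Der_module_simps:
  "carrier (Der_module A) = Der A"
  "\<zero>\<^bsub>Der_module A\<^esub> = (\<lambda>x\<in>carrier A. \<zero>\<^bsub>A\<^esub>)"
  "D \<oplus>\<^bsub>Der_module A\<^esub> D' = (\<lambda>x\<in>carrier A. D x \<oplus>\<^bsub>A\<^esub> D' x)"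
  "a \<odot>\<^bsub>Der_module A\<^esub> D = (\<lambda>x\<in>carrier A. a \<otimes>\<^bsub>A\<^esub> D x)"
  by (simp_all add: Der_module_def End_alg_def)

lemma delta_zero: "delta (\<lambda>_. 0) = \<zero>\<^bsub>Der_module A\<^esub>"
  by (simp add: delta_def Der_module_simps pi_zero)

lemma delta_add: "delta (\<lambda>x. u x + v x) = delta u \<oplus>\<^bsub>Der_module A\<^esub> delta v"
  by (auto simp: delta_def Der_module_simps pi_add dot_add_left fun_eq_iff restrict_def)

lemma delta_scale: "delta (\<lambda>x. c * u x) = \<pi> c \<odot>\<^bsub>Der_module A\<^esub> delta u"
  by (auto simp: delta_def Der_module_simps pi_mult dot_scale_left fun_eq_iff restrict_def)

lemma Der_cases:
  assumes "D \<in> Der A"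
  obtains w where "tangent w" "D = delta w"
proof -
  have "\<forall>x. \<exists>p. D (\<pi> (mvar x)) = \<pi> p"
    using DerE(1)[OF assms] by (auto simp: pi_carrier PiE_iff)
  then obtain w where "\<And>x. D (\<pi> (mvar x)) = \<pi> (w x)" by metis
  then show ?thesis using Der_eq_delta[OF assms] that by blast
qed

text \<open>The inverse is a definite description, so its uniqueness is checked directly: any other
  candidate is again some \<open>delta w\<close>, and its values on the variables determine w modulo
  the kernel.\<close>

lemma inv_delta:
  assumes "tangent u"
  shows "inv\<^bsub>add_monoid (Der_module A)\<^esub> delta u = delta (\<lambda>x. - 1 * u x)"
proof -
  let ?v = "\<lambda>x. - 1 * u x"
  have v: "tangent ?v" using assms by (rule tangent_scale)
  have sum: "delta (\<lambda>x. u x + ?v x) = \<zero>\<^bsub>Der_module A\<^esub>" "delta (\<lambda>x. ?v x + u x) = \<zero>\<^bsub>Der_module A\<^esub>"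
    by (simp_all add: delta_zero)
  show ?thesis
    unfolding m_inv_def
  proof (rule the_equality)
    show "delta ?v \<in> carrier (add_monoid (Der_module A)) \<and>
      delta u \<otimes>\<^bsub>add_monoid (Der_module A)\<^esub> delta ?v = \<one>\<^bsub>add_monoid (Der_module A)\<^esub> \<and>
      delta ?v \<otimes>\<^bsub>add_monoid (Der_module A)\<^esub> delta u = \<one>\<^bsub>add_monoid (Der_module A)\<^esub>"
      using delta_Der[OF v] sum[unfolded delta_add[of u ?v] delta_add[of ?v u]] by (simp add: Der_module_simps(1))
    fix y assume y: "y \<in> carrier (add_monoid (Der_module A)) \<and>
      delta u \<otimes>\<^bsub>add_monoid (Der_module A)\<^esub> y = \<one>\<^bsub>add_monoid (Der_module A)\<^esub> \<and>
      y \<otimes>\<^bsub>add_monoid (Der_module A)\<^esub> delta u = \<one>\<^bsub>add_monoid (Der_module A)\<^esub>"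
    then have "y \<in> Der A" by (simp add: Der_module_simps(1))
    then obtain w where w: "tangent w" "y = delta w" by (rule Der_cases)
    have "delta (\<lambda>x. w x + u x) = \<zero>\<^bsub>Der_module A\<^esub>"
      using y w(2) by (simp add: delta_add)
    then have "ker.cong (w x) (?v x)" if "x \<in> X" for x
    proof -
      have "delta (\<lambda>x. w x + u x) (\<pi> (mvar x)) = \<pi> (w x + u x)"
        using tangent_add[OF w(1) assms] that by (rule delta_mvar)
      then have "\<pi> (w x + u x) = \<pi> 0"
        using \<open>delta (\<lambda>x. w x + u x) = \<zero>\<^bsub>Der_module A\<^esub>\<close> by (simp add: Der_module_simps pi_zero)
      then show ?thesis by (simp add: ker_def)
    qed
    then show "y = delta ?v"
      using tangent_cong(2)[OF v] w(2) by blast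
  qed
qed

lemma submodule_delta_cspan:
  assumes B: "\<And>b. b \<in> B \<Longrightarrow> tangent b"
  shows "submodule (delta ` ker.cspan X B) A (Der_module A)"
proof -
  have tan: "tangent u" if "u \<in> ker.cspan X B" for u
    using tangent_cspan[OF B that] .
  show ?thesis
  proof (intro submodule.intro subgroup.intro submodule_axioms.intro)
    show "delta ` ker.cspan X B \<subseteq> carrier (add_monoid (Der_module A))"
      using tan delta_Der by (auto simp: Der_module_simps(1))
    show "x \<otimes>\<^bsub>add_monoid (Der_module A)\<^esub> y \<in> delta ` ker.cspan X B"
      if "x \<in> delta ` ker.cspan X B" "y \<in> delta ` ker.cspan X B" for x y
    proof -
      from that obtain u v where "x = delta u" "u \<in> ker.cspan X B" "y = delta v" "v \<in> ker.cspan X B"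
        by blast
      then show ?thesis
        using ker.cspan_add[of u X B v] by (auto simp: delta_add[symmetric])
    qed
    show "\<one>\<^bsub>add_monoid (Der_module A)\<^esub> \<in> delta ` ker.cspan X B"
      using ker.cspan_zero by (auto simp flip: delta_zero)
    show "inv\<^bsub>add_monoid (Der_module A)\<^esub> x \<in> delta ` ker.cspan X B" if "x \<in> delta ` ker.cspan X B" for x
    proof -
      from that obtain u where u: "x = delta u" "u \<in> ker.cspan X B" by blast
      show ?thesis
        unfolding u(1) inv_delta[OF tan[OF u(2)]] using ker.cspan_scale[OF u(2)] by (rule imageI)
    qed
    show "a \<odot>\<^bsub>Der_module A\<^esub> x \<in> delta ` ker.cspan X B" if "a \<in> carrier A" "x \<in> delta ` ker.cspan X B" for a x
    proof -
      from that obtain p u where u: "a = \<pi> p" "x = delta u" "u \<in> ker.cspan X B"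
        by (auto simp: pi_carrier)
      show ?thesis
        unfolding u(1,2) delta_scale[symmetric] using ker.cspan_scale[OF u(3)] by (rule imageI)
    qed
  qed
qed

text \<open>Through \<open>delta\<close> the closure rules of \<open>cspan\<close> become those of a
  submodule. Closure under congruence adds no derivation, since \<open>delta\<close> depends only on
  the vector modulo the kernel.\<close>

lemma hull_delta:
  assumes B: "\<And>b. b \<in> B \<Longrightarrow> tangent b"
  shows "(\<lambda>H. submodule H A (Der_module A)) hull (delta ` B) = delta ` ker.cspan X B"
proof (rule hull_unique)
  show "delta ` B \<subseteq> delta ` ker.cspan X B"
    using ker.cspan_base by blast
  show "submodule (delta ` ker.cspan X B) A (Der_module A)"
    using B by (rule submodule_delta_cspan)
  fix H assume BH: "delta ` B \<subseteq> H" and H: "submodule H A (Der_module A)"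
  interpret submodule H A "Der_module A" by fact
  have "delta u \<in> H" if "u \<in> ker.cspan X B" for u
    using that
  proof (induction rule: ker.cspan.induct)
    case (cspan_base b)
    then show ?case using BH by blast
  next
    case cspan_zero
    then show ?case using one_closed by (simp add: delta_zero)
  next
    case (cspan_add u v)
    then show ?case using m_closed[of "delta u" "delta v"] by (simp add: delta_add)
  next
    case (cspan_scale u c)
    then show ?case by (simp add: delta_scale)
  next
    case (cspan_cong u v)
    then show ?case using tangent_cong(2)[of u v] tangent_cspan[OF B cspan_cong.hyps(1)] by simp
  qed
  then show "delta ` ker.cspan X B \<subseteq> H" by blast
qed

end

text \<open>Makes \<open>conjugate\<close> refer to conjugation by an isomorphism again, not to the
  class operation on matrices.\<close>

hide_const (open) conjugate_class.conjugate

text \<open>The quotient map is extended to polynomials in all variables by sending the superfluous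
  variables to 0.\<close>

definition coset :: "nat \<Rightarrow> 'k::field mpoly set \<Rightarrow> 'k mpoly \<Rightarrow> 'k mpoly set"
  where "coset n I p = I +>\<^bsub>mpoly_ring n\<^esub> restrict_vars n p"

lemma quot_alg_simps:
  "carrier (quot_alg n I) = carrier (mpoly_ring n Quot I)"
  "monoid.mult (quot_alg n I) = monoid.mult (mpoly_ring n Quot I)"
  "one (quot_alg n I) = one (mpoly_ring n Quot I)"
  "zero (quot_alg n I) = zero (mpoly_ring n Quot I)"
  "add (quot_alg n I) = add (mpoly_ring n Quot I)"
  "c \<odot>\<^bsub>quot_alg n I\<^esub> a = (I +>\<^bsub>mpoly_ring n\<^esub> mconst c) \<otimes>\<^bsub>mpoly_ring n Quot I\<^esub> a"
  by (simp_all add: quot_alg_def ring.defs)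

lemma polynomial_quotient_quot_alg:
  assumes "primeideal I (mpoly_ring n)"
  shows "polynomial_quotient (quot_alg n I) (coset n I) {1..n}"
proof -
  interpret P: cring "mpoly_ring n" by (rule cring_mpoly_ring)
  interpret I: primeideal I "mpoly_ring n" by fact
  interpret Q: domain "mpoly_ring n Quot I" by (rule I.quotient_is_domain)
  interpret hom: ring_hom_ring "mpoly_ring n" "mpoly_ring n Quot I" "(+>\<^bsub>mpoly_ring n\<^esub>) I"
    by (rule I.rcos_ring_hom_ring)
  note res = restrict_vars_carrier
  have add: "coset n I p \<oplus>\<^bsub>mpoly_ring n Quot I\<^esub> coset n I q = coset n I (p + q)" for p q
    using hom.hom_add[OF res[of n p] res[of n q]] by (simp add: coset_def)
  have mult: "coset n I p \<otimes>\<^bsub>mpoly_ring n Quot I\<^esub> coset n I q = coset n I (p * q)" for p q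
    using hom.hom_mult[OF res[of n p] res[of n q]] by (simp add: coset_def)
  have zero: "\<zero>\<^bsub>mpoly_ring n Quot I\<^esub> = coset n I 0"
    using hom.hom_zero by (simp add: coset_def)
  have one: "\<one>\<^bsub>mpoly_ring n Quot I\<^esub> = coset n I 1"
    using hom.hom_one by (simp add: coset_def)
  have carrier: "carrier (mpoly_ring n Quot I) = range (coset n I)"
  proof
    show "range (coset n I) \<subseteq> carrier (mpoly_ring n Quot I)"
      using hom.hom_closed[OF res] by (auto simp: coset_def)
    show "carrier (mpoly_ring n Quot I) \<subseteq> range (coset n I)"
    proof
      fix a assume "a \<in> carrier (mpoly_ring n Quot I)"
      then obtain p where "p \<in> carrier (mpoly_ring n)" "a = I +>\<^bsub>mpoly_ring n\<^esub> p"
        by (auto simp: FactRing_def A_RCOSETS_def')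
      then have "a = coset n I p" by (simp add: coset_def restrict_vars_id)
      then show "a \<in> range (coset n I)" by simp
    qed
  qed
  show ?thesis
  proof
    show "c \<odot>\<^bsub>quot_alg n I\<^esub> coset n I p = coset n I (mconst c * p)" for c p
      using mult[of "mconst c" p] by (simp add: quot_alg_simps coset_def)
    show "coset n I p = coset n I 0 \<or> coset n I q = coset n I 0"
      if "coset n I (p * q) = coset n I 0" for p q
      using that Q.integral[of "coset n I p" "coset n I q"] carrier by (simp add: mult zero)
    show "coset n I 1 \<noteq> coset n I 0"
      using Q.one_not_zero by (simp add: zero one)
    show "coset n I (mvar x) = coset n I 0" if "x \<notin> {1..n}" for x
      using that by (simp only: coset_def restrict_vars_mvar if_False restrict_vars_hom)
  qed (simp_all add: quot_alg_simps add mult zero one carrier)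
qed

section \<open>Natural derivations of a presented algebra\<close>

locale presented =
  fixes n :: nat and I :: "'k::field mpoly set" and m :: nat and f :: "nat \<Rightarrow> 'k mpoly"
  assumes presents: "presents n I m f"
begin

sublocale polynomial_quotient "quot_alg n I" "coset n I" "{1..n}"
  using presents polynomial_quotient_quot_alg unfolding presents_def by blast

lemma ideal_I: "ideal I (mpoly_ring n)"
  using presents unfolding presents_def primeideal_def by blast

lemma ker_iff: "p \<in> ker \<longleftrightarrow> restrict_vars n p \<in> I"
proof -
  interpret P: cring "mpoly_ring n" by (rule cring_mpoly_ring)
  have "p \<in> ker \<longleftrightarrow> I +>\<^bsub>mpoly_ring n\<^esub> restrict_vars n p = I +>\<^bsub>mpoly_ring n\<^esub> 0"
    by (simp add: ker_def coset_def)
  also have "\<dots> \<longleftrightarrow> restrict_vars n p \<ominus>\<^bsub>mpoly_ring n\<^esub> 0 \<in> I"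
    using P.quotient_eq_iff_same_a_r_cos[OF ideal_I restrict_vars_carrier[of n p] P.zero_closed] by simp
  also have "restrict_vars n p \<ominus>\<^bsub>mpoly_ring n\<^esub> 0 = restrict_vars n p"
    using restrict_vars_carrier[of n p] P.minus_zero by (simp add: a_minus_def)
  finally show ?thesis .
qed

lemma coset_carrier: "p \<in> carrier (mpoly_ring n) \<Longrightarrow> I +>\<^bsub>mpoly_ring n\<^esub> p = coset n I p"
  by (simp add: coset_def restrict_vars_id)

lemma f_carrier: "i \<in> {1..m} \<Longrightarrow> f i \<in> carrier (mpoly_ring n)"
  using presents unfolding presents_def by blast

lemma f_ker:
  assumes "i \<in> {1..m}"
  shows "f i \<in> ker"
proof -
  have "f i = (\<Sum>k = 1..m. of_bool (k = i) * f k)"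
    using dot_unit[of "{1..m}" i f] assms by (simp add: dot_def)
  moreover have "of_bool b \<in> carrier (mpoly_ring n)" for b
    using mconst_carrier[of 0 n] mconst_carrier[of 1 n] by (cases b) simp_all
  ultimately have "f i \<in> generated_ideal n m f"
    unfolding generated_ideal_def
    by (intro CollectI exI[of _ "\<lambda>k. of_bool (k = i)"] conjI) (assumption, blast)
  then have "f i \<in> I"
    using presents unfolding presents_def by blast
  then show ?thesis
    unfolding ker_iff restrict_vars_id[OF f_carrier[OF assms]] .
qed

text \<open>An element F of the kernel may involve variables beyond n, whereas I contains only its
  restriction; this compares the gradients of the two.\<close>

lemma ker_mpderiv_restrict:
  assumes "x \<in> {1..n}"
  shows "mpderiv x F - mpderiv x (restrict_vars n F) \<in> ker"
  using ker.zero_mem by (simp add: ker_iff mpderiv_restrict_vars[OF assms] restrict_vars_idem)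

abbreviation grad :: "nat \<Rightarrow> nat \<Rightarrow> 'k mpoly"
  where "grad i \<equiv> \<lambda>x. mpderiv x (f i)"

abbreviation Rel :: "(nat \<Rightarrow> 'k mpoly) set"
  where "Rel \<equiv> relations ker {1..n}"

lemma grad_Rel: "i \<in> {1..m} \<Longrightarrow> grad i \<in> Rel"
  using f_ker ker.zero_mem by (force simp: relations_def)

text \<open>Write the restriction of F as a combination of the f_i. In its gradient the terms with
  derivatives of the coefficients are multiples of the f_i, so they lie in the kernel.\<close>

lemma Rel_span:
  assumes "u \<in> Rel"
  shows "\<exists>c. \<forall>x\<in>{1..n}. ker.cong (u x) (\<Sum>i\<in>{1..m}. c i * grad i x)"
proof -
  obtain F where F: "F \<in> ker" "\<And>x. x \<in> {1..n} \<Longrightarrow> ker.cong (u x) (mpderiv x F)"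
    using assms by (auto simp: relations_def)
  have "restrict_vars n F \<in> generated_ideal n m f"
    using F(1) presents by (simp add: ker_iff presents_def)
  then obtain c where c: "restrict_vars n F = (\<Sum>i = 1..m. c i * f i)"
    by (auto simp: generated_ideal_def)
  have "ker.cong (u x) (\<Sum>i\<in>{1..m}. c i * grad i x)" if x: "x \<in> {1..n}" for x
  proof -
    have "mpderiv x (restrict_vars n F) - (\<Sum>i\<in>{1..m}. c i * grad i x) = (\<Sum>i\<in>{1..m}. mpderiv x (c i) * f i)"
      by (simp add: c sum.distrib)
    also have "\<dots> \<in> ker"
      using f_ker by (intro ker.sum_mem ker.mult_mem)
    finally show ?thesis
      using F(2)[OF x] ker_mpderiv_restrict[OF x] ker.cong_trans by blast
  qed
  then show ?thesis by blast
qed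

lemma jacobi_coset:
  assumes "i \<in> {1..m}" "x \<in> {1..n}"
  shows "jacobi_matrix n I f i x = coset n I (grad i x)"
proof -
  have "restrict_vars n (grad i x) = grad i x"
    using mpderiv_restrict_vars[OF assms(2), of "f i"] restrict_vars_id[OF f_carrier[OF assms(1)]] by simp
  then show ?thesis by (simp add: jacobi_matrix_def coset_def)
qed

abbreviation rank :: nat
  where "rank \<equiv> jacobi_rank n I m f"

lemma rank_is: "ker.rank_is {1..n} Rel rank"
  unfolding jacobi_rank_def
  by (rule matrix_rank_is[OF refl grad_Rel Rel_span]) (simp_all add: jacobi_coset fr_def pi_one)

lemma tangent_Rel: "w \<in> ker.cof {1..n} Rel rank \<Longrightarrow> tangent w"
  using rank_is tangent_cof unfolding ker.rank_is_def by blast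

text \<open>The values prescribed at the variables are the entries of w. A derivation with these
  values exists because w is tangent and is unique by \<open>Der_eq_delta\<close>, so the definite
  description denotes it.\<close>

lemma natural_derivation_eq:
  assumes i: "i \<in> {1..rank} \<rightarrow> {1..m}"
    and j: "j \<in> {1..rank + 1} \<rightarrow> {1..n}" "strict_mono_on {1..rank + 1} j"
  defines "w \<equiv> cvec rank {1..n} (\<lambda>\<nu>. grad (i (Suc \<nu>))) (\<lambda>\<mu>. unit_vec (j (Suc \<mu>)))"
  shows "natural_derivation n I f rank i j = delta w \<and> tangent w"
proof -
  let ?r = rank and ?A = "quot_alg n I" and ?\<pi> = "coset n I"
  have inj: "j a = j b \<longleftrightarrow> a = b" if "a \<in> {1..?r + 1}" "b \<in> {1..?r + 1}" for a b
    using strict_mono_on_imp_inj_on[OF j(2)] that by (auto simp: inj_on_def)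
  have "\<forall>\<nu><?r. grad (i (Suc \<nu>)) \<in> Rel"
    using i grad_Rel by (auto simp: Pi_iff)
  then have "w \<in> ker.cof {1..n} Rel ?r"
    unfolding w_def ker.cof_def by (blast intro: ker.cspan_base)
  then have tangent: "tangent w" by (rule tangent_Rel)
  have on_j: "?\<pi> (w (j k)) = [((- 1 :: int) ^ (?r + 1 + k))] \<cdot>\<^bsub>?A\<^esub> jacobi_minor n I f ?r i (omit k j)"
    if k: "k \<in> {1..?r + 1}" for k
  proof -
    define d where "d = mdet ?r {1..n} (\<lambda>\<nu>. grad (i (Suc \<nu>))) ((\<lambda>\<mu>. unit_vec (j (Suc \<mu>))) \<circ> skip (k - 1))"
    \<comment> \<open>As j is injective, only the form with index k - 1 is nonzero at j_k.\<close>
    have "w (j k) = (\<Sum>\<mu>\<in>{k - 1}. unit_vec (j (Suc \<mu>)) (j k) * ((-1) ^ (?r + \<mu>) *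
        mdet ?r {1..n} (\<lambda>\<nu>. grad (i (Suc \<nu>))) ((\<lambda>\<mu>. unit_vec (j (Suc \<mu>))) \<circ> skip \<mu>)))"
      unfolding w_def cvec_def using k inj
      by (intro sum.mono_neutral_right) (auto simp: unit_vec_def)
    also have "\<dots> = (-1) ^ (?r + (k - 1)) * d"
      using k by (simp add: unit_vec_def d_def)
    also have "(-1) ^ (?r + (k - 1)) = ((-1) ^ (?r + 1 + k) :: 'k mpoly)"
    proof -
      \<comment> \<open>Forms are counted from 0 but k from 1: the exponent in \<open>cvec\<close>
        differs by 2 from the one in the definition of natural derivations.\<close>
      have "?r + 1 + k = (?r + (k - 1)) + 2" using k by simp
      then show ?thesis by (simp only: power_add power2_eq_square) simp
    qed
    finally have w: "w (j k) = (-1) ^ (?r + 1 + k) * d" .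
    have omit: "omit k j (Suc \<mu>) = j (Suc (skip (k - 1) \<mu>))" for \<mu>
      using k by (auto simp: omit_def skip_def)
    have omit_mem: "omit k j \<mu> \<in> {1..n}" if "\<mu> \<in> {1..?r}" for \<mu>
      using that k j(1) by (auto simp: omit_def Pi_iff)
    have "jacobi_minor n I f ?r i (omit k j)
        = ?\<pi> (fdet ?r (\<lambda>\<nu> \<mu>. grad (i (Suc \<nu>)) (omit k j (Suc \<mu>))))"
      unfolding jacobi_minor_def
      by (rule determinant_pi) (use i omit_mem jacobi_coset in \<open>auto simp: Pi_iff\<close>)
    also have "fdet ?r (\<lambda>\<nu> \<mu>. grad (i (Suc \<nu>)) (omit k j (Suc \<mu>))) = d"
      unfolding d_def mdet_def
    proof (rule fdet_cong)
      fix \<nu> \<mu> assume "\<nu> < ?r" "\<mu> < ?r"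
      then have "omit k j (Suc \<mu>) \<in> {1..n}" by (intro omit_mem) simp
      then show "grad (i (Suc \<nu>)) (omit k j (Suc \<mu>))
          = dot {1..n} (grad (i (Suc \<nu>))) (((\<lambda>\<mu>. unit_vec (j (Suc \<mu>))) \<circ> skip (k - 1)) \<mu>)"
        unfolding unit_vec_def comp_def omit[symmetric] by (subst dot_commute) (simp add: dot_unit)
    qed
    finally have "jacobi_minor n I f ?r i (omit k j) = ?\<pi> d" .
    moreover have "(- 1 :: int) ^ (?r + 1 + k) = 1 \<or> (- 1 :: int) ^ (?r + 1 + k) = - 1"
      using neg_one_even_power neg_one_odd_power by metis
    ultimately show ?thesis by (simp add: w pi_sign)
  qed
  have off_j: "w l = 0" if "l \<notin> j ` {1..?r + 1}" for l
    unfolding w_def cvec_def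
  proof (rule sum.neutral, intro ballI)
    fix \<mu> assume "\<mu> \<in> {..<Suc ?r}"
    then have "j (Suc \<mu>) \<noteq> l" using that by auto
    then show "unit_vec (j (Suc \<mu>)) l * ((-1) ^ (?r + \<mu>) * mdet ?r {1..n} (\<lambda>\<nu>. grad (i (Suc \<nu>)))
        ((\<lambda>\<mu>. unit_vec (j (Suc \<mu>))) \<circ> skip \<mu>)) = 0"
      by (auto simp: unit_vec_def)
  qed
  have var: "I +>\<^bsub>mpoly_ring n\<^esub> mvar l = ?\<pi> (mvar l)" if "l \<in> {1..n}" for l
    using mvar_carrier[OF that] by (rule coset_carrier)
  have jn: "j k \<in> {1..n}" if "k \<in> {1..?r + 1}" for k
    using j(1) that by blast
  have "natural_derivation n I f ?r i j = delta w"
    unfolding natural_derivation_def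
  proof (rule the_equality)
    show "delta w \<in> Der ?A \<and>
      (\<forall>k\<in>{1..?r + 1}. delta w (I +>\<^bsub>mpoly_ring n\<^esub> mvar (j k)) =
         [((- 1 :: int) ^ (?r + 1 + k))] \<cdot>\<^bsub>?A\<^esub> jacobi_minor n I f ?r i (omit k j)) \<and>
      (\<forall>l\<in>{1..n} - j ` {1..?r + 1}. delta w (I +>\<^bsub>mpoly_ring n\<^esub> mvar l) = \<zero>\<^bsub>?A\<^esub>)"
    proof (intro conjI ballI)
      show "delta w \<in> Der ?A" using tangent by (rule delta_Der)
      show "delta w (I +>\<^bsub>mpoly_ring n\<^esub> mvar (j k)) =
         [((- 1 :: int) ^ (?r + 1 + k))] \<cdot>\<^bsub>?A\<^esub> jacobi_minor n I f ?r i (omit k j)"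
        if "k \<in> {1..?r + 1}" for k
        unfolding var[OF jn[OF that]] delta_mvar[OF tangent jn[OF that]] by (rule on_j[OF that])
      show "delta w (I +>\<^bsub>mpoly_ring n\<^esub> mvar l) = \<zero>\<^bsub>?A\<^esub>" if "l \<in> {1..n} - j ` {1..?r + 1}" for l
        using that var[of l] delta_mvar[OF tangent, of l] off_j[of l] by (simp add: pi_zero)
    qed
    fix D assume D: "D \<in> Der ?A \<and>
      (\<forall>k\<in>{1..?r + 1}. D (I +>\<^bsub>mpoly_ring n\<^esub> mvar (j k)) =
         [((- 1 :: int) ^ (?r + 1 + k))] \<cdot>\<^bsub>?A\<^esub> jacobi_minor n I f ?r i (omit k j)) \<and>
      (\<forall>l\<in>{1..n} - j ` {1..?r + 1}. D (I +>\<^bsub>mpoly_ring n\<^esub> mvar l) = \<zero>\<^bsub>?A\<^esub>)"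
    have "D (?\<pi> (mvar x)) = ?\<pi> (w x)" if x: "x \<in> {1..n}" for x
    proof (cases "x \<in> j ` {1..?r + 1}")
      case True
      then obtain k where k: "k \<in> {1..?r + 1}" "x = j k" by blast
      have "D (I +>\<^bsub>mpoly_ring n\<^esub> mvar (j k)) = ?\<pi> (w (j k))"
        unfolding on_j[OF k(1)] using D k(1) by blast
      then show ?thesis
        using var[OF x] k(2) by simp
    next
      case False
      then have "D (I +>\<^bsub>mpoly_ring n\<^esub> mvar x) = \<zero>\<^bsub>?A\<^esub>"
        using D x by blast
      then show ?thesis
        using var[OF x] off_j[OF False] by (simp add: pi_zero)
    qed
    then show "D = delta w"
      using Der_eq_delta[of D w] D by blast
  qed
  then show ?thesis using tangent ..
qed

lemma natural_derivations_eq: "natural_derivations n I m f = delta ` sorted_minors m grad rank"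
proof
  show "natural_derivations n I m f \<subseteq> delta ` sorted_minors m grad rank"
    unfolding natural_derivations_def Let_def sorted_minors_def using natural_derivation_eq by blast
  show "delta ` sorted_minors m grad rank \<subseteq> natural_derivations n I m f"
  proof
    fix D assume "D \<in> delta ` sorted_minors m grad rank"
    then obtain i j where D: "D = delta (cvec rank {1..n} (\<lambda>\<nu>. grad (i (Suc \<nu>))) (\<lambda>\<mu>. unit_vec (j (Suc \<mu>))))"
      and ij: "i \<in> {1..rank} \<rightarrow> {1..m}" "strict_mono_on {1..rank} i"
        "j \<in> {1..rank + 1} \<rightarrow> {1..n}" "strict_mono_on {1..rank + 1} j"
      unfolding sorted_minors_def by blast
    have "D = natural_derivation n I f rank i j"
      using natural_derivation_eq[OF ij(1,3,4)] D by simp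
    then show "D \<in> natural_derivations n I m f"
      unfolding natural_derivations_def Let_def using ij by blast
  qed
qed

text \<open>On the right the generators f enter only through the rank, and that number is determined
  by the module of relations.\<close>

lemma nat_der_eq: "nat_der n I m f = delta ` ker.cof {1..n} Rel rank"
proof -
  have tan: "tangent b" if "b \<in> sorted_minors m grad rank" for b
    using that natural_derivation_eq unfolding sorted_minors_def by blast
  have "ker.cof {1..n} Rel rank = ker.cspan {1..n} (sorted_minors m grad rank)"
    by (rule cof_eq_cspan_sorted_minors) (rule grad_Rel Rel_span, assumption)+
  then show ?thesis
    unfolding nat_der_def natural_derivations_eq using hull_delta[OF tan] by simp
qed

end

section \<open>Transport along isomorphisms\<close>

lemma alg_iso_inverse:
  assumes "ring A" and \<sigma>: "\<sigma> \<in> alg_iso A B"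
    and smult: "\<And>c a. a \<in> carrier A \<Longrightarrow> c \<odot>\<^bsub>A\<^esub> a \<in> carrier A"
  shows "inv_into (carrier A) \<sigma> \<in> alg_iso B A"
proof -
  have iso: "\<sigma> \<in> ring_iso A B" and hom: "\<And>c a. a \<in> carrier A \<Longrightarrow> \<sigma> (c \<odot>\<^bsub>A\<^esub> a) = c \<odot>\<^bsub>B\<^esub> \<sigma> a"
    using \<sigma> by (simp_all add: alg_iso_def)
  have bij: "bij_betw \<sigma> (carrier A) (carrier B)"
    using ring_iso_memE(5)[OF iso] .
  have "inv_into (carrier A) \<sigma> (c \<odot>\<^bsub>B\<^esub> b) = c \<odot>\<^bsub>A\<^esub> inv_into (carrier A) \<sigma> b" if "b \<in> carrier B" for b c
  proof -
    let ?a = "inv_into (carrier A) \<sigma> b"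
    have a: "?a \<in> carrier A" "\<sigma> ?a = b"
      using bij that by (auto simp: bij_betw_def inv_into_into f_inv_into_f)
    then have "c \<odot>\<^bsub>B\<^esub> b = \<sigma> (c \<odot>\<^bsub>A\<^esub> ?a)" using hom by simp
    then show ?thesis
      using bij smult[OF a(1)] by (simp add: bij_betw_def inv_into_f_f)
  qed
  then show ?thesis
    using ring_iso_set_sym[OF assms(1) iso] by (simp add: alg_iso_def)
qed

lemma End_alg_simps:
  "carrier (End_alg A) = {T \<in> carrier A \<rightarrow>\<^sub>E carrier A.
       (\<forall>x \<in> carrier A. \<forall>y \<in> carrier A. T (x \<oplus>\<^bsub>A\<^esub> y) = T x \<oplus>\<^bsub>A\<^esub> T y) \<and>
       (\<forall>c. \<forall>x \<in> carrier A. T (c \<odot>\<^bsub>A\<^esub> x) = c \<odot>\<^bsub>A\<^esub> T x)}"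
  "S \<otimes>\<^bsub>End_alg A\<^esub> T = compose (carrier A) S T"
  "\<one>\<^bsub>End_alg A\<^esub> = (\<lambda>x \<in> carrier A. x)"
  "\<zero>\<^bsub>End_alg A\<^esub> = (\<lambda>x \<in> carrier A. \<zero>\<^bsub>A\<^esub>)"
  "S \<oplus>\<^bsub>End_alg A\<^esub> T = (\<lambda>x \<in> carrier A. S x \<oplus>\<^bsub>A\<^esub> T x)"
  "c \<odot>\<^bsub>End_alg A\<^esub> T = (\<lambda>x \<in> carrier A. c \<odot>\<^bsub>A\<^esub> T x)"
  by (simp_all add: End_alg_def)

section \<open>The algebra of linear endomorphisms\<close>

context polynomial_quotient
begin

lemma smult_closed: "a \<in> carrier A \<Longrightarrow> c \<odot>\<^bsub>A\<^esub> a \<in> carrier A"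
  by (erule pi_cases) (simp add: pi_smult)

lemma smult_add:
  assumes "a \<in> carrier A" "b \<in> carrier A"
  shows "c \<odot>\<^bsub>A\<^esub> (a \<oplus>\<^bsub>A\<^esub> b) = c \<odot>\<^bsub>A\<^esub> a \<oplus>\<^bsub>A\<^esub> c \<odot>\<^bsub>A\<^esub> b"
  using assms by (elim pi_cases) (simp add: pi_simps distrib_left)

lemma smult_smult: "a \<in> carrier A \<Longrightarrow> c \<odot>\<^bsub>A\<^esub> (d \<odot>\<^bsub>A\<^esub> a) = d \<odot>\<^bsub>A\<^esub> (c \<odot>\<^bsub>A\<^esub> a)"
  by (elim pi_cases) (simp add: pi_smult mult.left_commute)

lemma smult_zero: "c \<odot>\<^bsub>A\<^esub> \<zero>\<^bsub>A\<^esub> = \<zero>\<^bsub>A\<^esub>"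
  by (simp add: pi_zero pi_smult)

lemma smult_mult_right:
  assumes "a \<in> carrier A" "b \<in> carrier A"
  shows "a \<otimes>\<^bsub>A\<^esub> (c \<odot>\<^bsub>A\<^esub> b) = c \<odot>\<^bsub>A\<^esub> (a \<otimes>\<^bsub>A\<^esub> b)"
  using assms by (elim pi_cases) (simp add: pi_simps mult.left_commute)

lemma smult_neg_one: "a \<in> carrier A \<Longrightarrow> (- 1) \<odot>\<^bsub>A\<^esub> a = \<ominus>\<^bsub>A\<^esub> a"
proof (elim pi_cases)
  fix p assume "a = \<pi> p"
  moreover have "mconst (- 1) * p = - p"
  proof -
    have "(mconst (- 1) + mconst 1) * p = 0"
      unfolding mconst_hom(3)[symmetric] by simp
    then show ?thesis by (simp add: distrib_right eq_neg_iff_add_eq_0)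
  qed
  ultimately show ?thesis by (simp add: pi_smult pi_uminus)
qed

lemma EndD:
  assumes "T \<in> carrier (End_alg A)"
  shows "T \<in> carrier A \<rightarrow>\<^sub>E carrier A" "x \<in> carrier A \<Longrightarrow> T x \<in> carrier A"
    "x \<in> carrier A \<Longrightarrow> y \<in> carrier A \<Longrightarrow> T (x \<oplus>\<^bsub>A\<^esub> y) = T x \<oplus>\<^bsub>A\<^esub> T y"
    "x \<in> carrier A \<Longrightarrow> T (c \<odot>\<^bsub>A\<^esub> x) = c \<odot>\<^bsub>A\<^esub> T x"
  using assms by (auto simp: End_alg_simps)

lemma EndI:
  assumes "T \<in> carrier A \<rightarrow>\<^sub>E carrier A"
    "\<And>x y. x \<in> carrier A \<Longrightarrow> y \<in> carrier A \<Longrightarrow> T (x \<oplus>\<^bsub>A\<^esub> y) = T x \<oplus>\<^bsub>A\<^esub> T y"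
    "\<And>c x. x \<in> carrier A \<Longrightarrow> T (c \<odot>\<^bsub>A\<^esub> x) = c \<odot>\<^bsub>A\<^esub> T x"
  shows "T \<in> carrier (End_alg A)"
  using assms by (simp add: End_alg_simps(1))

lemma End_zero: "\<zero>\<^bsub>End_alg A\<^esub> \<in> carrier (End_alg A)"
  by (rule EndI) (auto simp: End_alg_simps(4) smult_closed smult_zero)

lemma End_one: "\<one>\<^bsub>End_alg A\<^esub> \<in> carrier (End_alg A)"
  by (rule EndI) (auto simp: End_alg_simps(3) smult_closed)

lemma End_add:
  assumes "S \<in> carrier (End_alg A)" "T \<in> carrier (End_alg A)"
  shows "S \<oplus>\<^bsub>End_alg A\<^esub> T \<in> carrier (End_alg A)"
  unfolding End_alg_simps(5)
  by (rule EndI) (use EndD[OF assms(1)] EndD[OF assms(2)] in \<open>auto simp: smult_closed smult_add A.a_ac\<close>)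

lemma End_mult:
  assumes "S \<in> carrier (End_alg A)" "T \<in> carrier (End_alg A)"
  shows "S \<otimes>\<^bsub>End_alg A\<^esub> T \<in> carrier (End_alg A)"
  unfolding End_alg_simps(2)
  by (rule EndI) (use EndD[OF assms(1)] EndD[OF assms(2)] in \<open>auto simp: compose_def smult_closed\<close>)

lemma End_smult:
  assumes "T \<in> carrier (End_alg A)"
  shows "c \<odot>\<^bsub>End_alg A\<^esub> T \<in> carrier (End_alg A)"
  unfolding End_alg_simps(6)
  by (rule EndI) (use EndD[OF assms] in \<open>auto simp: smult_closed smult_add smult_smult\<close>)

text \<open>The inverse is again a definite description; its uniqueness follows pointwise from the
  uniqueness of negatives in A.\<close>

lemma End_inv:
  assumes "T \<in> carrier (End_alg A)"
  shows "inv\<^bsub>add_monoid (End_alg A)\<^esub> T = (- 1) \<odot>\<^bsub>End_alg A\<^esub> T"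
  unfolding m_inv_def
proof (rule the_equality)
  note T = EndD(2)[OF assms]
  show "(- 1) \<odot>\<^bsub>End_alg A\<^esub> T \<in> carrier (add_monoid (End_alg A)) \<and>
    T \<otimes>\<^bsub>add_monoid (End_alg A)\<^esub> ((- 1) \<odot>\<^bsub>End_alg A\<^esub> T) = \<one>\<^bsub>add_monoid (End_alg A)\<^esub> \<and>
    (- 1) \<odot>\<^bsub>End_alg A\<^esub> T \<otimes>\<^bsub>add_monoid (End_alg A)\<^esub> T = \<one>\<^bsub>add_monoid (End_alg A)\<^esub>"
    using End_smult[OF assms] T
    by (auto simp: End_alg_simps(4-6) smult_neg_one A.r_neg A.l_neg fun_eq_iff restrict_def)
  fix S assume S: "S \<in> carrier (add_monoid (End_alg A)) \<and>
    T \<otimes>\<^bsub>add_monoid (End_alg A)\<^esub> S = \<one>\<^bsub>add_monoid (End_alg A)\<^esub> \<and>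
    S \<otimes>\<^bsub>add_monoid (End_alg A)\<^esub> T = \<one>\<^bsub>add_monoid (End_alg A)\<^esub>"
  then have S': "S \<in> carrier (End_alg A)" by simp
  show "S = (- 1) \<odot>\<^bsub>End_alg A\<^esub> T"
  proof (rule PiE_ext[OF EndD(1)[OF S'] EndD(1)[OF End_smult[OF assms]]])
    fix x assume x: "x \<in> carrier A"
    have "(S \<oplus>\<^bsub>End_alg A\<^esub> T) x = \<zero>\<^bsub>End_alg A\<^esub> x"
      using S by simp
    then have "S x \<oplus>\<^bsub>A\<^esub> T x = \<zero>\<^bsub>A\<^esub>" using x by (simp add: End_alg_simps)
    then have "S x = \<ominus>\<^bsub>A\<^esub> T x"
      using A.minus_equality[of "S x" "T x"] EndD(2)[OF S' x] T[OF x] by simp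
    then show "S x = ((- 1) \<odot>\<^bsub>End_alg A\<^esub> T) x"
      using x T by (simp add: End_alg_simps smult_neg_one)
  qed
qed

lemma subalgebraI:
  assumes "H \<subseteq> carrier (End_alg A)" "\<zero>\<^bsub>End_alg A\<^esub> \<in> H" "\<one>\<^bsub>End_alg A\<^esub> \<in> H"
    "\<And>S T. S \<in> H \<Longrightarrow> T \<in> H \<Longrightarrow> S \<oplus>\<^bsub>End_alg A\<^esub> T \<in> H"
    "\<And>S T. S \<in> H \<Longrightarrow> T \<in> H \<Longrightarrow> S \<otimes>\<^bsub>End_alg A\<^esub> T \<in> H"
    "\<And>c T. T \<in> H \<Longrightarrow> c \<odot>\<^bsub>End_alg A\<^esub> T \<in> H"
  shows "subalgebra_of (End_alg A) H"
  unfolding subalgebra_of_def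
proof (intro conjI subring.intro subgroup.intro submonoid.intro)
  show "inv\<^bsub>add_monoid (End_alg A)\<^esub> T \<in> H" if "T \<in> H" for T
    using assms(1,6) End_inv that by auto
qed (use assms in auto)

lemma subalgebra_carrier: "subalgebra_of (End_alg A) (carrier (End_alg A))"
  by (rule subalgebraI) (simp_all add: End_zero End_one End_add End_mult End_smult)

lemma left_mult_End:
  assumes "a \<in> carrier A"
  shows "left_mult A a \<in> carrier (End_alg A)"
  unfolding left_mult_def
  by (rule EndI) (use assms in \<open>auto simp: smult_closed A.r_distr smult_mult_right\<close>)

end

lemma subalgebraD:
  assumes "subalgebra_of E H"
  shows "H \<subseteq> carrier E" "\<zero>\<^bsub>E\<^esub> \<in> H" "\<one>\<^bsub>E\<^esub> \<in> H"
    "S \<in> H \<Longrightarrow> T \<in> H \<Longrightarrow> S \<oplus>\<^bsub>E\<^esub> T \<in> H"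
    "S \<in> H \<Longrightarrow> T \<in> H \<Longrightarrow> S \<otimes>\<^bsub>E\<^esub> T \<in> H"
    "T \<in> H \<Longrightarrow> c \<odot>\<^bsub>E\<^esub> T \<in> H"
proof -
  interpret subring H E using assms by (simp add: subalgebra_of_def)
  show "H \<subseteq> carrier E" "\<zero>\<^bsub>E\<^esub> \<in> H" "\<one>\<^bsub>E\<^esub> \<in> H"
    "S \<in> H \<Longrightarrow> T \<in> H \<Longrightarrow> S \<oplus>\<^bsub>E\<^esub> T \<in> H" "S \<in> H \<Longrightarrow> T \<in> H \<Longrightarrow> S \<otimes>\<^bsub>E\<^esub> T \<in> H"
    using subgroup_axioms submonoid_axioms
    by (auto simp: subgroup_def submonoid_def)
  show "T \<in> H \<Longrightarrow> c \<odot>\<^bsub>E\<^esub> T \<in> H"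
    using assms by (simp add: subalgebra_of_def)
qed

section \<open>Conjugation by an isomorphism\<close>

locale isomorphic_quotients =
  P: polynomial_quotient A \<pi> X + Q: polynomial_quotient B \<rho> Y
  for A :: "('k::field, 'a) module" and \<pi> X and B :: "('k, 'b) module" and \<rho> Y +
  fixes \<sigma> :: "'a \<Rightarrow> 'b"
  assumes iso: "\<sigma> \<in> alg_iso A B"
begin

abbreviation \<tau> :: "'b \<Rightarrow> 'a"
  where "\<tau> \<equiv> inv_into (carrier A) \<sigma>"

lemma iso_simps:
  "a \<in> carrier A \<Longrightarrow> \<sigma> a \<in> carrier B"
  "a \<in> carrier A \<Longrightarrow> a' \<in> carrier A \<Longrightarrow> \<sigma> (a \<oplus>\<^bsub>A\<^esub> a') = \<sigma> a \<oplus>\<^bsub>B\<^esub> \<sigma> a'"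
  "a \<in> carrier A \<Longrightarrow> a' \<in> carrier A \<Longrightarrow> \<sigma> (a \<otimes>\<^bsub>A\<^esub> a') = \<sigma> a \<otimes>\<^bsub>B\<^esub> \<sigma> a'"
  "\<sigma> \<one>\<^bsub>A\<^esub> = \<one>\<^bsub>B\<^esub>"
  "a \<in> carrier A \<Longrightarrow> \<sigma> (c \<odot>\<^bsub>A\<^esub> a) = c \<odot>\<^bsub>B\<^esub> \<sigma> a"
  using iso ring_iso_memE[of \<sigma> A B] by (auto simp: alg_iso_def)

lemma iso_bij: "bij_betw \<sigma> (carrier A) (carrier B)"
  using iso ring_iso_memE(5)[of \<sigma> A B] by (auto simp: alg_iso_def)

lemma iso_zero: "\<sigma> \<zero>\<^bsub>A\<^esub> = \<zero>\<^bsub>B\<^esub>"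
proof -
  have "\<sigma> \<zero>\<^bsub>A\<^esub> \<oplus>\<^bsub>B\<^esub> \<sigma> \<zero>\<^bsub>A\<^esub> = \<sigma> \<zero>\<^bsub>A\<^esub>"
    using iso_simps(2)[of "\<zero>\<^bsub>A\<^esub>" "\<zero>\<^bsub>A\<^esub>"] by simp
  then show ?thesis
    using Q.A.add.l_cancel_one[of "\<sigma> \<zero>\<^bsub>A\<^esub>" "\<sigma> \<zero>\<^bsub>A\<^esub>"] iso_simps(1) by simp
qed

lemma inverse_iso: "\<tau> \<in> alg_iso B A"
  using alg_iso_inverse[OF P.A.ring_axioms iso P.smult_closed] .

lemma inverse_simps:
  "b \<in> carrier B \<Longrightarrow> \<tau> b \<in> carrier A"
  "b \<in> carrier B \<Longrightarrow> \<sigma> (\<tau> b) = b"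
  "a \<in> carrier A \<Longrightarrow> \<tau> (\<sigma> a) = a"
  using iso_bij by (auto simp: bij_betw_def inv_into_into f_inv_into_f inv_into_f_f)

lemma inverse_hom:
  "b \<in> carrier B \<Longrightarrow> b' \<in> carrier B \<Longrightarrow> \<tau> (b \<oplus>\<^bsub>B\<^esub> b') = \<tau> b \<oplus>\<^bsub>A\<^esub> \<tau> b'"
  "b \<in> carrier B \<Longrightarrow> b' \<in> carrier B \<Longrightarrow> \<tau> (b \<otimes>\<^bsub>B\<^esub> b') = \<tau> b \<otimes>\<^bsub>A\<^esub> \<tau> b'"
  "b \<in> carrier B \<Longrightarrow> \<tau> (c \<odot>\<^bsub>B\<^esub> b) = c \<odot>\<^bsub>A\<^esub> \<tau> b"
  using inverse_iso ring_iso_memE[of \<tau> B A] by (auto simp: alg_iso_def)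

abbreviation conj :: "('a \<Rightarrow> 'a) \<Rightarrow> 'b \<Rightarrow> 'b"
  where "conj \<equiv> conjugate A B \<sigma>"

lemma conj_apply: "b \<in> carrier B \<Longrightarrow> conj T b = \<sigma> (T (\<tau> b))"
  by (simp add: conjugate_def)

lemma conj_End:
  assumes "T \<in> carrier (End_alg A)"
  shows "conj T \<in> carrier (End_alg B)"
proof (rule Q.EndI)
  show "conj T \<in> carrier B \<rightarrow>\<^sub>E carrier B"
    using P.EndD(2)[OF assms] by (auto simp: conjugate_def iso_simps inverse_simps)
qed (use P.EndD[OF assms] in \<open>simp_all add: conj_apply inverse_simps inverse_hom iso_simps Q.smult_closed\<close>)

lemma conj_hom:
  assumes "S \<in> carrier (End_alg A)" "T \<in> carrier (End_alg A)"
  shows "conj (S \<oplus>\<^bsub>End_alg A\<^esub> T) = conj S \<oplus>\<^bsub>End_alg B\<^esub> conj T"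
    and "conj (S \<otimes>\<^bsub>End_alg A\<^esub> T) = conj S \<otimes>\<^bsub>End_alg B\<^esub> conj T"
    and "conj (c \<odot>\<^bsub>End_alg A\<^esub> T) = c \<odot>\<^bsub>End_alg B\<^esub> conj T"
  using P.EndD(2)[OF assms(1)] P.EndD(2)[OF assms(2)]
  by (auto simp: fun_eq_iff End_alg_simps conjugate_def restrict_def compose_def inverse_simps iso_simps)

lemma conj_zero: "conj \<zero>\<^bsub>End_alg A\<^esub> = \<zero>\<^bsub>End_alg B\<^esub>"
  by (auto simp: fun_eq_iff End_alg_simps conjugate_def restrict_def inverse_simps iso_zero)

lemma conj_one: "conj \<one>\<^bsub>End_alg A\<^esub> = \<one>\<^bsub>End_alg B\<^esub>"
  by (auto simp: fun_eq_iff End_alg_simps conjugate_def restrict_def inverse_simps)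

lemma conj_left_mult: "a \<in> carrier A \<Longrightarrow> conj (left_mult A a) = left_mult B (\<sigma> a)"
  by (auto simp: fun_eq_iff left_mult_def conjugate_def restrict_def inverse_simps iso_simps)

lemma conj_Der:
  assumes "D \<in> Der A"
  shows "conj D \<in> Der B"
proof -
  have D: "D \<in> carrier (End_alg A)"
    and leibniz: "\<And>x y. x \<in> carrier A \<Longrightarrow> y \<in> carrier A \<Longrightarrow> D (x \<otimes>\<^bsub>A\<^esub> y) = D x \<otimes>\<^bsub>A\<^esub> y \<oplus>\<^bsub>A\<^esub> x \<otimes>\<^bsub>A\<^esub> D y"
    using assms by (auto simp: Der_def)
  have "conj D (x \<otimes>\<^bsub>B\<^esub> y) = conj D x \<otimes>\<^bsub>B\<^esub> y \<oplus>\<^bsub>B\<^esub> x \<otimes>\<^bsub>B\<^esub> conj D y"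
    if "x \<in> carrier B" "y \<in> carrier B" for x y
    using that P.EndD(2)[OF D] by (simp add: conj_apply inverse_simps inverse_hom leibniz iso_simps)
  then show ?thesis
    using conj_End[OF D] by (simp add: Der_def)
qed

lemma conj_inverse_conj:
  assumes "T \<in> carrier B \<rightarrow>\<^sub>E carrier B"
  shows "conj (conjugate B A \<tau> T) = T"
proof
  fix b
  have "inv_into (carrier B) \<tau> (\<tau> b) = b" if "b \<in> carrier B" for b
    using that inverse_simps(2) by (metis inj_on_inverseI inv_into_f_f)
  then show "conj (conjugate B A \<tau> T) b = T b"
    using assms by (cases "b \<in> carrier B")
      (auto simp: conjugate_def inverse_simps PiE_iff extensional_def)
qed

text \<open>Conjugation respects all operations, so the endomorphisms whose conjugate lies in a
  given subalgebra K form a subalgebra. It contains G and hence the hull.\<close>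

lemma conj_hull_subset:
  assumes G: "G \<subseteq> carrier (End_alg A)" and G': "\<And>T. T \<in> G \<Longrightarrow> conj T \<in> G'"
    and T: "T \<in> subalgebra_of (End_alg A) hull G"
  shows "conj T \<in> subalgebra_of (End_alg B) hull G'"
  unfolding hull_def
proof (rule InterI)
  fix K assume "K \<in> {t. subalgebra_of (End_alg B) t \<and> G' \<subseteq> t}"
  then have K: "subalgebra_of (End_alg B) K" and "G' \<subseteq> K" by auto
  have "subalgebra_of (End_alg A) {T \<in> carrier (End_alg A). conj T \<in> K}"
    by (rule P.subalgebraI)
      (use subalgebraD[OF K] in \<open>auto simp: P.End_zero P.End_one P.End_add P.End_mult P.End_smult
        conj_zero conj_one conj_hom\<close>)
  moreover have "G \<subseteq> {T \<in> carrier (End_alg A). conj T \<in> K}"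
    using G G' \<open>G' \<subseteq> K\<close> by blast
  ultimately have "subalgebra_of (End_alg A) hull G \<subseteq> {T \<in> carrier (End_alg A). conj T \<in> K}"
    by (rule hull_minimal[rotated])
  then show "conj T \<in> K" using T by blast
qed

text \<open>A substitution may take any values on the variables, so representatives of the images of
  the variables define S and T. The identities with \<sigma> need checking on constants and
  variables only; variables outside X or Y, of class 0, are sent to 0.\<close>

lemma lift_exists:
  obtains S T where "presentation_pair P.ker Q.ker X Y S T"
    "\<And>g. \<sigma> (\<pi> (subst S g)) = \<rho> g" "\<And>h. \<rho> (subst T h) = \<sigma> (\<pi> h)"
proof -
  have "\<exists>p. \<sigma> (\<pi> p) = \<rho> g" for g
  proof -
    have "\<tau> (\<rho> g) \<in> carrier A" by (simp add: inverse_simps)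
    then obtain p where "\<tau> (\<rho> g) = \<pi> p" by (rule P.pi_cases)
    then have "\<sigma> (\<pi> p) = \<rho> g" using inverse_simps(2)[of "\<rho> g"] by simp
    then show ?thesis ..
  qed
  then obtain s where s: "\<And>g. \<sigma> (\<pi> (s g)) = \<rho> g" by metis
  have "\<exists>q. \<rho> q = \<sigma> (\<pi> h)" for h
  proof -
    have "\<sigma> (\<pi> h) \<in> carrier B" by (simp add: iso_simps)
    then show ?thesis by (metis Q.pi_cases)
  qed
  then obtain t where t: "\<And>h. \<rho> (t h) = \<sigma> (\<pi> h)" by metis
  define S where "S = (\<lambda>y. if y \<in> Y then s (mvar y) else 0)"
  define T where "T = (\<lambda>x. if x \<in> X then t (mvar x) else 0)"
  have \<sigma>0: "\<sigma> (\<pi> 0) = \<rho> 0"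
    using iso_zero by (simp add: P.pi_zero Q.pi_zero)
  have \<sigma>_add: "\<sigma> (\<pi> (p + q)) = \<sigma> (\<pi> p) \<oplus>\<^bsub>B\<^esub> \<sigma> (\<pi> q)"
    and \<sigma>_mult: "\<sigma> (\<pi> (p * q)) = \<sigma> (\<pi> p) \<otimes>\<^bsub>B\<^esub> \<sigma> (\<pi> q)" for p q
    by (simp_all add: P.pi_add[symmetric] P.pi_mult[symmetric] iso_simps)
  have \<sigma>_const: "\<sigma> (\<pi> (mconst c)) = \<rho> (mconst c)" for c
  proof -
    have "\<sigma> (c \<odot>\<^bsub>A\<^esub> \<pi> 1) = c \<odot>\<^bsub>B\<^esub> \<rho> 1"
      using iso_simps(4) by (simp add: iso_simps P.pi_one Q.pi_one)
    then show ?thesis by (simp add: P.pi_smult Q.pi_smult)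
  qed
  have S: "\<sigma> (\<pi> (subst S g)) = \<rho> g" for g
  proof (induction g rule: mpoly_induct)
    case (var y)
    then show ?case using s \<sigma>0 Q.pi_outside by (simp add: S_def)
  qed (simp_all add: \<sigma>_const \<sigma>_add \<sigma>_mult Q.pi_add Q.pi_mult)
  have T: "\<rho> (subst T h) = \<sigma> (\<pi> h)" for h
  proof (induction h rule: mpoly_induct)
    case (var x)
    then show ?case using t \<sigma>0 P.pi_outside by (simp add: T_def)
  qed (simp_all add: \<sigma>_const \<sigma>_add \<sigma>_mult Q.pi_add[symmetric] Q.pi_mult[symmetric])
  have \<sigma>_inj: "\<sigma> (\<pi> p) = \<sigma> (\<pi> q) \<longleftrightarrow> \<pi> p = \<pi> q" for p q
    using inverse_simps(3) P.pi_closed by metis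
  have "presentation_pair P.ker Q.ker X Y S T"
  proof
    show "finite X" "finite Y" by (fact P.finite_vars Q.finite_vars)+
    show "S y = 0" if "y \<notin> Y" for y using that by (simp add: S_def)
    show "T x = 0" if "x \<notin> X" for x using that by (simp add: T_def)
    show "subst S g \<in> P.ker \<longleftrightarrow> g \<in> Q.ker" for g
      using \<sigma>_inj[of "subst S g" 0] by (simp add: P.ker_def Q.ker_def S \<sigma>0)
    show "subst T h \<in> Q.ker \<longleftrightarrow> h \<in> P.ker" for h
      using \<sigma>_inj[of h 0] by (simp add: P.ker_def Q.ker_def T \<sigma>0)
    show "subst S (subst T h) - h \<in> P.ker" for h
      using \<sigma>_inj[of "subst S (subst T h)" h] by (simp add: S T P.pi_eq_iff)
    show "subst T (subst S g) - g \<in> Q.ker" for g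
      by (simp add: S T Q.pi_eq_iff[symmetric])
  qed
  then show ?thesis using S T that by blast
qed

end

section \<open>Transport of natural derivations and of natural differential operators\<close>

locale presented_pair =
  P: presented n I m f + Q: presented n' I' m' f'
  for n :: nat and I :: "'k::field mpoly set" and m :: nat and f :: "nat \<Rightarrow> 'k mpoly"
    and n' :: nat and I' :: "'k mpoly set" and m' :: nat and f' :: "nat \<Rightarrow> 'k mpoly" +
  fixes \<sigma> :: "'k mpoly set \<Rightarrow> 'k mpoly set"
  assumes \<sigma>: "\<sigma> \<in> alg_iso (quot_alg n I) (quot_alg n' I')"
begin

sublocale isomorphic_quotients "quot_alg n I" "coset n I" "{1..n}"
    "quot_alg n' I'" "coset n' I'" "{1..n'}" \<sigma>
  by unfold_locales (rule \<sigma>)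

text \<open>The conjugate of \<open>delta w\<close> sends the class of the variable y to the image
  under \<sigma> of the w-derivative of S y. As T lifts \<sigma>, these values are the entries of
  the vector for which \<open>cof_transfer\<close> proves membership.\<close>

lemma conj_nat_der:
  assumes "D \<in> nat_der n I m f"
  shows "conj D \<in> nat_der n' I' m' f'"
proof -
  from assms obtain w where D: "D = P.delta w" and w: "w \<in> P.ker.cof {1..n} P.Rel P.rank"
    unfolding P.nat_der_eq by blast
  have tangent: "P.tangent w" using w by (rule P.tangent_Rel)
  obtain S T where "presentation_pair P.ker Q.ker {1..n} {1..n'} S T"
    and S: "\<And>g. \<sigma> (coset n I (subst S g)) = coset n' I' g"
    and T: "\<And>h. coset n' I' (subst T h) = \<sigma> (coset n I h)"
    using lift_exists by blast
  then interpret pair: presentation_pair P.ker Q.ker "{1..n}" "{1..n'}" S T by blast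
  define v where "v = (\<lambda>y. subst T (\<Sum>x\<in>{1..n}. mpderiv x (S y) * w x))"
  have v: "v \<in> Q.ker.cof {1..n'} Q.Rel Q.rank"
    unfolding v_def by (rule pair.cof_transfer[OF P.rank_is Q.rank_is w])
  have "conj D (coset n' I' (mvar y)) = coset n' I' (v y)" for y
  proof -
    have "\<tau> (coset n' I' (mvar y)) = coset n I (S y)"
      using S[of "mvar y"] inverse_simps(3)[OF P.pi_closed, of "S y"] by simp
    then have "conj D (coset n' I' (mvar y)) = \<sigma> (P.delta w (coset n I (S y)))"
      by (simp only: conj_apply[OF Q.pi_closed] D)
    also have "\<dots> = \<sigma> (coset n I (\<Sum>x\<in>{1..n}. mpderiv x (S y) * w x))"
      by (simp only: P.delta_pi[OF tangent] dot_def mult.commute)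
    also have "\<dots> = coset n' I' (v y)"
      by (simp only: v_def T)
    finally show ?thesis .
  qed
  moreover have "conj D \<in> Der (quot_alg n' I')"
    unfolding D by (rule conj_Der[OF P.delta_Der[OF tangent]])
  ultimately have "conj D = Q.delta v"
    using Q.Der_eq_delta by blast
  then show ?thesis
    unfolding Q.nat_der_eq using v by blast
qed

lemma nat_der_End: "nat_der n I m f \<subseteq> carrier (End_alg (quot_alg n I))"
  unfolding P.nat_der_eq using P.delta_Der[OF P.tangent_Rel] by (auto simp: Der_def)

text \<open>Conjugation takes multiplication by a to multiplication by \<sigma> a and natural
  derivations to natural derivations, hence generators to generators.\<close>

lemma conj_nat_diff_ops:
  assumes "D \<in> nat_diff_ops n I m f"
  shows "conj D \<in> nat_diff_ops n' I' m' f'"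
  using assms unfolding nat_diff_ops_def
proof (rule conj_hull_subset[rotated 2])
  show "left_mult (quot_alg n I) ` carrier (quot_alg n I) \<union> nat_der n I m f \<subseteq> carrier (End_alg (quot_alg n I))"
    using P.left_mult_End nat_der_End by blast
  show "conj T \<in> left_mult (quot_alg n' I') ` carrier (quot_alg n' I') \<union> nat_der n' I' m' f'"
    if "T \<in> left_mult (quot_alg n I) ` carrier (quot_alg n I) \<union> nat_der n I m f" for T
    using that conj_left_mult conj_nat_der iso_simps(1) by auto
qed

lemma nat_diff_ops_End: "nat_diff_ops n I m f \<subseteq> carrier (End_alg (quot_alg n I))"
  unfolding nat_diff_ops_def
  by (rule hull_minimal) (use P.left_mult_End nat_der_End P.subalgebra_carrier in auto)

end

text \<open>Each inclusion comes from one of the two directions of the isomorphism: an operator on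
  the second algebra is the conjugate of its own conjugate by the inverse.\<close>

lemma conjugate_image:
  assumes "presents n I m f" "presents n' I' m' f'" "\<sigma> \<in> alg_iso (quot_alg n I) (quot_alg n' I')"
  shows "conjugate (quot_alg n I) (quot_alg n' I') \<sigma> ` nat_der n I m f = nat_der n' I' m' f'" (is ?der)
    and "conjugate (quot_alg n I) (quot_alg n' I') \<sigma> ` nat_diff_ops n I m f = nat_diff_ops n' I' m' f'" (is ?ops)
proof -
  interpret pair: presented_pair n I m f n' I' m' f' \<sigma>
    by unfold_locales (use assms in auto)
  interpret inv: presented_pair n' I' m' f' n I m f "inv_into (carrier (quot_alg n I)) \<sigma>"
    by unfold_locales (use assms pair.inverse_iso in auto)
  have cancel: "pair.conj (inv.conj T) = T" if "T \<in> carrier (End_alg (quot_alg n' I'))" for T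
    by (rule pair.conj_inverse_conj) (use pair.Q.EndD(1)[OF that] in simp)
  show ?der
  proof
    show "pair.conj ` nat_der n I m f \<subseteq> nat_der n' I' m' f'"
      using pair.conj_nat_der by blast
    show "nat_der n' I' m' f' \<subseteq> pair.conj ` nat_der n I m f"
    proof
      fix T assume T: "T \<in> nat_der n' I' m' f'"
      have "T = pair.conj (inv.conj T)"
        using cancel[OF subsetD[OF inv.nat_der_End T]] by (rule sym)
      then show "T \<in> pair.conj ` nat_der n I m f"
        using inv.conj_nat_der[OF T] by (rule image_eqI)
    qed
  qed
  show ?ops
  proof
    show "pair.conj ` nat_diff_ops n I m f \<subseteq> nat_diff_ops n' I' m' f'"
      using pair.conj_nat_diff_ops by blast
    show "nat_diff_ops n' I' m' f' \<subseteq> pair.conj ` nat_diff_ops n I m f"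
    proof
      fix T assume T: "T \<in> nat_diff_ops n' I' m' f'"
      have "T = pair.conj (inv.conj T)"
        using cancel[OF subsetD[OF inv.nat_diff_ops_End T]] by (rule sym)
      then show "T \<in> pair.conj ` nat_diff_ops n I m f"
        using inv.conj_nat_diff_ops[OF T] by (rule image_eqI)
    qed
  qed
qed

lemma conjugate_id:
  assumes "T \<in> carrier A \<rightarrow>\<^sub>E carrier A"
  shows "conjugate A A (\<lambda>a. a) T = T"
  using assms by (auto simp: conjugate_def fun_eq_iff inv_into_f_f restrict_def PiE_iff extensional_def
      intro!: arg_cong[where f = T] inv_into_f_f[of "\<lambda>a. a", simplified])

text \<open>Two generating sets give two presentations of the same algebra, compared by the
  identity. Conjugation by it fixes every endomorphism, as these are \<open>undefined\<close>
  outside the carrier.\<close>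

lemma nat_der_nat_diff_ops_unique:
  assumes "presents n I m f" "presents n I m' f'"
  shows "nat_der n I m f = nat_der n I m' f'" and "nat_diff_ops n I m f = nat_diff_ops n I m' f'"
proof -
  let ?A = "quot_alg n I" and ?id = "\<lambda>a. a"
  have id: "?id \<in> alg_iso ?A ?A"
    unfolding alg_iso_def ring_iso_def by (auto intro: ring_hom_memI bij_betw_imageI)
  interpret pair: presented_pair n I m f n I m' f' ?id
    by unfold_locales (use assms id in auto)
  have fix_id: "conjugate ?A ?A ?id ` H = H" if "H \<subseteq> carrier (End_alg ?A)" for H
  proof -
    have "conjugate ?A ?A ?id ` H = (\<lambda>T. T) ` H"
      by (intro image_cong refl conjugate_id pair.P.EndD(1)) (use that in blast)
    then show ?thesis by simp
  qed
  show "nat_der n I m f = nat_der n I m' f'"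
    using conjugate_image(1)[OF assms id] fix_id[OF pair.nat_der_End] by simp
  show "nat_diff_ops n I m f = nat_diff_ops n I m' f'"
    using conjugate_image(2)[OF assms id] fix_id[OF pair.nat_diff_ops_End] by simp
qed

theorem theorem2p2:
  shows
    "(\<forall>n (I :: 'k::field_char_0 mpoly set) m f m' f'.
        presents n I m f \<and> presents n I m' f' \<longrightarrow>
        nat_der n I m f = nat_der n I m' f') \<and>
     (\<forall>n (I :: 'k mpoly set) m f n' I' m' f' \<sigma>.
        presents n I m f \<and> presents n' I' m' f' \<and>
        \<sigma> \<in> alg_iso (quot_alg n I) (quot_alg n' I') \<longrightarrow>
        conjugate (quot_alg n I) (quot_alg n' I') \<sigma> ` nat_der n I m f = nat_der n' I' m' f') \<and>
     (\<forall>n (I :: 'k mpoly set) m f m' f'.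
        presents n I m f \<and> presents n I m' f' \<longrightarrow>
        nat_diff_ops n I m f = nat_diff_ops n I m' f') \<and>
     (\<forall>n (I :: 'k mpoly set) m f n' I' m' f' \<sigma>.
        presents n I m f \<and> presents n' I' m' f' \<and>
        \<sigma> \<in> alg_iso (quot_alg n I) (quot_alg n' I') \<longrightarrow>
        conjugate (quot_alg n I) (quot_alg n' I') \<sigma> ` nat_diff_ops n I m f = nat_diff_ops n' I' m' f')"
  by (intro conjI allI impI; elim conjE;
      rule nat_der_nat_diff_ops_unique conjugate_image; assumption)

end
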